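(* Let $C^\bullet$ be a cochain complex of free $\mathbf{Z}^2$-persistence modules such that $\dim H^\bullet(C^\bullet)$ is finite (i.e. its cohomology has finite total dimension). Then the algorithm described in the context, applied to graded matrices $[\delta^\bullet]$ representing $C^\bullet$, computes free resolutions of $H^d(C^\bullet)$: its outputs for $d=0,1,\dots$ are pairs of graded matrices representing a free resolution of $H^d(C^\bullet)$.
   Context: Let $k$ be a field. A $\mathbf{Z}^2$-persistence module is a functor $M$ from the poset $\mathbf{Z}^2$ (product order) to finite-dimensional $k$-vector spaces; its total dimension is $\sum_z\dim M_z$. $F(z)$ is the module with $F(z)_w=k$ if $z\le w$ and $0$ otherwise, with identity structure maps between nonzero components; free modules are those isomorphic to direct sums of such. A free resolution of $M$ is a chain complex of free modules, concentrated in nonnegative degrees, quasi-isomorphic to $M$. Coboundary maps are indexed as $\delta^{d}\colon C^{d-1}\to C^{d}$. A graded matrix $A$ has entries in $k$, row grades $\mathrm{rg}^A_i$ and column grades $\mathrm{cg}^A_j$ in $\mathbf{Z}^2$. A morphism of finite rank free modules with fixed bases is represented by the graded matrix of its coefficients, with column (row) grades the grades of the basis elements of the source (target). The graded transpose of a graded $m\times l$-matrix $A$ is the graded $l\times m$-matrix with $(A^T)_{ij}=A_{m+1-j,\,l+1-i}$, $\mathrm{rg}^{A^T}_i=-\mathrm{cg}^A_{l+1-i}$, $\mathrm{cg}^{A^T}_j=-\mathrm{rg}^A_{m+1-j}$. $[\delta^d]$ is the graded matrix representing $\delta^d$. $A_j$ denotes the $j$th column of $A$. The pivot $\operatorname{piv}(b)$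 of a column $b$ is the largest index $i$ with $b_i\neq0$. For a matrix $B$ with $m$ rows and $r\in(\mathbf{Z}^2)^m$, $[B]_r$ is the graded matrix with entries of $B$, row grades $r_i$ and column grades $\bigvee_{B_{ij}\ne0}r_i$ (componentwise maximum). Let $(x,y)\preceq_{\mathrm{lex}}(x',y')$ iff $x<x'$ or ($x=x'$ and $y\le y'$), and $(x,y)\preceq_{\mathrm{colex}}(x',y')$ iff $y<y'$ or ($y=y'$ and $x\le x'$). For $b\in k^m$ and $r\in(\mathbf{Z}^2)^m$, $\operatorname{l-piv}(b)$ is the smallest index $i$ such that $b_i\ne0$ and $r_i$ takes its maximum value with respect to $\preceq_{\mathrm{lex}}$; $\operatorname{c-piv}(b)$ is defined analogously with $\preceq_{\mathrm{colex}}$; both are $0$ for $b=0$. Subroutines: - Bireduce$(B)$, for an $m\times l$-matrix $B$ with row grades $r=(r_1,\dots,r_m)$. (i) Set $p_i\gets0$ for all row indices $i$. For $j=1,\dots,l$: while $i\gets\operatorname{c-piv}(B_j)\neq0$: if $p_i=0$, set $p_i\gets j$ and leave the while loop; otherwise $B_j\gets B_j+B_{p_i}$. (ii) Reset $p_i\gets0$ for all $i$. For $j'=1,\dots,l$: set $j\gets j'$; while $i\gets\operatorname{l-piv}(B_j)\neq0$: if $p_i=0$, set $p_i\gets j$ and leave the while loop; otherwise, if $\operatorname{c-piv}(B_j)<\operatorname{c-piv}(B_{p_i})$, swap $p_i$ and $j$; then $B_j\gets B_j+B_{p_i}$. (iii) Return $[B]_r$. (The output is specified as a graded matrix whose nonzero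 columns represent a basis of the following submodule of $M=\bigoplus_iF(r_i)$: the preimage, under the canonical map from $M$ to the constant module on $\operatorname{colim}M$, of the constant module on the subspace $V\subseteq\operatorname{colim}M$ spanned by the columns of the input.) - MGSWithKer$(A)$: for a graded matrix $A$ representing a morphism of free modules, returns graded matrices $(A',K')$, where $A'$ represents a minimal generating system of $\operatorname{im}A$ and $K'$ represents a basis of $\ker A'$. - MinimizeChainComplex: given graded matrices representing a chain complex of free modules, returns graded matrices representing a quasi-isomorphic minimal chain complex of free modules, i.e. one with no direct summand isomorphic to $\cdots\to0\to F(z)\xrightarrow{\mathrm{id}}F(z)\to0\to\cdots$. Algorithm: set $q\gets\emptyset$. For $d=0,1,\dots$: 1. (clearing) for each $j\in q$, set $[\delta^{d+1}]_j\gets0$; 2. $[i^{d+1}]\gets$ Bireduce$([\delta^{d+1}])$; 3. $q\gets\{\operatorname{piv}[i^{d+1}]_1,\dots,\operatorname{piv}[i^{d+1}]_n\}$, where $n$ is the number of columns of $[i^{d+1}]$; 4. $([i^{d+1}]^T,[p^{d+1}]^T)\gets$ MGSWithKer$([i^{d+1}]^T)$; 5. output MinimizeChainComplex$([i^{d+1}],[p^{d+1}])$.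
   Formalization: Output d is shown to resolve H^{d+2}, with H^0=H^1=0 (the printed pairing with H^d is false); Bireduce scales the added column to cancel the pivot, compares c-pivots by colex grade then index (index order fails on unsorted rows), and drops zero columns; C is in degrees ≥0. *)

theory Defs
  imports
    "Jordan_Normal_Form.VS_Connect"
    "Jordan_Normal_Form.Column_Operations"
    "HOL-Algebra.AbelCoset"
    "HOL-Analysis.Infinite_Sum"
    "HOL-Library.Product_Order"
    "HOL-Library.Monad_Syntax"
begin

hide_const (open) Multiset.mult Modules.module Modules.module_hom

section \<open>Persistence modules\<close>

text \<open>\<^theory>\<open>HOL-Library.Product_Order\<close> supplies the product order and the componentwise join.\<close>

type_synonym grade = "int \<times> int"

record ('k, 'v) pmodule =
  pspace :: "grade \<Rightarrow> ('k, 'v) module"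
  pmap :: "grade \<Rightarrow> grade \<Rightarrow> 'v \<Rightarrow> 'v"

abbreviation pcarrier :: "('k, 'v) pmodule \<Rightarrow> grade \<Rightarrow> 'v set" where
  "pcarrier M z \<equiv> carrier (pspace M z)"

definition persistence_module :: "('k::field, 'v) pmodule \<Rightarrow> bool" where
  "persistence_module M \<longleftrightarrow>
    (\<forall>z. vectorspace class_ring (pspace M z) \<and> vectorspace.fin_dim class_ring (pspace M z)) \<and>
    (\<forall>z w. z \<le> w \<longrightarrow> pmap M z w \<in> module_hom class_ring (pspace M z) (pspace M w)) \<and>
    (\<forall>z. \<forall>x\<in>pcarrier M z. pmap M z z x = x) \<and>
    (\<forall>u v w. u \<le> v \<longrightarrow> v \<le> w \<longrightarrow>
      (\<forall>x\<in>pcarrier M u. pmap M v w (pmap M u v x) = pmap M u w x))"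

definition pmorphism ::
  "('k::field, 'v) pmodule \<Rightarrow> ('k, 'w) pmodule \<Rightarrow> (grade \<Rightarrow> 'v \<Rightarrow> 'w) \<Rightarrow> bool" where
  "pmorphism M N f \<longleftrightarrow>
    (\<forall>z. f z \<in> module_hom class_ring (pspace M z) (pspace N z)) \<and>
    (\<forall>z w. z \<le> w \<longrightarrow> (\<forall>x\<in>pcarrier M z. f w (pmap M z w x) = pmap N z w (f z x)))"

definition pisomorphism ::
  "('k::field, 'v) pmodule \<Rightarrow> ('k, 'w) pmodule \<Rightarrow> (grade \<Rightarrow> 'v \<Rightarrow> 'w) \<Rightarrow> bool" where
  "pisomorphism M N f \<longleftrightarrow>
    pmorphism M N f \<and> (\<forall>z. bij_betw (f z) (pcarrier M z) (pcarrier N z))"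

definition zero_pmodule :: "('k, 'v) pmodule \<Rightarrow> bool" where
  "zero_pmodule M \<longleftrightarrow> (\<forall>z. pcarrier M z = {\<zero>\<^bsub>pspace M z\<^esub>})"

definition total_dim :: "('k::field, 'v) pmodule \<Rightarrow> ennreal" where
  "total_dim M = (\<Sum>\<^sub>\<infinity>z. of_nat (vectorspace.dim class_ring (pspace M z)))"

text \<open>\<open>free_pm [z\<^sub>1, \<dots>, z\<^sub>n]\<close> is the direct sum of the modules \<open>F(z\<^sub>i)\<close>: at grade \<open>w\<close>, the tuples in
  \<open>k\<^sup>n\<close> whose \<open>i\<close>th entry vanishes unless \<open>z\<^sub>i \<le> w\<close>. In particular \<open>free_pm [z]\<close> is \<open>F(z)\<close>, and
  \<open>free_pm []\<close> is zero.\<close>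

definition free_space :: "grade list \<Rightarrow> grade \<Rightarrow> ('k::field, 'k vec) module" where
  "free_space gs w = (module_vec TYPE('k) (length gs))
    \<lparr>carrier := {v \<in> carrier_vec (length gs). \<forall>i<length gs. v $ i \<noteq> 0 \<longrightarrow> gs ! i \<le> w}\<rparr>"

definition free_pm :: "grade list \<Rightarrow> ('k::field, 'k vec) pmodule" where
  "free_pm gs = \<lparr>pspace = free_space gs, pmap = (\<lambda>z w v. v)\<rparr>"

definition free_finite_rank :: "('k::field, 'v) pmodule \<Rightarrow> bool" where
  "free_finite_rank M \<longleftrightarrow> (\<exists>gs \<phi>. pisomorphism (free_pm gs) M \<phi>)"


section \<open>Complexes\<close>

text \<open>Complexes are indexed cohomologically over the integers, \<open>pdiff C d\<close> being the map
  \<open>C\<^sup>d\<^sup>-\<^sup>1 \<rightarrow> C\<^sup>d\<close>. A chain complex is regarded as a cochain complex by placing chain degree \<open>n\<close>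
  in degree \<open>-n\<close>.\<close>

record ('k, 'v) pcomplex =
  pobj :: "int \<Rightarrow> ('k, 'v) pmodule"
  pdiff :: "int \<Rightarrow> grade \<Rightarrow> 'v \<Rightarrow> 'v"

definition cochain_complex :: "('k::field, 'v) pcomplex \<Rightarrow> bool" where
  "cochain_complex C \<longleftrightarrow>
    (\<forall>d. persistence_module (pobj C d)) \<and>
    (\<forall>d. pmorphism (pobj C (d - 1)) (pobj C d) (pdiff C d)) \<and>
    (\<forall>d z. \<forall>x\<in>pcarrier (pobj C (d - 1)) z.
      pdiff C (d + 1) z (pdiff C d z x) = \<zero>\<^bsub>pspace (pobj C (d + 1)) z\<^esub>)"

definition cocycles :: "('k, 'v) pcomplex \<Rightarrow> int \<Rightarrow> grade \<Rightarrow> 'v set" where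
  "cocycles C d z =
    {x \<in> pcarrier (pobj C d) z. pdiff C (d + 1) z x = \<zero>\<^bsub>pspace (pobj C (d + 1)) z\<^esub>}"

definition coboundaries :: "('k, 'v) pcomplex \<Rightarrow> int \<Rightarrow> grade \<Rightarrow> 'v set" where
  "coboundaries C d z = pdiff C d z ` pcarrier (pobj C (d - 1)) z"

definition quotient_space :: "('k, 'v) module \<Rightarrow> 'v set \<Rightarrow> ('k, 'v set) module" where
  "quotient_space V N =
    \<lparr>carrier = a_rcosets\<^bsub>V\<^esub> N, mult = undefined, one = undefined, zero = N, add = set_add V,
     smult = (\<lambda>a X. \<Union>x\<in>X. N +>\<^bsub>V\<^esub> (a \<odot>\<^bsub>V\<^esub> x))\<rparr>"

definition cohomology_map ::
  "('k, 'w) pcomplex \<Rightarrow> int \<Rightarrow> grade \<Rightarrow> ('v \<Rightarrow> 'w) \<Rightarrow> 'v set \<Rightarrow> 'w set" where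
  "cohomology_map C d z f X = (\<Union>x\<in>X. coboundaries C d z +>\<^bsub>pspace (pobj C d) z\<^esub> f x)"

definition cohomology :: "('k, 'v) pcomplex \<Rightarrow> int \<Rightarrow> ('k, 'v set) pmodule" where
  "cohomology C d =
    \<lparr>pspace = (\<lambda>z. quotient_space ((pspace (pobj C d) z)\<lparr>carrier := cocycles C d z\<rparr>)
                                  (coboundaries C d z)),
     pmap = (\<lambda>z w. cohomology_map C d w (pmap (pobj C d) z w))\<rparr>"

definition chain_map ::
  "('k::field, 'v) pcomplex \<Rightarrow> ('k, 'w) pcomplex \<Rightarrow> (int \<Rightarrow> grade \<Rightarrow> 'v \<Rightarrow> 'w) \<Rightarrow> bool" where
  "chain_map C D f \<longleftrightarrow>
    (\<forall>d. pmorphism (pobj C d) (pobj D d) (f d)) \<and>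
    (\<forall>d z. \<forall>x\<in>pcarrier (pobj C (d - 1)) z. f d z (pdiff C d z x) = pdiff D d z (f (d - 1) z x))"

definition quasi_isomorphism ::
  "('k::field, 'v) pcomplex \<Rightarrow> ('k, 'w) pcomplex \<Rightarrow> (int \<Rightarrow> grade \<Rightarrow> 'v \<Rightarrow> 'w) \<Rightarrow> bool" where
  "quasi_isomorphism C D f \<longleftrightarrow> chain_map C D f \<and>
    (\<forall>d z. bij_betw (cohomology_map D d z (f d z))
      (pcarrier (cohomology C d) z) (pcarrier (cohomology D d) z))"

text \<open>A single quasi-isomorphism \<open>C \<rightarrow> D\<close> suffices: below, \<open>C\<close> is always a bounded complex of free
  modules, so every zigzag of quasi-isomorphisms between \<open>C\<close> and \<open>D\<close> can be replaced by one.\<close>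

definition quasi_isomorphic :: "('k::field, 'v) pcomplex \<Rightarrow> ('k, 'w) pcomplex \<Rightarrow> bool" where
  "quasi_isomorphic C D \<longleftrightarrow> (\<exists>f. quasi_isomorphism C D f)"

definition complex_isomorphic :: "('k::field, 'v) pcomplex \<Rightarrow> ('k, 'w) pcomplex \<Rightarrow> bool" where
  "complex_isomorphic C D \<longleftrightarrow>
    (\<exists>f. chain_map C D f \<and> (\<forall>d. pisomorphism (pobj C d) (pobj D d) (f d)))"

definition in_degree_zero :: "('k, 'v) pmodule \<Rightarrow> ('k, 'v) pcomplex" where
  "in_degree_zero M =
    \<lparr>pobj = (\<lambda>d. if d = 0 then M
                 else \<lparr>pspace = (\<lambda>z. (pspace M z)\<lparr>carrier := {\<zero>\<^bsub>pspace M z\<^esub>}\<rparr>),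
                       pmap = (\<lambda>z w x. \<zero>\<^bsub>pspace M w\<^esub>)\<rparr>),
     pdiff = (\<lambda>d z x. \<zero>\<^bsub>pspace M z\<^esub>)\<rparr>"

definition free_resolution :: "('k::field, 'v) pcomplex \<Rightarrow> ('k, 'w) pmodule \<Rightarrow> bool" where
  "free_resolution F M \<longleftrightarrow>
    cochain_complex F \<and> (\<forall>d. free_finite_rank (pobj F d)) \<and> (\<forall>d>0. zero_pmodule (pobj F d)) \<and>
    quasi_isomorphic F (in_degree_zero M)"

definition complex_sum ::
  "('k::field, 'v) pcomplex \<Rightarrow> ('k, 'w) pcomplex \<Rightarrow> ('k, 'v \<times> 'w) pcomplex" where
  "complex_sum C D =
    \<lparr>pobj = (\<lambda>d. \<lparr>pspace = (\<lambda>z. direct_sum (pspace (pobj C d) z) (pspace (pobj D d) z)),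
                  pmap = (\<lambda>z w. map_prod (pmap (pobj C d) z w) (pmap (pobj D d) z w))\<rparr>),
     pdiff = (\<lambda>d z. map_prod (pdiff C d z) (pdiff D d z))\<rparr>"

text \<open>The complex \<open>\<dots> \<rightarrow> 0 \<rightarrow> F(g) \<rightarrow> F(g) \<rightarrow> 0 \<rightarrow> \<dots>\<close> with the identity in the middle, in degrees
  \<open>n - 1\<close> and \<open>n\<close>.\<close>

definition identity_complex :: "int \<Rightarrow> grade \<Rightarrow> ('k::field, 'k vec) pcomplex" where
  "identity_complex n g =
    \<lparr>pobj = (\<lambda>d. if d = n - 1 \<or> d = n then free_pm [g] else free_pm []),
     pdiff = (\<lambda>d z v. if d = n then v else if d = n - 1 then 0\<^sub>v 1 else 0\<^sub>v 0)\<rparr>"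

definition minimal_complex :: "('k::field, 'v) pcomplex \<Rightarrow> bool" where
  "minimal_complex C \<longleftrightarrow>
    \<not> (\<exists>n g (R :: ('k, 'v) pcomplex).
        cochain_complex R \<and> complex_isomorphic C (complex_sum (identity_complex n g) R))"


section \<open>Graded matrices\<close>

text \<open>Rows and columns are numbered from \<open>0\<close>.\<close>

record 'k gmatrix =
  ent :: "'k mat"
  rgr :: "grade list"
  cgr :: "grade list"

definition graded_matrix :: "'k gmatrix \<Rightarrow> bool" where
  "graded_matrix A \<longleftrightarrow> ent A \<in> carrier_mat (length (rgr A)) (length (cgr A))"

text \<open>A graded matrix represents a morphism \<open>free_pm (cgr A) \<rightarrow> free_pm (rgr A)\<close> iff a nonzero
  entry in position \<open>(i, j)\<close> forces the \<open>i\<close>th row grade to lie below the \<open>j\<close>th column grade, because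
  \<open>F(z) \<rightarrow> F(w)\<close> can be nonzero only if \<open>w \<le> z\<close>.\<close>

definition morphism_matrix :: "'k::field gmatrix \<Rightarrow> bool" where
  "morphism_matrix A \<longleftrightarrow> graded_matrix A \<and>
    (\<forall>i<length (rgr A). \<forall>j<length (cgr A). ent A $$ (i, j) \<noteq> 0 \<longrightarrow> rgr A ! i \<le> cgr A ! j)"

definition gtranspose :: "'k gmatrix \<Rightarrow> 'k gmatrix" where
  "gtranspose A =
    (let m = length (rgr A); l = length (cgr A) in
      \<lparr>ent = mat l m (\<lambda>(i, j). ent A $$ (m - 1 - j, l - 1 - i)),
       rgr = rev (map uminus (cgr A)), cgr = rev (map uminus (rgr A))\<rparr>)"

text \<open>\<open>\<phi> d\<close> is the isomorphism given by the fixed basis of \<open>C\<^sup>d\<close>, whose grades are \<open>G d\<close>.\<close>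

definition represents_cochain_complex ::
  "(nat \<Rightarrow> 'k::field gmatrix) \<Rightarrow> ('k, 'v) pcomplex \<Rightarrow> bool" where
  "represents_cochain_complex \<Delta> C \<longleftrightarrow>
    (\<exists>G \<phi>. (\<forall>d. pisomorphism (free_pm (G d)) (pobj C (int d)) (\<phi> d)) \<and>
      (\<forall>d. morphism_matrix (\<Delta> (Suc d)) \<and> cgr (\<Delta> (Suc d)) = G d \<and> rgr (\<Delta> (Suc d)) = G (Suc d) \<and>
        (\<forall>z. \<forall>v\<in>pcarrier (free_pm (G d)) z.
          pdiff C (int (Suc d)) z (\<phi> d z v) = \<phi> (Suc d) z (ent (\<Delta> (Suc d)) *\<^sub>v v))))"

text \<open>A pair \<open>(A, B)\<close> of graded matrices stands for a chain complex \<open>F\<^sub>2 \<rightarrow> F\<^sub>1 \<rightarrow> F\<^sub>0\<close> with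
  first map \<open>A\<close> and second map \<open>B\<close>.\<close>

definition represents_chain_complex :: "'k::field gmatrix \<times> 'k gmatrix \<Rightarrow> bool" where
  "represents_chain_complex = (\<lambda>(A, B).
    morphism_matrix A \<and> morphism_matrix B \<and> rgr A = cgr B \<and>
    ent B * ent A = 0\<^sub>m (length (rgr B)) (length (cgr A)))"

definition matrix_complex :: "'k::field gmatrix \<times> 'k gmatrix \<Rightarrow> ('k, 'k vec) pcomplex" where
  "matrix_complex = (\<lambda>(A, B).
    \<lparr>pobj = (\<lambda>d. if d = 0 then free_pm (rgr B) else if d = -1 then free_pm (cgr B)
                 else if d = -2 then free_pm (cgr A) else free_pm []),
     pdiff = (\<lambda>d z v. if d = 0 then ent B *\<^sub>v v else if d = -1 then ent A *\<^sub>v v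
                      else if d = -2 then 0\<^sub>v (length (cgr A)) else 0\<^sub>v 0)\<rparr>)"

definition represents_free_resolution ::
  "'k::field gmatrix \<times> 'k gmatrix \<Rightarrow> ('k, 'v) pmodule \<Rightarrow> bool" where
  "represents_free_resolution P M \<longleftrightarrow>
    represents_chain_complex P \<and> free_resolution (matrix_complex P) M"


section \<open>Bireduce\<close>

definition lex_le :: "grade \<Rightarrow> grade \<Rightarrow> bool" where
  "lex_le p q \<longleftrightarrow> fst p < fst q \<or> (fst p = fst q \<and> snd p \<le> snd q)"

definition colex_le :: "grade \<Rightarrow> grade \<Rightarrow> bool" where
  "colex_le p q \<longleftrightarrow> snd p < snd q \<or> (snd p = snd q \<and> fst p \<le> fst q)"

text \<open>The pivots of the zero column are \<open>None\<close>.\<close>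

definition pivot_wrt ::
  "(grade \<Rightarrow> grade \<Rightarrow> bool) \<Rightarrow> grade list \<Rightarrow> 'k::zero vec \<Rightarrow> nat option" where
  "pivot_wrt leq r b =
    (if \<forall>i<dim_vec b. b $ i = 0 then None
     else Some (LEAST i. i < dim_vec b \<and> b $ i \<noteq> 0 \<and>
       (\<forall>j<dim_vec b. b $ j \<noteq> 0 \<longrightarrow> leq (r ! j) (r ! i))))"

abbreviation l_piv :: "grade list \<Rightarrow> 'k::zero vec \<Rightarrow> nat option" where
  "l_piv \<equiv> pivot_wrt lex_le"

abbreviation c_piv :: "grade list \<Rightarrow> 'k::zero vec \<Rightarrow> nat option" where
  "c_piv \<equiv> pivot_wrt colex_le"

text \<open>The comparison of colexicographic pivots: by colexicographic grade, and by index between equal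
  grades. If the row grades are sorted colexicographically, this is the comparison of indices.
  Comparing indices when the rows are not so sorted would break the reduction: adding a column with
  a larger colexicographic pivot grade changes the grade of the column added to.\<close>

definition c_less :: "grade list \<Rightarrow> nat \<Rightarrow> nat \<Rightarrow> bool" where
  "c_less r i i' \<longleftrightarrow>
    colex_le (r ! i) (r ! i') \<and> (r ! i = r ! i' \<longrightarrow> i < i')"

text \<open>Adds to column \<open>j\<close> the multiple of column \<open>k\<close> that cancels its entry in row \<open>i\<close>. Over the field
  with two elements this is \<open>B\<^sub>j \<leftarrow> B\<^sub>j + B\<^sub>k\<close> whenever both entries are nonzero.\<close>

definition cancel_entry :: "nat \<Rightarrow> nat \<Rightarrow> nat \<Rightarrow> 'k::field mat \<Rightarrow> 'k mat" where
  "cancel_entry i j k B = addcol (- (B $$ (i, j)) / B $$ (i, k)) j k B"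

text \<open>The two while loops, as partial functions with value \<open>None\<close> in case of nontermination.\<close>

partial_function (option) c_reduce ::
  "grade list \<Rightarrow> nat \<Rightarrow> 'k::field mat \<Rightarrow> (nat \<Rightarrow> nat option) \<Rightarrow> ('k mat \<times> (nat \<Rightarrow> nat option)) option"
where
  "c_reduce r j B p =
    (case c_piv r (col B j) of
       None \<Rightarrow> Some (B, p)
     | Some i \<Rightarrow>
         (case p i of
            None \<Rightarrow> Some (B, p(i \<mapsto> j))
          | Some k \<Rightarrow> c_reduce r j (cancel_entry i j k B) p))"

partial_function (option) l_reduce ::
  "grade list \<Rightarrow> nat \<Rightarrow> 'k::field mat \<Rightarrow> (nat \<Rightarrow> nat option) \<Rightarrow> ('k mat \<times> (nat \<Rightarrow> nat option)) option"
where
  "l_reduce r j B p =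
    (case l_piv r (col B j) of
       None \<Rightarrow> Some (B, p)
     | Some i \<Rightarrow>
         (case p i of
            None \<Rightarrow> Some (B, p(i \<mapsto> j))
          | Some k \<Rightarrow>
              (if c_less r (the (c_piv r (col B j))) (the (c_piv r (col B k)))
               then l_reduce r k (cancel_entry i k j B) (p(i \<mapsto> j))
               else l_reduce r j (cancel_entry i j k B) p)))"

fun for_columns :: "(nat \<Rightarrow> 'a \<Rightarrow> 'b \<Rightarrow> ('a \<times> 'b) option) \<Rightarrow> nat list \<Rightarrow> 'a \<Rightarrow> 'b \<Rightarrow> 'a option" where
  "for_columns f [] B p = Some B"
| "for_columns f (j # js) B p = do { (B', p') \<leftarrow> f j B p; for_columns f js B' p' }"

definition with_row_grades :: "'k::zero mat \<Rightarrow> grade list \<Rightarrow> 'k gmatrix" where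
  "with_row_grades B r =
    \<lparr>ent = B, rgr = r,
     cgr = map (\<lambda>j. Sup_fin {r ! i | i. i < dim_row B \<and> B $$ (i, j) \<noteq> 0}) [0..<dim_col B]\<rparr>"

definition nonzero_columns :: "'k::zero mat \<Rightarrow> 'k mat" where
  "nonzero_columns B = mat_of_cols (dim_row B) (filter (\<lambda>b. b \<noteq> 0\<^sub>v (dim_row B)) (cols B))"

text \<open>Zero columns are dropped, as the join defining their grade would be empty.\<close>

definition bireduce :: "'k::field gmatrix \<Rightarrow> 'k gmatrix option" where
  "bireduce A =
    do {
      B \<leftarrow> for_columns (c_reduce (rgr A)) [0..<dim_col (ent A)] (ent A) Map.empty;
      B' \<leftarrow> for_columns (l_reduce (rgr A)) [0..<dim_col (ent A)] B Map.empty;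
      Some (with_row_grades (nonzero_columns B') (rgr A))
    }"


section \<open>Specifications of the other subroutines\<close>

text \<open>The submodule of \<open>free_pm (rgr A)\<close> generated by the columns of \<open>A\<close> with index in \<open>J\<close>, each
  taken as an element of its column grade.\<close>

definition generated_by :: "'k::field gmatrix \<Rightarrow> nat set \<Rightarrow> grade \<Rightarrow> 'k vec set" where
  "generated_by A J z =
    {ent A *\<^sub>v v | v. v \<in> pcarrier (free_pm (cgr A)) z \<and>
                     (\<forall>j<length (cgr A). v $ j \<noteq> 0 \<longrightarrow> j \<in> J)}"

definition image_at :: "'k::field gmatrix \<Rightarrow> grade \<Rightarrow> 'k vec set" where
  "image_at A z = (\<lambda>v. ent A *\<^sub>v v) ` pcarrier (free_pm (cgr A)) z"

definition kernel_at :: "'k::field gmatrix \<Rightarrow> grade \<Rightarrow> 'k vec set" where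
  "kernel_at A z = {v \<in> pcarrier (free_pm (cgr A)) z. ent A *\<^sub>v v = 0\<^sub>v (length (rgr A))}"

definition minimal_generating_system :: "'k::field gmatrix \<Rightarrow> (grade \<Rightarrow> 'k vec set) \<Rightarrow> bool" where
  "minimal_generating_system A S \<longleftrightarrow>
    morphism_matrix A \<and> generated_by A {..<length (cgr A)} = S \<and>
    (\<forall>J. J \<subset> {..<length (cgr A)} \<longrightarrow> generated_by A J \<noteq> S)"

definition basis_matrix :: "'k::field gmatrix \<Rightarrow> (grade \<Rightarrow> 'k vec set) \<Rightarrow> bool" where
  "basis_matrix A S \<longleftrightarrow>
    morphism_matrix A \<and>
    (\<forall>z. bij_betw (\<lambda>v. ent A *\<^sub>v v) (pcarrier (free_pm (cgr A)) z) (S z))"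

definition mgs_with_ker_spec ::
  "('k::field gmatrix \<Rightarrow> 'k gmatrix \<times> 'k gmatrix) \<Rightarrow> bool" where
  "mgs_with_ker_spec mgs_with_ker \<longleftrightarrow>
    (\<forall>A A' K'. morphism_matrix A \<longrightarrow> mgs_with_ker A = (A', K') \<longrightarrow>
      rgr A' = rgr A \<and> minimal_generating_system A' (image_at A) \<and>
      rgr K' = cgr A' \<and> basis_matrix K' (kernel_at A'))"

definition minimize_spec ::
  "('k::field gmatrix \<times> 'k gmatrix \<Rightarrow> 'k gmatrix \<times> 'k gmatrix) \<Rightarrow> bool" where
  "minimize_spec minimize \<longleftrightarrow>
    (\<forall>P. represents_chain_complex P \<longrightarrow>
      represents_chain_complex (minimize P) \<and>
      quasi_isomorphic (matrix_complex P) (matrix_complex (minimize P)) \<and>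
      minimal_complex (matrix_complex (minimize P)))"


section \<open>The algorithm\<close>

definition clear_columns :: "nat set \<Rightarrow> 'k::zero gmatrix \<Rightarrow> 'k gmatrix" where
  "clear_columns q A = A\<lparr>ent := mat (dim_row (ent A)) (dim_col (ent A))
    (\<lambda>(i, j). if j \<in> q then 0 else ent A $$ (i, j))\<rparr>"

definition piv :: "'k::zero vec \<Rightarrow> nat" where
  "piv b = Max {i. i < dim_vec b \<and> b $ i \<noteq> 0}"

text \<open>One pass of the loop body on \<open>A = [\<delta>\<^sup>d\<^sup>+\<^sup>1]\<close>; the result is the new value of \<open>q\<close> and the output.\<close>

definition loop_body ::
  "('k::field gmatrix \<Rightarrow> 'k gmatrix \<times> 'k gmatrix) \<Rightarrow>
   ('k gmatrix \<times> 'k gmatrix \<Rightarrow> 'k gmatrix \<times> 'k gmatrix) \<Rightarrow>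
   'k gmatrix \<Rightarrow> nat set \<Rightarrow> (nat set \<times> 'k gmatrix \<times> 'k gmatrix) option" where
  "loop_body mgs_with_ker minimize A q =
    do {
      I \<leftarrow> bireduce (clear_columns q A);
      let q' = piv ` set (cols (ent I));
      let (I', P') = mgs_with_ker (gtranspose I);
      Some (q', minimize (gtranspose I', gtranspose P'))
    }"

primrec iteration ::
  "('k::field gmatrix \<Rightarrow> 'k gmatrix \<times> 'k gmatrix) \<Rightarrow>
   ('k gmatrix \<times> 'k gmatrix \<Rightarrow> 'k gmatrix \<times> 'k gmatrix) \<Rightarrow>
   (nat \<Rightarrow> 'k gmatrix) \<Rightarrow> nat \<Rightarrow> (nat set \<times> 'k gmatrix \<times> 'k gmatrix) option" where
  "iteration mgs_with_ker minimize \<Delta> 0 = loop_body mgs_with_ker minimize (\<Delta> (Suc 0)) {}"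
| "iteration mgs_with_ker minimize \<Delta> (Suc d) =
    do {
      (q, _) \<leftarrow> iteration mgs_with_ker minimize \<Delta> d;
      loop_body mgs_with_ker minimize (\<Delta> (Suc (Suc d))) q
    }"

definition algorithm_output ::
  "('k::field gmatrix \<Rightarrow> 'k gmatrix \<times> 'k gmatrix) \<Rightarrow>
   ('k gmatrix \<times> 'k gmatrix \<Rightarrow> 'k gmatrix \<times> 'k gmatrix) \<Rightarrow>
   (nat \<Rightarrow> 'k gmatrix) \<Rightarrow> nat \<Rightarrow> ('k gmatrix \<times> 'k gmatrix) option" where
  "algorithm_output mgs_with_ker minimize \<Delta> d =
    map_option snd (iteration mgs_with_ker minimize \<Delta> d)"

end

theory Submission
  imports Defs
begin

text \<open>Bireduction: adding a column to one whose colexicographic pivot grade is not smaller keeps the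
  columns free of cancellation in the second coordinate, however ties are broken; the second
  pass makes the lexicographic pivots distinct, so that there is no cancellation in the first
  coordinate either. Hence a combination of the columns lies in grade \<open>z\<close> iff all columns involved do,
  and \<open>i\<^sup>d\<^sup>+\<^sup>1\<close> is a basis of the cocycle module \<open>Z\<^sup>d\<^sup>+\<^sup>1\<close>, because the complex is exact in the colimit.
  Clearing does not change the column space, as the cleared columns are combinations of earlier ones.

  The complex \<open>Z\<^sup>d\<^sup>+\<^sup>1 \<rightarrow> C\<^sup>d\<^sup>+\<^sup>1 \<rightarrow> Z\<^sup>d\<^sup>+\<^sup>2\<close> is a free resolution of \<open>H\<^sup>d\<^sup>+\<^sup>2\<close>. As the cohomology vanishes far out in
  either direction of the plane, the transpose of \<open>C\<^sup>d\<^sup>+\<^sup>1 \<rightarrow> Z\<^sup>d\<^sup>+\<^sup>2\<close> is a basis of the kernel of the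
  transpose of \<open>Z\<^sup>d\<^sup>+\<^sup>1 \<rightarrow> C\<^sup>d\<^sup>+\<^sup>1\<close>. So the matrices computed by the algorithm and those of this resolution
  are transposes of two resolutions of one and the same module, hence homotopy equivalent.\<close>

section \<open>Pivots and column reduction\<close>

text \<open>Finiteness of the cohomology is used at two strengths. In a grade above all generators
  it identifies the column space of a coboundary matrix with the kernel of the next one; this is why
  a pass of the loop can find the cocycles of degree \<open>d + 1\<close> without looking at the
  next matrix. In grades with only one large coordinate it yields, in elementary terms, that Hom and
  the first Ext from the cohomology module to free modules vanish, which is what makes the
  transposed resolution left exact.

  The obstacle is that MGSWithKer keeps of the basis \<open>I\<close> nothing but its column grades
  and the image of its transpose, so the returned pair need not contain \<open>I\<close> or a
  coboundary matrix. The comparison of resolutions therefore starts from equal images in every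
  grade, and no cokernel module is constructed. Its outcome is recorded as a surjection from the
  last free module onto the cohomology with known kernel. In that form, called
  \<open>augmentation\<close>, it survives minimization, whose specification offers only a
  quasi-isomorphism leaving the unminimized complex.\<close>

definition mat_range :: "'k::field mat \<Rightarrow> 'k vec set" where
  "mat_range B = {B *\<^sub>v a | a. a \<in> carrier_vec (dim_col B)}"

text \<open>A common abstraction of \<open>lex_le\<close> and \<open>colex_le\<close>, so that the
  pivot lemmas are proved once for both passes.\<close>

definition grade_order :: "(grade \<Rightarrow> grade \<Rightarrow> bool) \<Rightarrow> bool" where
  "grade_order leq \<longleftrightarrow> (\<forall>p q. leq p q \<or> leq q p) \<and> (\<forall>p q. leq p q \<longrightarrow> leq q p \<longrightarrow> p = q) \<and>
    (\<forall>p q s. leq p q \<longrightarrow> leq q s \<longrightarrow> leq p s)"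

lemma grade_order_lex: "grade_order lex_le"
  unfolding grade_order_def lex_le_def by (auto simp: prod_eq_iff)

lemma grade_order_colex: "grade_order colex_le"
  unfolding grade_order_def colex_le_def by (auto simp: prod_eq_iff)

text \<open>The order on row indices for which the pivot of a column is its largest nonzero index.\<close>

definition row_le :: "(grade \<Rightarrow> grade \<Rightarrow> bool) \<Rightarrow> grade list \<Rightarrow> nat \<Rightarrow> nat \<Rightarrow> bool" where
  "row_le leq r i i' \<longleftrightarrow> leq (r ! i) (r ! i') \<and> (r ! i = r ! i' \<longrightarrow> i' \<le> i)"

lemma row_le_total: "grade_order leq \<Longrightarrow> row_le leq r i i' \<or> row_le leq r i' i"
  unfolding row_le_def grade_order_def by (metis nle_le)

lemma row_le_antisym: "grade_order leq \<Longrightarrow> row_le leq r i i' \<Longrightarrow> row_le leq r i' i \<Longrightarrow> i = i'"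
  unfolding row_le_def grade_order_def by (metis le_antisym)

lemma row_le_trans:
  "grade_order leq \<Longrightarrow> row_le leq r i j \<Longrightarrow> row_le leq r j k \<Longrightarrow> row_le leq r i k"
  unfolding row_le_def grade_order_def by (metis le_trans)

lemma row_le_refl: "grade_order leq \<Longrightarrow> row_le leq r i i"
  unfolding row_le_def grade_order_def by blast

lemma finite_row_max:
  assumes "grade_order leq" "finite S" "S \<noteq> {}"
  shows "\<exists>i\<in>S. \<forall>j\<in>S. row_le leq r j i"
  using assms(2,3)
proof (induction rule: finite_ne_induct)
  case (singleton x)
  then show ?case using row_le_refl[OF assms(1)] by auto
next
  case (insert x F)
  then obtain i where i: "i \<in> F" "\<forall>j\<in>F. row_le leq r j i" by auto
  show ?case
  proof (cases "row_le leq r x i")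
    case True
    then show ?thesis using i by auto
  next
    case False
    then have "row_le leq r i x" using row_le_total[OF assms(1)] by blast
    then show ?thesis
      using i row_le_refl[OF assms(1)] row_le_trans[OF assms(1)] by blast
  qed
qed

lemma pivot_wrt_None: "pivot_wrt leq r b = None \<longleftrightarrow> (\<forall>i<dim_vec b. b $ i = 0)"
  unfolding pivot_wrt_def by auto

text \<open>Among the nonzero entries of maximal grade, the one of least index is the largest for
  \<open>row_le\<close>, because ties in grade are ordered there by decreasing index.\<close>

lemma pivot_wrt_SomeD:
  assumes leq: "grade_order leq" and "pivot_wrt leq r b = Some i"
  shows "i < dim_vec b" "b $ i \<noteq> 0" "\<And>j. j < dim_vec b \<Longrightarrow> b $ j \<noteq> 0 \<Longrightarrow> row_le leq r j i"
proof -
  let ?S = "{i. i < dim_vec b \<and> b $ i \<noteq> 0}"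
  let ?P = "\<lambda>i. i < dim_vec b \<and> b $ i \<noteq> 0 \<and> (\<forall>j<dim_vec b. b $ j \<noteq> 0 \<longrightarrow> leq (r ! j) (r ! i))"
  have i: "i = (LEAST i. ?P i)" and ne: "?S \<noteq> {}"
    using assms(2) unfolding pivot_wrt_def by (auto split: if_splits)
  obtain i0 where "i0 \<in> ?S" "\<forall>j\<in>?S. row_le leq r j i0"
    using finite_row_max[OF leq _ ne] by auto
  then have "?P i0" unfolding row_le_def by auto
  then have P: "?P i" unfolding i by (rule LeastI)
  then show "i < dim_vec b" "b $ i \<noteq> 0" by auto
  fix j assume j: "j < dim_vec b" "b $ j \<noteq> 0"
  have "i \<le> j" if "r ! j = r ! i"
    using P that j unfolding i by (intro Least_le) (auto simp: i[symmetric])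
  then show "row_le leq r j i" using P j unfolding row_le_def by auto
qed

text \<open>The position of a row in the order \<open>row_le\<close>, as a natural number that can
  serve as a termination measure.\<close>

definition row_rank :: "(grade \<Rightarrow> grade \<Rightarrow> bool) \<Rightarrow> grade list \<Rightarrow> nat \<Rightarrow> nat \<Rightarrow> nat" where
  "row_rank leq r m i = card {j. j < m \<and> row_le leq r j i}"

lemma row_rank_less:
  assumes "grade_order leq" "row_le leq r i i'" "i \<noteq> i'" "i' < m"
  shows "row_rank leq r m i < row_rank leq r m i'"
proof -
  have "{j. j < m \<and> row_le leq r j i} \<subset> {j. j < m \<and> row_le leq r j i'}"
    using assms row_le_trans[OF assms(1)] row_le_refl[OF assms(1)] row_le_antisym[OF assms(1)]
    by blast
  then show ?thesis unfolding row_rank_def by (intro psubset_card_mono) auto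
qed

section \<open>Effect of a single column operation on pivots and column space\<close>

lemma dim_cancel_entry[simp]:
  "dim_row (cancel_entry i j k B) = dim_row B" "dim_col (cancel_entry i j k B) = dim_col B"
  unfolding cancel_entry_def by auto

lemma col_cancel_entry_other:
  "c < dim_col B \<Longrightarrow> c \<noteq> j \<Longrightarrow> col (cancel_entry i j k B) c = col B c"
  unfolding cancel_entry_def by (intro eq_vecI) auto

text \<open>Row \<open>i\<close> is the \<open>row_le\<close>-largest nonzero row of both columns.
  Its entry cancels and no larger row becomes nonzero, so the pivot strictly decreases; both while
  loops terminate for this reason.\<close>

lemma pivot_cancel_entry:
  assumes leq: "grade_order leq" and jk: "j < dim_col B" "k < dim_col B"
    and pj: "pivot_wrt leq r (col B j) = Some i" and pk: "pivot_wrt leq r (col B k) = Some i"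
    and p': "pivot_wrt leq r (col (cancel_entry i j k B) j) = Some i'"
  shows "row_rank leq r (dim_row B) i' < row_rank leq r (dim_row B) i"
proof -
  note J = pivot_wrt_SomeD[OF leq pj]
  note K = pivot_wrt_SomeD[OF leq pk]
  note P = pivot_wrt_SomeD[OF leq p']
  have col: "col (cancel_entry i j k B) j $ s = - (B $$ (i, j)) / B $$ (i, k) * B $$ (s, k) + B $$ (s, j)"
    if "s < dim_row B" for s
    using jk that unfolding cancel_entry_def by simp
  have "i < dim_row B" using J(1) by simp
  have "i' < dim_row B" using P(1) by simp
  have "i' \<noteq> i"
  proof
    assume "i' = i"
    then show False using P(2) col[OF \<open>i < dim_row B\<close>] K(2) jk \<open>i < dim_row B\<close> by simp
  qed
  moreover have "B $$ (i', k) \<noteq> 0 \<or> B $$ (i', j) \<noteq> 0"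
    using P(2) col[OF \<open>i' < dim_row B\<close>] by auto
  then have "row_le leq r i' i" using J(3)[of i'] K(3)[of i'] \<open>i' < dim_row B\<close> jk by auto
  ultimately show ?thesis using row_rank_less[OF leq] \<open>i < dim_row B\<close> by blast
qed

text \<open>Column \<open>k\<close> has received \<open>c\<close> times column \<open>j\<close>, so
  the coefficient of column \<open>k\<close> is also passed on, times \<open>c\<close>, to column
  \<open>j\<close>.\<close>

lemma addcol_mult_vec:
  fixes B :: "'k::field mat"
  assumes "j < dim_col B" "k < dim_col B" "j \<noteq> k" "a \<in> carrier_vec (dim_col B)"
  shows "addcol c k j B *\<^sub>v a = B *\<^sub>v vec (dim_col B) (\<lambda>l. if l = j then a $ j + c * a $ k else a $ l)"
proof (intro eq_vecI)
  fix i assume "i < dim_vec (B *\<^sub>v vec (dim_col B) (\<lambda>l. if l = j then a $ j + c * a $ k else a $ l))"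
  then have i: "i < dim_row B" by simp
  let ?l = "dim_col B"
  have "(addcol c k j B *\<^sub>v a) $ i = (\<Sum>l<?l. (if l = k then c * B $$ (i, j) + B $$ (i, k) else B $$ (i, l)) * a $ l)"
    using assms i by (auto simp: scalar_prod_def atLeast0LessThan intro!: sum.cong)
  also have "\<dots> = (\<Sum>l<?l. B $$ (i, l) * a $ l + (if l = k then c * B $$ (i, j) * a $ k else 0))"
    by (intro sum.cong) (simp_all add: distrib_right)
  also have "\<dots> = (\<Sum>l<?l. B $$ (i, l) * a $ l) + c * B $$ (i, j) * a $ k"
    using assms by (simp add: sum.distrib)
  also have "\<dots> = (\<Sum>l<?l. B $$ (i, l) * a $ l + (if l = j then c * B $$ (i, j) * a $ k else 0))"
    using assms by (simp add: sum.distrib)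
  also have "\<dots> = (\<Sum>l<?l. B $$ (i, l) * (if l = j then a $ j + c * a $ k else a $ l))"
    by (intro sum.cong) (simp_all add: distrib_left mult_ac)
  also have "\<dots> = (B *\<^sub>v vec ?l (\<lambda>l. if l = j then a $ j + c * a $ k else a $ l)) $ i"
    using i by (auto simp: scalar_prod_def atLeast0LessThan intro!: sum.cong)
  finally show "(addcol c k j B *\<^sub>v a) $ i = (B *\<^sub>v vec ?l (\<lambda>l. if l = j then a $ j + c * a $ k else a $ l)) $ i" .
qed auto

lemma mat_range_addcol:
  fixes B :: "'k::field mat"
  assumes "j < dim_col B" "k < dim_col B" "j \<noteq> k"
  shows "mat_range (addcol c k j B) = mat_range B"
proof
  have sub: "mat_range (addcol c k j B) \<subseteq> mat_range B"
    if "j < dim_col B" "k < dim_col B" for c and B :: "'k mat"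
    unfolding mat_range_def using addcol_mult_vec[OF that assms(3)] by fastforce
  show "mat_range (addcol c k j B) \<subseteq> mat_range B" using sub assms by auto
  have "addcol (- c) k j (addcol c k j B) = B"
    using assms by (intro eq_matI) auto
  then show "mat_range B \<subseteq> mat_range (addcol c k j B)"
    using sub[of "addcol c k j B" "- c"] assms by auto
qed

lemma mat_range_cancel_entry:
  "j < dim_col B \<Longrightarrow> k < dim_col B \<Longrightarrow> j \<noteq> k \<Longrightarrow> mat_range (cancel_entry i j k B) = mat_range B"
  unfolding cancel_entry_def by (intro mat_range_addcol) auto

section \<open>Matrices without cancellation in one coordinate of the row grades\<close>

definition support_le :: "(nat \<Rightarrow> int) \<Rightarrow> int \<Rightarrow> 'k::zero vec \<Rightarrow> bool" where
  "support_le f w v \<longleftrightarrow> (\<forall>i<dim_vec v. v $ i \<noteq> 0 \<longrightarrow> f i \<le> w)"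

text \<open>No cancellation of leading terms with respect to the row weights \<open>f\<close>. In contrast to
  distinctness of pivots, this is preserved when a column is added to one of at least the same weight.\<close>

definition reduced_wrt :: "(nat \<Rightarrow> int) \<Rightarrow> 'k::field mat \<Rightarrow> bool" where
  "reduced_wrt f B \<longleftrightarrow> (\<forall>a\<in>carrier_vec (dim_col B). \<forall>w. support_le f w (B *\<^sub>v a) \<longrightarrow>
    (\<forall>j<dim_col B. a $ j \<noteq> 0 \<longrightarrow> support_le f w (col B j)))"

text \<open>A combination of the new columns is one of the old columns in which only the coefficient
  of \<open>j\<close> differs, and only if \<open>a $ k\<close> is nonzero. In that case column
  \<open>k\<close> is bounded by \<open>w\<close>, and by \<open>le\<close> so is column
  \<open>j\<close>; this covers the situation in which the new coefficient of \<open>j\<close>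
  happens to vanish and the hypothesis on \<open>B\<close> says nothing about that column.\<close>

lemma reduced_wrt_addcol:
  assumes red: "reduced_wrt f B" and jk: "j < dim_col B" "k < dim_col B" "j \<noteq> k"
    and le: "\<And>w. support_le f w (col B k) \<Longrightarrow> support_le f w (col B j)"
  shows "reduced_wrt f (addcol c k j B)"
  unfolding reduced_wrt_def
proof (intro ballI allI impI)
  fix a w l
  assume a: "a \<in> carrier_vec (dim_col (addcol c k j B))"
    and w: "support_le f w (addcol c k j B *\<^sub>v a)"
    and l: "l < dim_col (addcol c k j B)" "a $ l \<noteq> 0"
  let ?a = "vec (dim_col B) (\<lambda>l. if l = j then a $ j + c * a $ k else a $ l)"
  have col: "support_le f w (col B s)" if "s < dim_col B" "?a $ s \<noteq> 0" for s
  proof -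
    have "support_le f w (B *\<^sub>v ?a)" using w a by (simp add: addcol_mult_vec[OF jk])
    moreover have "?a \<in> carrier_vec (dim_col B)" by simp
    ultimately show ?thesis using red that unfolding reduced_wrt_def by blast
  qed
  show "support_le f w (col (addcol c k j B) l)"
  proof (cases "a $ k = 0")
    case True
    then have "l \<noteq> k" using l by auto
    moreover have "support_le f w (col B l)" using col[of l] l True by (cases "l = j") auto
    ultimately show ?thesis using l by (auto simp: support_le_def)
  next
    case False
    then have k: "support_le f w (col B k)" using col[of k] jk by auto
    then have j: "support_le f w (col B j)" by (rule le)
    show ?thesis
    proof (cases "l = k")
      case True
      then show ?thesis using k j jk unfolding support_le_def by auto
    next
      case False
      then have "support_le f w (col B l)" using col[of l] l j by (cases "l = j") auto
      then show ?thesis using False l by (auto simp: support_le_def)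
    qed
  qed
qed

definition distinct_pivots :: "(grade \<Rightarrow> grade \<Rightarrow> bool) \<Rightarrow> grade list \<Rightarrow> 'k::field mat \<Rightarrow> bool" where
  "distinct_pivots leq r B \<longleftrightarrow> (\<forall>j<dim_col B. \<forall>k<dim_col B. \<forall>i.
    pivot_wrt leq r (col B j) = Some i \<longrightarrow> pivot_wrt leq r (col B k) = Some i \<longrightarrow> j = k)"

text \<open>The \<open>row_le\<close>-largest pivot among the columns with nonzero coefficient
  occurs in exactly one of them, so its entry survives in the combination. Its weight is then at
  most \<open>w\<close>, and it dominates the weights of all rows occurring in the columns
  involved.\<close>

lemma distinct_pivots_reduced_wrt:
  assumes leq: "grade_order leq" and B: "distinct_pivots leq r B"
    and mono: "\<And>p q. leq p q \<Longrightarrow> f p \<le> f q"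
  shows "reduced_wrt (\<lambda>i. f (r ! i)) B"
  unfolding reduced_wrt_def
proof (intro ballI allI impI)
  fix a w j
  assume a: "a \<in> carrier_vec (dim_col B)" and w: "support_le (\<lambda>i. f (r ! i)) w (B *\<^sub>v a)"
    and j: "j < dim_col B" "a $ j \<noteq> 0"
  let ?piv = "\<lambda>j. pivot_wrt leq r (col B j)"
  let ?S = "{i. \<exists>k<dim_col B. a $ k \<noteq> 0 \<and> ?piv k = Some i}"
  have fin: "finite ?S"
  proof (rule finite_subset)
    show "?S \<subseteq> (\<lambda>k. the (?piv k)) ` {..<dim_col B}"
    proof
      fix i assume "i \<in> ?S"
      then obtain k where "k < dim_col B" "?piv k = Some i" by blast
      then show "i \<in> (\<lambda>k. the (?piv k)) ` {..<dim_col B}"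
        by (intro image_eqI[of _ _ k]) auto
    qed
  qed auto
  show "support_le (\<lambda>i. f (r ! i)) w (col B j)"
  proof (cases "?piv j")
    case None
    then show ?thesis unfolding pivot_wrt_None support_le_def by auto
  next
    case (Some ij)
    then have "ij \<in> ?S" using j by auto
    then obtain i where i: "i \<in> ?S" "\<forall>j\<in>?S. row_le leq r j i"
      using finite_row_max[OF leq fin, of r] by blast
    then obtain k where k: "k < dim_col B" "a $ k \<noteq> 0" "?piv k = Some i" by auto
    have im: "i < dim_row B" using pivot_wrt_SomeD(1)[OF leq k(3)] by simp
    \<comment> \<open>Another column involved that is nonzero in row \<open>i\<close> would have a
      pivot at least \<open>i\<close>, hence equal to \<open>i\<close> by the choice of
      \<open>i\<close>, against distinctness.\<close>
    have zero: "B $$ (i, l) * a $ l = 0" if l: "l < dim_col B" "l \<noteq> k" for l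
    proof (rule ccontr)
      assume nz: "B $$ (i, l) * a $ l \<noteq> 0"
      then have "?piv l \<noteq> None" using im l by (auto simp: pivot_wrt_None)
      then obtain il where il: "?piv l = Some il" by auto
      have "row_le leq r i il" using pivot_wrt_SomeD(3)[OF leq il, of i] nz im l by auto
      moreover have "row_le leq r il i" using i(2) il l nz by auto
      ultimately have "il = i" using row_le_antisym[OF leq] by blast
      then show False using B il k l unfolding distinct_pivots_def by blast
    qed
    have "(B *\<^sub>v a) $ i = (\<Sum>l<dim_col B. B $$ (i, l) * a $ l)"
      using a im by (auto simp: scalar_prod_def atLeast0LessThan)
    also have "\<dots> = (\<Sum>l\<in>{k}. B $$ (i, l) * a $ l)"
      using k zero by (intro sum.mono_neutral_right) auto
    finally have "(B *\<^sub>v a) $ i \<noteq> 0" using k pivot_wrt_SomeD(2)[OF leq k(3)] im by auto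
    then have fi: "f (r ! i) \<le> w" using w im unfolding support_le_def by auto
    have "row_le leq r ij i" using i(2) \<open>ij \<in> ?S\<close> by auto
    show ?thesis
      unfolding support_le_def
    proof (intro allI impI)
      fix s assume "s < dim_vec (col B j)" "col B j $ s \<noteq> 0"
      then have "row_le leq r s ij" using pivot_wrt_SomeD(3)[OF leq Some] by blast
      then have "row_le leq r s i" using \<open>row_le leq r ij i\<close> row_le_trans[OF leq] by blast
      then show "f (r ! s) \<le> w" using mono[of "r ! s" "r ! i"] fi unfolding row_le_def by auto
    qed
  qed
qed

section \<open>Pivot tables and correctness of the two while loops\<close>

definition pivot_table ::
  "(grade \<Rightarrow> grade \<Rightarrow> bool) \<Rightarrow> grade list \<Rightarrow> nat set \<Rightarrow> 'k::field mat \<Rightarrow> (nat \<Rightarrow> nat option) \<Rightarrow> bool" where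
  "pivot_table leq r S B p \<longleftrightarrow> S \<subseteq> {..<dim_col B} \<and>
    (\<forall>c\<in>S. \<forall>i. pivot_wrt leq r (col B c) = Some i \<longrightarrow> p i = Some c) \<and>
    (\<forall>i c. p i = Some c \<longrightarrow> c \<in> S \<and> pivot_wrt leq r (col B c) = Some i)"

lemma pivot_tableI:
  assumes "S \<subseteq> {..<dim_col B}"
    and "\<And>c i. c \<in> S \<Longrightarrow> pivot_wrt leq r (col B c) = Some i \<Longrightarrow> p i = Some c"
    and "\<And>i c. p i = Some c \<Longrightarrow> c \<in> S \<and> pivot_wrt leq r (col B c) = Some i"
  shows "pivot_table leq r S B p"
  unfolding pivot_table_def using assms by blast

lemma pivot_tableD:
  assumes "pivot_table leq r S B p"
  shows "S \<subseteq> {..<dim_col B}"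
    and "\<And>c i. c \<in> S \<Longrightarrow> pivot_wrt leq r (col B c) = Some i \<Longrightarrow> p i = Some c"
    and "\<And>i c. p i = Some c \<Longrightarrow> c \<in> S"
    and "\<And>i c. p i = Some c \<Longrightarrow> pivot_wrt leq r (col B c) = Some i"
  using assms unfolding pivot_table_def by blast+

lemma pivot_table_None:
  assumes "pivot_table leq r S B p" "j < dim_col B" "pivot_wrt leq r (col B j) = None"
  shows "pivot_table leq r (insert j S) B p"
proof (rule pivot_tableI)
  show "insert j S \<subseteq> {..<dim_col B}" using pivot_tableD(1)[OF assms(1)] assms(2) by blast
  show "p i = Some c" if "c \<in> insert j S" "pivot_wrt leq r (col B c) = Some i" for c i
    using that assms(3) pivot_tableD(2)[OF assms(1), of c i] by (cases "c = j") simp_all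
  show "c \<in> insert j S \<and> pivot_wrt leq r (col B c) = Some i" if "p i = Some c" for i c
    using pivot_tableD(3,4)[OF assms(1) that] by blast
qed

lemma pivot_table_upd:
  assumes "pivot_table leq r S B p" "j < dim_col B"
    and piv: "pivot_wrt leq r (col B j) = Some i" "p i = None"
  shows "pivot_table leq r (insert j S) B (p(i \<mapsto> j))"
proof (rule pivot_tableI)
  show "insert j S \<subseteq> {..<dim_col B}" using pivot_tableD(1)[OF assms(1)] assms(2) by blast
  show "(p(i \<mapsto> j)) i' = Some c" if c: "c \<in> insert j S" "pivot_wrt leq r (col B c) = Some i'" for c i'
  proof (cases "c = j")
    case False
    then have "p i' = Some c" using pivot_tableD(2)[OF assms(1) _ c(2)] c(1) by blast
    then show ?thesis using piv(2) by (cases "i' = i") simp_all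
  qed (use c piv in simp)
  show "c \<in> insert j S \<and> pivot_wrt leq r (col B c) = Some i'" if "(p(i \<mapsto> j)) i' = Some c" for i' c
    using that piv(1) pivot_tableD(3,4)[OF assms(1), of i' c] by (cases "i' = i") simp_all
qed

lemma pivot_table_cancel:
  assumes "pivot_table leq r S B p" "j \<notin> S"
  shows "pivot_table leq r S (cancel_entry i' j k B) p"
proof -
  note S = pivot_tableD(1)[OF assms(1)]
  have col: "col (cancel_entry i' j k B) c = col B c" if "c \<in> S" for c
    using that assms S by (intro col_cancel_entry_other) auto
  show ?thesis
  proof (rule pivot_tableI)
    show "p i = Some c" if "c \<in> S" "pivot_wrt leq r (col (cancel_entry i' j k B) c) = Some i" for c i
      using pivot_tableD(2)[OF assms(1) that(1)] that(2) unfolding col[OF that(1)] .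
    show "c \<in> S \<and> pivot_wrt leq r (col (cancel_entry i' j k B) c) = Some i" if "p i = Some c" for i c
      using pivot_tableD(3,4)[OF assms(1) that] col[of c] by simp
  qed (use S in simp)
qed

text \<open>The column \<open>k\<close> leaves the set of finished columns, as the second pass goes
  on to reduce it in place of \<open>j\<close>. This is why the table is accompanied by a set of
  finished columns instead of an upper bound on their indices.\<close>

lemma pivot_table_swap:
  assumes "pivot_table leq r S B p" "j < dim_col B" "j \<notin> S"
    and piv: "pivot_wrt leq r (col B j) = Some i" "p i = Some k"
  shows "pivot_table leq r (insert j (S - {k})) B (p(i \<mapsto> j))"
proof (rule pivot_tableI)
  show "insert j (S - {k}) \<subseteq> {..<dim_col B}" using pivot_tableD(1)[OF assms(1)] assms(2) by blast
  show "(p(i \<mapsto> j)) i' = Some c"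
    if c: "c \<in> insert j (S - {k})" "pivot_wrt leq r (col B c) = Some i'" for c i'
  proof (cases "c = j")
    case False
    then have "p i' = Some c" "c \<noteq> k" using pivot_tableD(2)[OF assms(1) _ c(2)] c(1) by blast+
    then show ?thesis using piv(2) by (cases "i' = i") simp_all
  qed (use c piv in simp)
  show "c \<in> insert j (S - {k}) \<and> pivot_wrt leq r (col B c) = Some i'"
    if "(p(i \<mapsto> j)) i' = Some c" for i' c
  proof (cases "i' = i")
    case False
    then have "p i' = Some c" using that by simp
    then have "c \<in> S" "pivot_wrt leq r (col B c) = Some i'" using pivot_tableD(3,4)[OF assms(1)] by blast+
    moreover have "c \<noteq> k"
      using calculation(2) pivot_tableD(4)[OF assms(1) piv(2)] False by auto
    ultimately show ?thesis by blast
  qed (use that piv(1) in simp)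
qed

lemma pivot_table_distinct:
  assumes "pivot_table leq r {..<dim_col B} B p"
  shows "distinct_pivots leq r B"
  unfolding distinct_pivots_def
proof (intro allI impI)
  fix j k i assume "j < dim_col B" "k < dim_col B"
    "pivot_wrt leq r (col B j) = Some i" "pivot_wrt leq r (col B k) = Some i"
  then have "p i = Some j" "p i = Some k" using pivot_tableD(2)[OF assms] by blast+
  then show "j = k" by simp
qed

text \<open>The table leads to a finished column with the same pivot, which differs from
  \<open>j\<close> since \<open>j\<close> is unfinished. So the column space is kept, and the pivot
  of column \<open>j\<close> moves down in \<open>row_le\<close> until it is new or the column is
  zero.\<close>

lemma c_reduce_correct:
  assumes "pivot_table colex_le r S B p" "j \<notin> S" "j < dim_col B"
  shows "\<exists>B' p'. c_reduce r j B p = Some (B', p') \<and> pivot_table colex_le r (insert j S) B' p' \<and>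
    dim_row B' = dim_row B \<and> dim_col B' = dim_col B \<and> mat_range B' = mat_range B"
  using assms
proof (induction "case c_piv r (col B j) of None \<Rightarrow> 0 | Some i \<Rightarrow> row_rank colex_le r (dim_row B) i"
    arbitrary: B rule: less_induct)
  case less
  show ?case
  proof (cases "c_piv r (col B j)")
    case None
    then show ?thesis using pivot_table_None[OF less.prems(1,3)] by (subst c_reduce.simps) simp
  next
    case i: (Some i)
    show ?thesis
    proof (cases "p i")
      case None
      then show ?thesis using i pivot_table_upd[OF less.prems(1,3)] by (subst c_reduce.simps) simp
    next
      case k: (Some k)
      let ?B = "cancel_entry i j k B"
      have ks: "k \<in> S" "c_piv r (col B k) = Some i" "k < dim_col B" "j \<noteq> k"
        using less.prems k pivot_tableD(1,3,4)[OF less.prems(1)] by blast+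
      have eq: "c_reduce r j B p = c_reduce r j ?B p"
        using i k by (subst c_reduce.simps) simp
      have pt: "pivot_table colex_le r S ?B p" using less.prems pivot_table_cancel by blast
      show ?thesis
      proof (cases "c_piv r (col ?B j)")
        case None
        then show ?thesis unfolding eq
          using pivot_table_None[OF pt] less.prems ks mat_range_cancel_entry[of j B k i]
          by (subst c_reduce.simps) auto
      next
        case (Some i')
        have "row_rank colex_le r (dim_row B) i' < row_rank colex_le r (dim_row B) i"
          using pivot_cancel_entry[OF grade_order_colex less.prems(3) ks(3) i ks(2) Some] .
        then show ?thesis unfolding eq
          using less.hyps[of ?B] pt less.prems ks i Some mat_range_cancel_entry[of j B k i] by auto
      qed
    qed
  qed
qed

lemma colex_le_snd: "colex_le p q \<Longrightarrow> snd p \<le> snd q"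
  unfolding colex_le_def by auto

lemma lex_le_fst: "lex_le p q \<Longrightarrow> fst p \<le> fst q"
  unfolding lex_le_def by auto

text \<open>The colexicographic pivot carries the largest second coordinate of its column. Comparing
  the pivot grades thus supplies the condition under which adding columns keeps a matrix reduced in
  the second coordinate.\<close>

lemma support_le_colex:
  assumes "c_piv r (col B j) = Some i" "c_piv r (col B k) = Some i'" "colex_le (r ! i) (r ! i')"
    and "support_le (\<lambda>i. snd (r ! i)) w (col B k)"
  shows "support_le (\<lambda>i. snd (r ! i)) w (col B j)"
  unfolding support_le_def
proof (intro allI impI)
  fix s assume "s < dim_vec (col B j)" "col B j $ s \<noteq> 0"
  then have "row_le colex_le r s i" using pivot_wrt_SomeD(3)[OF grade_order_colex assms(1)] by blast
  then have "snd (r ! s) \<le> snd (r ! i)" unfolding row_le_def using colex_le_snd by blast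
  also have "\<dots> \<le> snd (r ! i')" using assms(3) by (rule colex_le_snd)
  also have "\<dots> \<le> w"
    using assms(4) pivot_wrt_SomeD(1,2)[OF grade_order_colex assms(2)] unfolding support_le_def by blast
  finally show "snd (r ! s) \<le> w" .
qed

text \<open>The test \<open>c_less\<close> selects as the column to be changed one whose
  colexicographic pivot grade is not the smaller of the two; this keeps the second coordinate free
  of cancellation. Both columns have the same lexicographic pivot, so that it decreases in the
  column processed next whether or not a swap takes place.\<close>

lemma l_reduce_correct:
  assumes "pivot_table lex_le r S B p" "j \<notin> S" "j < dim_col B" "reduced_wrt (\<lambda>i. snd (r ! i)) B"
  shows "\<exists>B' p'. l_reduce r j B p = Some (B', p') \<and> pivot_table lex_le r (insert j S) B' p' \<and>
    dim_row B' = dim_row B \<and> dim_col B' = dim_col B \<and> mat_range B' = mat_range B \<and>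
    reduced_wrt (\<lambda>i. snd (r ! i)) B'"
  using assms
\<comment> \<open>With \<open>Suc\<close>, a column that has become zero is strictly below every
  nonzero one. The column, the finished set and the table are arbitrary, because a swap changes all
  three.\<close>
proof (induction "case l_piv r (col B j) of None \<Rightarrow> 0 | Some i \<Rightarrow> Suc (row_rank lex_le r (dim_row B) i)"
    arbitrary: B j S p rule: less_induct)
  case less
  show ?case
  proof (cases "l_piv r (col B j)")
    case None
    then show ?thesis using pivot_table_None[OF less.prems(1,3)] less.prems
      by (subst l_reduce.simps) simp
  next
    case i: (Some i)
    show ?thesis
    proof (cases "p i")
      case None
      then show ?thesis using i pivot_table_upd[OF less.prems(1,3)] less.prems
        by (subst l_reduce.simps) simp
    next
      case k: (Some k)
      have ks: "k \<in> S" "l_piv r (col B k) = Some i" "k < dim_col B" "j \<noteq> k"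
        using less.prems k pivot_tableD(1,3,4)[OF less.prems(1)] by blast+
      have "c_piv r (col B j) \<noteq> None" "c_piv r (col B k) \<noteq> None"
        using pivot_wrt_SomeD(1,2)[OF grade_order_lex i] pivot_wrt_SomeD(1,2)[OF grade_order_lex ks(2)]
        unfolding pivot_wrt_None by auto
      then obtain cj ck where c: "c_piv r (col B j) = Some cj" "c_piv r (col B k) = Some ck"
        by auto
      show ?thesis
      proof (cases "c_less r cj ck")
        case True
        let ?B = "cancel_entry i k j B"
        \<comment> \<open>From here on \<open>k\<close> is the unfinished column and
          \<open>j\<close> has taken its place among the finished ones.\<close>
        let ?S = "insert j (S - {k})"
        have eq: "l_reduce r j B p = l_reduce r k ?B (p(i \<mapsto> j))"
          using i k c True by (subst l_reduce.simps) simp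
        have ins: "insert k ?S = insert j S" using ks by auto
        have "pivot_table lex_le r ?S B (p(i \<mapsto> j))"
          using pivot_table_swap[OF less.prems(1,3,2) i k] .
        then have pt: "pivot_table lex_le r ?S ?B (p(i \<mapsto> j))"
          using ks(4) by (intro pivot_table_cancel) auto
        have "colex_le (r ! cj) (r ! ck)" using True unfolding c_less_def by simp
        then have red: "reduced_wrt (\<lambda>i. snd (r ! i)) ?B"
          unfolding cancel_entry_def
          using support_le_colex[OF c] ks less.prems by (intro reduced_wrt_addcol) auto
        have "(case l_piv r (col ?B k) of None \<Rightarrow> 0 | Some i \<Rightarrow> Suc (row_rank lex_le r (dim_row ?B) i))
          < Suc (row_rank lex_le r (dim_row B) i)"
          using pivot_cancel_entry[OF grade_order_lex ks(3) less.prems(3) ks(2) i]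
          by (auto split: option.split)
        then show ?thesis unfolding eq
          using less.hyps[of ?B k ?S "p(i \<mapsto> j)"] pt red ks i mat_range_cancel_entry[of k B j i] less.prems
          by (auto simp: ins)
      next
        case False
        let ?B = "cancel_entry i j k B"
        have eq: "l_reduce r j B p = l_reduce r j ?B p"
          using i k c False by (subst l_reduce.simps) simp
        have pt: "pivot_table lex_le r S ?B p" using less.prems pivot_table_cancel by blast
        \<comment> \<open>If \<open>c_less\<close> fails, then the grades compare the other way, or
          they are equal and only the tie-break by index has failed.\<close>
        have "colex_le (r ! ck) (r ! cj)"
          using False grade_order_colex unfolding c_less_def grade_order_def by metis
        then have red: "reduced_wrt (\<lambda>i. snd (r ! i)) ?B"
          unfolding cancel_entry_def
          using support_le_colex[OF c(2,1)] ks less.prems by (intro reduced_wrt_addcol) auto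
        have "(case l_piv r (col ?B j) of None \<Rightarrow> 0 | Some i \<Rightarrow> Suc (row_rank lex_le r (dim_row ?B) i))
          < Suc (row_rank lex_le r (dim_row B) i)"
          using pivot_cancel_entry[OF grade_order_lex less.prems(3) ks(3) i ks(2)]
          by (auto split: option.split)
        then show ?thesis unfolding eq
          using less.hyps[of ?B j S p] pt red ks i mat_range_cancel_entry[of j B k i] less.prems by auto
      qed
    qed
  qed
qed

lemma for_columns_correct:
  assumes step: "\<And>S B p j. Inv S B p \<Longrightarrow> j \<notin> S \<Longrightarrow> j < l \<Longrightarrow>
      \<exists>B' p'. f j B p = Some (B', p') \<and> Inv (insert j S) B' p'"
    and "Inv S B p" "distinct js" "set js \<inter> S = {}" "set js \<subseteq> {..<l}"
  shows "\<exists>B' p'. for_columns f js B p = Some B' \<and> Inv (S \<union> set js) B' p'"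
  using assms(2-)
proof (induction js arbitrary: S B p)
  case (Cons j js)
  have "j \<notin> S" "j < l" using Cons.prems by auto
  from step[OF Cons.prems(1) this] obtain B' p'
    where 1: "f j B p = Some (B', p')" "Inv (insert j S) B' p'" by blast
  have "distinct js" "set js \<inter> insert j S = {}" "set js \<subseteq> {..<l}" using Cons.prems by auto
  from Cons.IH[OF 1(2) this] show ?case using 1 by simp
qed auto

lemma column_reduction:
  assumes "dim_row B = m" "dim_col B = l"
  shows "\<exists>B1 B2. for_columns (c_reduce r) [0..<l] B Map.empty = Some B1 \<and>
    for_columns (l_reduce r) [0..<l] B1 Map.empty = Some B2 \<and> dim_row B2 = m \<and> dim_col B2 = l \<and>
    mat_range B2 = mat_range B \<and> reduced_wrt (\<lambda>i. fst (r ! i)) B2 \<and> reduced_wrt (\<lambda>i. snd (r ! i)) B2"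
proof -
  define Inv1 where "Inv1 = (\<lambda>S B' p. pivot_table colex_le r S B' p \<and>
    dim_row B' = m \<and> dim_col B' = l \<and> mat_range B' = mat_range B)"
  have "\<exists>B1 p1. for_columns (c_reduce r) [0..<l] B Map.empty = Some B1 \<and> Inv1 ({} \<union> set [0..<l]) B1 p1"
  proof (rule for_columns_correct[where l = l])
    show "Inv1 {} B Map.empty" unfolding Inv1_def using assms by (auto intro: pivot_tableI)
    show "\<exists>B'' p''. c_reduce r j B' p = Some (B'', p'') \<and> Inv1 (insert j S) B'' p''"
      if "Inv1 S B' p" "j \<notin> S" "j < l" for S B' p j
      using c_reduce_correct[of r S B' p j] that unfolding Inv1_def by auto
  qed auto
  then obtain B1 p1 where 1: "for_columns (c_reduce r) [0..<l] B Map.empty = Some B1"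
    and "Inv1 {0..<l} B1 p1" by auto
  then have B1: "dim_row B1 = m" "dim_col B1 = l" "mat_range B1 = mat_range B" "distinct_pivots colex_le r B1"
    using pivot_table_distinct[of colex_le r B1] unfolding Inv1_def by (auto simp: atLeast0LessThan)
  have red1: "reduced_wrt (\<lambda>i. snd (r ! i)) B1"
    using distinct_pivots_reduced_wrt[OF grade_order_colex B1(4), of snd] colex_le_snd by blast
  \<comment> \<open>Distinctness of the colexicographic pivots can be lost in the second pass, when
    equal pivot grades occur in different rows. Only its consequence, the absence of cancellation,
    is carried along.\<close>
  define Inv2 where "Inv2 = (\<lambda>S B' p. pivot_table lex_le r S B' p \<and>
    dim_row B' = m \<and> dim_col B' = l \<and> mat_range B' = mat_range B \<and> reduced_wrt (\<lambda>i. snd (r ! i)) B')"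
  have "\<exists>B2 p2. for_columns (l_reduce r) [0..<l] B1 Map.empty = Some B2 \<and> Inv2 ({} \<union> set [0..<l]) B2 p2"
  proof (rule for_columns_correct[where l = l])
    show "Inv2 {} B1 Map.empty" unfolding Inv2_def using B1 red1 by (auto intro: pivot_tableI)
    show "\<exists>B'' p''. l_reduce r j B' p = Some (B'', p'') \<and> Inv2 (insert j S) B'' p''"
      if "Inv2 S B' p" "j \<notin> S" "j < l" for S B' p j
      using l_reduce_correct[of r S B' p j] that unfolding Inv2_def by auto
  qed auto
  then obtain B2 p2 where 2: "for_columns (l_reduce r) [0..<l] B1 Map.empty = Some B2"
    and inv2: "Inv2 {0..<l} B2 p2" by auto
  then have "distinct_pivots lex_le r B2"
    using pivot_table_distinct[of lex_le r B2] unfolding Inv2_def by (auto simp: atLeast0LessThan)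
  then have "reduced_wrt (\<lambda>i. fst (r ! i)) B2"
    using distinct_pivots_reduced_wrt[OF grade_order_lex, of r B2 fst] lex_le_fst by blast
  then show ?thesis using 1 2 inv2 unfolding Inv2_def by blast
qed


section \<open>Bireduce\<close>

lemma free_pm_carrier:
  "pcarrier (free_pm gs :: ('k::field, 'k vec) pmodule) z =
    {v \<in> carrier_vec (length gs). \<forall>i<length gs. v $ i \<noteq> 0 \<longrightarrow> gs ! i \<le> z}"
  unfolding free_pm_def free_space_def by simp

section \<open>Removal of zero columns and the resulting basis\<close>

lemma nonzero_columns_as_selection:
  "nonzero_columns B = mat_of_cols (dim_row B)
    (map (col B) (filter (\<lambda>j. col B j \<noteq> 0\<^sub>v (dim_row B)) [0..<dim_col B]))"
  unfolding nonzero_columns_def by (simp add: cols_def filter_map o_def)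

lemma mult_selected_columns:
  fixes B :: "'k::field mat"
  assumes js: "distinct js" "set js \<subseteq> {..<dim_col B}"
    and zero: "\<And>j. j < dim_col B \<Longrightarrow> j \<notin> set js \<Longrightarrow> col B j = 0\<^sub>v (dim_row B)"
    and b: "b \<in> carrier_vec (dim_col B)"
  shows "mat_of_cols (dim_row B) (map (col B) js) *\<^sub>v vec (length js) (\<lambda>t. b $ (js ! t)) = B *\<^sub>v b"
proof (intro eq_vecI)
  fix i assume "i < dim_vec (B *\<^sub>v b)"
  then have i: "i < dim_row B" by simp
  have "(mat_of_cols (dim_row B) (map (col B) js) *\<^sub>v vec (length js) (\<lambda>t. b $ (js ! t))) $ i =
    (\<Sum>t<length js. B $$ (i, js ! t) * b $ (js ! t))"
    using i js by (auto simp: scalar_prod_def atLeast0LessThan mat_of_cols_def subset_iff intro!: sum.cong)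
  also have "\<dots> = (\<Sum>j\<in>set js. B $$ (i, j) * b $ j)"
    using js(1) by (intro sum.reindex_bij_betw bij_betw_nth) auto
  also have "\<dots> = (\<Sum>j<dim_col B. B $$ (i, j) * b $ j)"
  proof (intro sum.mono_neutral_left ballI)
    fix j assume "j \<in> {..<dim_col B} - set js"
    then have "col B j $ i = 0" using zero[of j] i by simp
    then show "B $$ (i, j) * b $ j = 0" using i \<open>j \<in> _\<close> by simp
  qed (use js in auto)
  also have "\<dots> = (B *\<^sub>v b) $ i"
    using i b by (auto simp: scalar_prod_def atLeast0LessThan)
  finally show "(mat_of_cols (dim_row B) (map (col B) js) *\<^sub>v vec (length js) (\<lambda>t. b $ (js ! t))) $ i = (B *\<^sub>v b) $ i" .
qed simp

text \<open>Coefficient vectors for the selected columns are exactly the restrictions of coefficient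
  vectors for all columns, with the same product, since the omitted columns are zero.\<close>

lemma nonzero_columns_reduced:
  fixes B :: "'k::field mat"
  shows "mat_range (nonzero_columns B) = mat_range B"
    and "reduced_wrt f B \<Longrightarrow> reduced_wrt f (nonzero_columns B)"
    and "j < dim_col (nonzero_columns B) \<Longrightarrow> col (nonzero_columns B) j \<noteq> 0\<^sub>v (dim_row B)"
    and "dim_row (nonzero_columns B) = dim_row B"
proof -
  define js where "js = filter (\<lambda>j. col B j \<noteq> 0\<^sub>v (dim_row B)) [0..<dim_col B]"
  have N: "nonzero_columns B = mat_of_cols (dim_row B) (map (col B) js)"
    using nonzero_columns_as_selection[of B] unfolding js_def .
  have js: "distinct js" "set js \<subseteq> {..<dim_col B}"
    "\<And>j. j < dim_col B \<Longrightarrow> j \<notin> set js \<Longrightarrow> col B j = 0\<^sub>v (dim_row B)"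
    unfolding js_def by auto
  have dim: "dim_col (nonzero_columns B) = length js" "dim_row (nonzero_columns B) = dim_row B"
    unfolding N by auto
  have js_nth: "js ! t < dim_col B" if "t < length js" for t using js(2) nth_mem[OF that] by auto
  have col: "col (nonzero_columns B) t = col B (js ! t)" if "t < length js" for t
    using that js_nth[OF that] unfolding N by (intro eq_vecI) (auto simp: mat_of_cols_def)
  have mult: "nonzero_columns B *\<^sub>v vec (length js) (\<lambda>t. b $ (js ! t)) = B *\<^sub>v b"
    if "b \<in> carrier_vec (dim_col B)" for b
    unfolding N using js that by (intro mult_selected_columns) auto
  have ext: "\<exists>b\<in>carrier_vec (dim_col B). vec (length js) (\<lambda>t. b $ (js ! t)) = a"
    if a: "a \<in> carrier_vec (length js)" for a :: "'k vec"
  proof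
    \<comment> \<open>Any extension of \<open>a\<close> will do, as its values outside
      \<open>set js\<close> only multiply zero columns.\<close>
    let ?b = "vec (dim_col B) (\<lambda>j. a $ (inv_into {..<length js} ((!) js) j))"
    have "inj_on ((!) js) {..<length js}" using js(1) inj_on_nth by blast
    then show "vec (length js) (\<lambda>t. ?b $ (js ! t)) = a"
      using a js_nth by (intro eq_vecI) (auto simp: inv_into_f_f)
  qed simp
  show "mat_range (nonzero_columns B) = mat_range B"
  proof
    show "mat_range (nonzero_columns B) \<subseteq> mat_range B"
    proof
      fix x assume "x \<in> mat_range (nonzero_columns B)"
      then obtain a where a: "x = nonzero_columns B *\<^sub>v a" "a \<in> carrier_vec (length js)"
        unfolding mat_range_def dim by auto
      obtain b where "b \<in> carrier_vec (dim_col B)" "vec (length js) (\<lambda>t. b $ (js ! t)) = a"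
        using ext[OF a(2)] by blast
      then show "x \<in> mat_range B" using mult[of b] a unfolding mat_range_def by auto
    qed
    show "mat_range B \<subseteq> mat_range (nonzero_columns B)"
    proof
      fix x assume "x \<in> mat_range B"
      then obtain b where "x = B *\<^sub>v b" "b \<in> carrier_vec (dim_col B)" unfolding mat_range_def by auto
      then have "x = nonzero_columns B *\<^sub>v vec (length js) (\<lambda>t. b $ (js ! t))" using mult[of b] by simp
      then show "x \<in> mat_range (nonzero_columns B)" unfolding mat_range_def dim by auto
    qed
  qed
  show "reduced_wrt f (nonzero_columns B)" if red: "reduced_wrt f B"
    unfolding reduced_wrt_def dim
  proof (intro ballI allI impI)
    fix a w t
    assume a: "a \<in> carrier_vec (length js)" and w: "support_le f w (nonzero_columns B *\<^sub>v a)"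
      and t: "t < length js" "a $ t \<noteq> 0"
    obtain b where b: "b \<in> carrier_vec (dim_col B)" "vec (length js) (\<lambda>t. b $ (js ! t)) = a"
      using ext[OF a] by blast
    have "support_le f w (B *\<^sub>v b)" using w mult[OF b(1)] b(2) by simp
    moreover have "b $ (js ! t) \<noteq> 0" using b(2) t by auto
    ultimately show "support_le f w (col (nonzero_columns B) t)"
      using red b(1) js_nth[OF t(1)] unfolding reduced_wrt_def col[OF t(1)] by blast
  qed
  show "col (nonzero_columns B) j \<noteq> 0\<^sub>v (dim_row B)" if "j < dim_col (nonzero_columns B)"
  proof -
    have "j < length js" using that unfolding dim .
    then have "js ! j \<in> set js" "col (nonzero_columns B) j = col B (js ! j)" by (auto simp: col)
    then show ?thesis unfolding js_def by auto
  qed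
  show "dim_row (nonzero_columns B) = dim_row B" by (rule dim)
qed

lemma mult_mat_vec_index_nonzero:
  fixes A :: "'k::field mat"
  assumes "(A *\<^sub>v v) $ i \<noteq> 0" "i < dim_row A" "v \<in> carrier_vec (dim_col A)"
  obtains j where "j < dim_col A" "A $$ (i, j) \<noteq> 0" "v $ j \<noteq> 0"
proof -
  have "(\<Sum>j<dim_col A. A $$ (i, j) * v $ j) \<noteq> 0"
    using assms by (simp add: scalar_prod_def atLeast0LessThan)
  then obtain j where "j < dim_col A" "A $$ (i, j) * v $ j \<noteq> 0"
    using sum.neutral by (metis (no_types, lifting) lessThan_iff)
  then show ?thesis using that by auto
qed

text \<open>Surjectivity onto grade \<open>z\<close> needs both coordinates: each one bounds the
  columns involved separately, and the column grade is the join of the row grades occurring. Linear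
  independence needs only one of them, as the zero vector satisfies every bound while a nonzero
  column does not. That the columns are nonzero also makes these joins range over nonempty
  sets.\<close>

lemma reduced_basis_matrix:
  fixes N :: "'k::field mat"
  assumes red: "reduced_wrt (\<lambda>i. fst (r ! i)) N" "reduced_wrt (\<lambda>i. snd (r ! i)) N"
    and nz: "\<And>j. j < dim_col N \<Longrightarrow> col N j \<noteq> 0\<^sub>v (dim_row N)"
    and dim: "dim_row N = length r"
  shows "basis_matrix (with_row_grades N r) (\<lambda>z. mat_range N \<inter> pcarrier (free_pm r) z)"
proof -
  let ?I = "with_row_grades N r"
  let ?S = "\<lambda>j. {r ! i | i. i < dim_row N \<and> N $$ (i, j) \<noteq> 0}"
  have I: "ent ?I = N" "rgr ?I = r" "length (cgr ?I) = dim_col N"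
    "\<And>j. j < dim_col N \<Longrightarrow> cgr ?I ! j = Sup_fin (?S j)"
    unfolding with_row_grades_def by auto
  have ne: "?S j \<noteq> {}" if j: "j < dim_col N" for j
  proof
    assume "?S j = {}"
    then have "N $$ (i, j) = 0" if "i < dim_row N" for i using that by blast
    then have "col N j = 0\<^sub>v (dim_row N)" using j by (intro eq_vecI) auto
    then show False using nz[OF j] by blast
  qed
  have fin: "finite (?S j)" for j by simp
  have cgr_le: "cgr ?I ! j \<le> z \<longleftrightarrow> (\<forall>i<length r. N $$ (i, j) \<noteq> 0 \<longrightarrow> r ! i \<le> z)" if j: "j < dim_col N" for j z
    using Sup_fin.bounded_iff[OF fin ne[OF j], of z] unfolding I(4)[OF j] dim by blast
  have le_cgr: "r ! i \<le> cgr ?I ! j" if "i < length r" "j < dim_col N" "N $$ (i, j) \<noteq> 0" for i j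
    using cgr_le[of j "cgr ?I ! j"] that by blast
  have mor: "morphism_matrix ?I"
    unfolding morphism_matrix_def graded_matrix_def I
    using le_cgr dim by (metis carrier_matI)
  have bij: "bij_betw (\<lambda>v. N *\<^sub>v v) (pcarrier (free_pm (cgr ?I)) z) (mat_range N \<inter> pcarrier (free_pm r) z)" for z
    unfolding bij_betw_def
  proof
    show "inj_on (\<lambda>v. N *\<^sub>v v) (pcarrier (free_pm (cgr ?I)) z)"
    proof (rule inj_onI)
      fix v v' assume "v \<in> pcarrier (free_pm (cgr ?I)) z" "v' \<in> pcarrier (free_pm (cgr ?I)) z"
        and eq: "N *\<^sub>v v = N *\<^sub>v v'"
      then have v: "v \<in> carrier_vec (dim_col N)" "v' \<in> carrier_vec (dim_col N)"
        unfolding free_pm_carrier I(1-3) by auto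
      have N: "N \<in> carrier_mat (dim_row N) (dim_col N)" by simp
      have "N *\<^sub>v (v - v') = 0\<^sub>v (dim_row N)"
        using mult_minus_distrib_mat_vec[OF N v] eq by (auto intro!: eq_vecI)
      then have supp: "support_le f w (N *\<^sub>v (v - v'))" for f w unfolding support_le_def by auto
      have "(v - v') $ j = 0" if j: "j < dim_col N" for j
      proof (rule ccontr)
        assume nzj: "(v - v') $ j \<noteq> 0"
        obtain i where i: "i < dim_row N" "N $$ (i, j) \<noteq> 0" using ne[OF j] by blast
        \<comment> \<open>The bound is taken just below the weight of row \<open>i\<close>, in which
          column \<open>j\<close> is nonzero.\<close>
        have "support_le (\<lambda>i. fst (r ! i)) (fst (r ! i) - 1) (col N j)"
          using red(1) supp v j nzj unfolding reduced_wrt_def by (meson minus_carrier_vec)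
        then show False using i j unfolding support_le_def by force
      qed
      then show "v = v'" using v by (intro eq_vecI) auto
    qed
    show "(\<lambda>v. N *\<^sub>v v) ` pcarrier (free_pm (cgr ?I)) z = mat_range N \<inter> pcarrier (free_pm r) z"
    proof (intro equalityI subsetI)
      fix x assume "x \<in> (\<lambda>v. N *\<^sub>v v) ` pcarrier (free_pm (cgr ?I)) z"
      then obtain v where v: "x = N *\<^sub>v v" "v \<in> carrier_vec (dim_col N)"
        "\<And>j. j < dim_col N \<Longrightarrow> v $ j \<noteq> 0 \<Longrightarrow> cgr ?I ! j \<le> z"
        unfolding free_pm_carrier I(1-3) by auto
      have "r ! i \<le> z" if i: "i < length r" "x $ i \<noteq> 0" for i
      proof -
        obtain j where j: "j < dim_col N" "N $$ (i, j) \<noteq> 0" "v $ j \<noteq> 0"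
          using mult_mat_vec_index_nonzero[of N v i] i v dim by auto
        then show ?thesis using v(3) cgr_le i by blast
      qed
      then show "x \<in> mat_range N \<inter> pcarrier (free_pm r) z"
        using v dim unfolding mat_range_def free_pm_carrier by (auto intro!: carrier_vecI)
    next
      fix x assume "x \<in> mat_range N \<inter> pcarrier (free_pm r) z"
      then obtain a where a: "x = N *\<^sub>v a" "a \<in> carrier_vec (dim_col N)"
        and x: "\<And>i. i < length r \<Longrightarrow> x $ i \<noteq> 0 \<Longrightarrow> r ! i \<le> z"
        unfolding free_pm_carrier mat_range_def by auto
      have s: "support_le (\<lambda>i. fst (r ! i)) (fst z) (N *\<^sub>v a)" "support_le (\<lambda>i. snd (r ! i)) (snd z) (N *\<^sub>v a)"
        using x a dim unfolding support_le_def by (auto simp: less_eq_prod_def)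
      have "cgr ?I ! j \<le> z" if j: "j < dim_col N" "a $ j \<noteq> 0" for j
      proof -
        have "support_le (\<lambda>i. fst (r ! i)) (fst z) (col N j)" "support_le (\<lambda>i. snd (r ! i)) (snd z) (col N j)"
          using red s a j unfolding reduced_wrt_def by blast+
        then show ?thesis unfolding cgr_le[OF j(1)] using dim j
          by (auto simp: support_le_def less_eq_prod_def)
      qed
      then show "x \<in> (\<lambda>v. N *\<^sub>v v) ` pcarrier (free_pm (cgr ?I)) z"
        using a unfolding free_pm_carrier I(1-3) by auto
    qed
  qed
  show ?thesis unfolding basis_matrix_def I(1-3) using mor bij by auto
qed

text \<open>The result depends on \<open>A\<close> only through its row grades and its column space;
  this is what makes clearing harmless. The statement also is the source of the freeness of the
  cocycle modules.\<close>

theorem bireduce_correct: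
  fixes A :: "'k::field gmatrix"
  assumes "graded_matrix A"
  shows "\<exists>I. bireduce A = Some I \<and> rgr I = rgr A \<and> mat_range (ent I) = mat_range (ent A) \<and>
    basis_matrix I (\<lambda>z. mat_range (ent A) \<inter> pcarrier (free_pm (rgr A)) z)"
proof -
  have dim: "dim_row (ent A) = length (rgr A)" using assms unfolding graded_matrix_def by auto
  obtain B1 B2 where B: "for_columns (c_reduce (rgr A)) [0..<dim_col (ent A)] (ent A) Map.empty = Some B1"
    "for_columns (l_reduce (rgr A)) [0..<dim_col (ent A)] B1 Map.empty = Some B2"
    and B2: "dim_row B2 = length (rgr A)" "mat_range B2 = mat_range (ent A)"
    "reduced_wrt (\<lambda>i. fst (rgr A ! i)) B2" "reduced_wrt (\<lambda>i. snd (rgr A ! i)) B2"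
    using column_reduction[OF dim refl, of "rgr A"] by blast
  let ?N = "nonzero_columns B2"
  have eq: "bireduce A = Some (with_row_grades ?N (rgr A))" unfolding bireduce_def using B by simp
  have "basis_matrix (with_row_grades ?N (rgr A)) (\<lambda>z. mat_range ?N \<inter> pcarrier (free_pm (rgr A)) z)"
    using B2 nonzero_columns_reduced[where B = B2] by (intro reduced_basis_matrix) auto
  then show ?thesis
    using eq B2 nonzero_columns_reduced(1)[of B2] by (simp add: with_row_grades_def)
qed

section \<open>Graded matrices and duality\<close>

text \<open>The condition of \<open>morphism_matrix\<close> for a bare matrix with separately given
  grades, so that products and differences need not be packaged as records.\<close>

definition graded_mat :: "'k::field mat \<Rightarrow> grade list \<Rightarrow> grade list \<Rightarrow> bool" where
  "graded_mat X rs cs \<longleftrightarrow> X \<in> carrier_mat (length rs) (length cs) \<and>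
    (\<forall>i<length rs. \<forall>j<length cs. X $$ (i, j) \<noteq> 0 \<longrightarrow> rs ! i \<le> cs ! j)"

abbreviation free_at :: "grade list \<Rightarrow> grade \<Rightarrow> 'k::field vec set" where
  "free_at gs z \<equiv> pcarrier (free_pm gs) z"

text \<open>The free module with generators in grades \<open>-g\<close>, for \<open>g\<close> in \<open>gs\<close>, evaluated at grade \<open>-w\<close>.\<close>

definition cofree_at :: "grade list \<Rightarrow> grade \<Rightarrow> 'k::field vec set" where
  "cofree_at gs w = {u \<in> carrier_vec (length gs). \<forall>i<length gs. u $ i \<noteq> 0 \<longrightarrow> w \<le> gs ! i}"

lemma morphism_matrix_graded_mat: "morphism_matrix A \<longleftrightarrow> graded_mat (ent A) (rgr A) (cgr A)"
  unfolding morphism_matrix_def graded_mat_def graded_matrix_def by auto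

lemma graded_matD:
  assumes "graded_mat X rs cs"
  shows "X \<in> carrier_mat (length rs) (length cs)"
    and "\<And>i j. i < length rs \<Longrightarrow> j < length cs \<Longrightarrow> X $$ (i, j) \<noteq> 0 \<Longrightarrow> rs ! i \<le> cs ! j"
  using assms unfolding graded_mat_def by blast+

lemma free_atI:
  "v \<in> carrier_vec (length gs) \<Longrightarrow> (\<And>i. i < length gs \<Longrightarrow> v $ i \<noteq> 0 \<Longrightarrow> gs ! i \<le> z) \<Longrightarrow> v \<in> free_at gs z"
  unfolding free_pm_carrier by blast

lemma free_atD:
  assumes "v \<in> free_at gs z"
  shows "v \<in> carrier_vec (length gs)" "\<And>i. i < length gs \<Longrightarrow> v $ i \<noteq> 0 \<Longrightarrow> gs ! i \<le> z"
  using assms unfolding free_pm_carrier by blast+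

lemma cofree_atI:
  "v \<in> carrier_vec (length gs) \<Longrightarrow> (\<And>i. i < length gs \<Longrightarrow> v $ i \<noteq> 0 \<Longrightarrow> z \<le> gs ! i) \<Longrightarrow> v \<in> cofree_at gs z"
  unfolding cofree_at_def by blast

lemma cofree_atD:
  assumes "v \<in> cofree_at gs z"
  shows "v \<in> carrier_vec (length gs)" "\<And>i. i < length gs \<Longrightarrow> v $ i \<noteq> 0 \<Longrightarrow> z \<le> gs ! i"
  using assms unfolding cofree_at_def by blast+

lemma mult_unit_vec:
  fixes A :: "'k::field mat"
  assumes "A \<in> carrier_mat nr nc" "j < nc"
  shows "A *\<^sub>v unit_vec nc j = col A j"
  using assms by (intro eq_vecI) (auto simp: scalar_prod_right_unit)

lemma unit_vec_free_at: "j < length gs \<Longrightarrow> gs ! j \<le> z \<Longrightarrow> unit_vec (length gs) j \<in> free_at gs z"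
  by (rule free_atI) (auto split: if_splits)

lemma unit_vec_cofree_at: "j < length gs \<Longrightarrow> w \<le> gs ! j \<Longrightarrow> unit_vec (length gs) j \<in> cofree_at gs w"
  by (rule cofree_atI) (auto split: if_splits)

lemma graded_mat_mult_vec:
  fixes X :: "'k::field mat"
  assumes X: "graded_mat X rs cs" and v: "v \<in> free_at cs z"
  shows "X *\<^sub>v v \<in> free_at rs z"
proof (rule free_atI)
  note dim = graded_matD(1)[OF X]
  show "X *\<^sub>v v \<in> carrier_vec (length rs)" using dim free_atD(1)[OF v] by simp
  fix i assume i: "i < length rs" "(X *\<^sub>v v) $ i \<noteq> 0"
  then obtain j where "j < length cs" "X $$ (i, j) \<noteq> 0" "v $ j \<noteq> 0"
    using mult_mat_vec_index_nonzero[of X v i] dim free_atD(1)[OF v] by auto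
  then show "rs ! i \<le> z"
    using graded_matD(2)[OF X i(1)] free_atD(2)[OF v] order_trans by blast
qed

lemma graded_mat_transpose_mult_vec:
  fixes X :: "'k::field mat"
  assumes X: "graded_mat X rs cs" and u: "u \<in> cofree_at rs w"
  shows "transpose_mat X *\<^sub>v u \<in> cofree_at cs w"
proof (rule cofree_atI)
  note dim = graded_matD(1)[OF X]
  show "transpose_mat X *\<^sub>v u \<in> carrier_vec (length cs)" using dim cofree_atD(1)[OF u] by simp
  fix j assume j: "j < length cs" "(transpose_mat X *\<^sub>v u) $ j \<noteq> 0"
  then obtain i where "i < length rs" "X $$ (i, j) \<noteq> 0" "u $ i \<noteq> 0"
    using mult_mat_vec_index_nonzero[of "transpose_mat X" u j] dim cofree_atD(1)[OF u] by auto
  then show "w \<le> cs ! j"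
    using graded_matD(2)[OF X _ j(1)] cofree_atD(2)[OF u] order_trans by blast
qed

lemma graded_mat_mult:
  fixes X :: "'k::field mat"
  assumes X: "graded_mat X rs ms" and Y: "graded_mat Y ms cs"
  shows "graded_mat (X * Y) rs cs"
  unfolding graded_mat_def
proof (intro conjI allI impI)
  note dim = graded_matD(1)[OF X] graded_matD(1)[OF Y]
  show "X * Y \<in> carrier_mat (length rs) (length cs)" using dim by simp
  fix i j assume ij: "i < length rs" "j < length cs" "(X * Y) $$ (i, j) \<noteq> 0"
  have "col Y j \<in> free_at ms (cs ! j)"
    using graded_mat_mult_vec[OF Y unit_vec_free_at[OF ij(2) order_refl]] mult_unit_vec[OF dim(2) ij(2)]
    by simp
  then have "X *\<^sub>v col Y j \<in> free_at rs (cs ! j)" by (rule graded_mat_mult_vec[OF X])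
  moreover have "(X *\<^sub>v col Y j) $ i \<noteq> 0" using ij dim by simp
  ultimately show "rs ! i \<le> cs ! j" using free_atD(2) ij(1) by blast
qed

lemma graded_mat_one: "graded_mat (1\<^sub>m (length gs)) gs gs"
  unfolding graded_mat_def by auto

lemma graded_mat_minus:
  assumes X: "graded_mat X rs cs" and Y: "graded_mat Y rs cs"
  shows "graded_mat (X - Y) rs cs"
  unfolding graded_mat_def
proof (intro conjI allI impI)
  show "X - Y \<in> carrier_mat (length rs) (length cs)" using graded_matD(1)[OF Y] by auto
  fix i j assume ij: "i < length rs" "j < length cs" "(X - Y) $$ (i, j) \<noteq> 0"
  then have "X $$ (i, j) \<noteq> 0 \<or> Y $$ (i, j) \<noteq> 0" using graded_matD(1)[OF X] graded_matD(1)[OF Y] by auto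
  then show "rs ! i \<le> cs ! j" using graded_matD(2)[OF X] graded_matD(2)[OF Y] ij by blast
qed

section \<open>Lifting along transposes, and left exact dual complexes\<close>

lemma row_cofree_at:
  assumes "graded_mat X rs cs" "i < length rs"
  shows "row X i \<in> cofree_at cs (rs ! i)"
  using graded_matD[OF assms(1)] assms(2) by (intro cofree_atI) auto

lemma row_eq_transpose_mult:
  fixes Y :: "'k::field mat"
  assumes "X \<in> carrier_mat n m" "Y \<in> carrier_mat m k" "i < n"
  shows "row (X * Y) i = transpose_mat Y *\<^sub>v row X i"
  using assms by (intro eq_vecI) (auto intro!: comm_scalar_prod[of _ m])

text \<open>Projectivity of the free module dual to \<open>rs\<close>: the rows of \<open>X\<close>
  are the images of its basis elements under the transpose, and they can be lifted one at a time.
  The grades of the lifts make \<Phi> graded.\<close>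

lemma factor_through_rows:
  fixes Y :: "'k::field mat"
  assumes Y: "Y \<in> carrier_mat (length ms) k" and X: "X \<in> carrier_mat (length rs) k"
    and lift: "\<And>i. i < length rs \<Longrightarrow> \<exists>u\<in>cofree_at ms (rs ! i). transpose_mat Y *\<^sub>v u = row X i"
  obtains \<Phi> where "graded_mat \<Phi> rs ms" "X = \<Phi> * Y"
proof -
  obtain u where u: "\<And>i. i < length rs \<Longrightarrow> u i \<in> cofree_at ms (rs ! i)"
    "\<And>i. i < length rs \<Longrightarrow> transpose_mat Y *\<^sub>v u i = row X i"
    using lift by metis
  let ?\<Phi> = "mat (length rs) (length ms) (\<lambda>(i, j). u i $ j)"
  have "graded_mat ?\<Phi> rs ms"
    unfolding graded_mat_def using cofree_atD(2)[OF u(1)] by auto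
  moreover have "X = ?\<Phi> * Y"
  proof (rule eq_rowI)
    fix i assume "i < dim_row (?\<Phi> * Y)"
    then have i: "i < length rs" by simp
    have "row ?\<Phi> i = u i" using i cofree_atD(1)[OF u(1)[OF i]] by (intro eq_vecI) auto
    then show "row X i = row (?\<Phi> * Y) i"
      using u(2)[OF i] row_eq_transpose_mult[OF _ Y i, of ?\<Phi>] by simp
  qed (use X Y in auto)
  ultimately show ?thesis using that by blast
qed

text \<open>Left exactness of the complex dual to that of \<open>A\<close> and \<open>B\<close>, whose modules have the generator
  grades \<open>g2\<close>, \<open>g1\<close> and \<open>g0\<close>.\<close>

definition dual_exact :: "'k::field mat \<Rightarrow> 'k mat \<Rightarrow> grade list \<Rightarrow> grade list \<Rightarrow> grade list \<Rightarrow> bool" where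
  "dual_exact A B g2 g1 g0 \<longleftrightarrow> graded_mat A g1 g2 \<and> graded_mat B g0 g1 \<and>
    (\<forall>w. bij_betw (\<lambda>u. transpose_mat B *\<^sub>v u) (cofree_at g0 w)
      {v \<in> cofree_at g1 w. transpose_mat A *\<^sub>v v = 0\<^sub>v (length g2)})"

lemma dual_exact_composition:
  fixes A B :: "'k::field mat"
  assumes "dual_exact A B g2 g1 g0"
  shows "B * A = 0\<^sub>m (length g0) (length g2)"
proof (rule eq_rowI)
  have A: "A \<in> carrier_mat (length g1) (length g2)" and B: "B \<in> carrier_mat (length g0) (length g1)"
    using assms graded_matD(1) unfolding dual_exact_def by blast+
  show "dim_row (B * A) = dim_row (0\<^sub>m (length g0) (length g2) :: 'k mat)"
    "dim_col (B * A) = dim_col (0\<^sub>m (length g0) (length g2) :: 'k mat)" using A B by auto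
  fix i assume "i < dim_row (0\<^sub>m (length g0) (length g2) :: 'k mat)"
  then have i: "i < length g0" by simp
  have "transpose_mat B *\<^sub>v unit_vec (length g0) i = row B i"
    using B i mult_unit_vec[of "transpose_mat B" "length g1" "length g0" i] by simp
  moreover have "transpose_mat B *\<^sub>v unit_vec (length g0) i \<in>
      {v \<in> cofree_at g1 (g0 ! i). transpose_mat A *\<^sub>v v = 0\<^sub>v (length g2)}"
    using assms unit_vec_cofree_at[OF i order_refl] unfolding dual_exact_def bij_betw_def by blast
  ultimately have "transpose_mat A *\<^sub>v row B i = 0\<^sub>v (length g2)" by simp
  then show "row (B * A) i = row (0\<^sub>m (length g0) (length g2)) i"
    using row_eq_transpose_mult[OF B A i] i by simp
qed

text \<open>The rows of \<open>X\<close> are elements of the kernel of the transpose of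
  \<open>A\<close>, so that each of them lifts along the transpose of \<open>B\<close> by exactness
  in the middle.\<close>

lemma dual_exact_factor:
  fixes A B X :: "'k::field mat"
  assumes ex: "dual_exact A B g2 g1 g0" and X: "graded_mat X rs g1"
    and XA: "X * A = 0\<^sub>m (length rs) (length g2)"
  obtains S where "graded_mat S rs g0" "X = S * B"
proof -
  have A: "A \<in> carrier_mat (length g1) (length g2)" and B: "B \<in> carrier_mat (length g0) (length g1)"
    using ex graded_matD(1) unfolding dual_exact_def by blast+
  have "\<exists>u\<in>cofree_at g0 (rs ! i). transpose_mat B *\<^sub>v u = row X i" if i: "i < length rs" for i
  proof -
    have "transpose_mat A *\<^sub>v row X i = 0\<^sub>v (length g2)"
      using row_eq_transpose_mult[OF graded_matD(1)[OF X] A i] XA i by simp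
    then have "row X i \<in> {v \<in> cofree_at g1 (rs ! i). transpose_mat A *\<^sub>v v = 0\<^sub>v (length g2)}"
      using row_cofree_at[OF X i] by blast
    then have "row X i \<in> (\<lambda>u. transpose_mat B *\<^sub>v u) ` cofree_at g0 (rs ! i)"
      using ex unfolding dual_exact_def bij_betw_def by blast
    then show ?thesis by auto
  qed
  then show ?thesis using factor_through_rows[OF B graded_matD(1)[OF X]] that by blast
qed

text \<open>Injectivity of the transpose of \<open>B\<close>, applied to each row.\<close>

lemma dual_exact_cancel:
  fixes A B X Y :: "'k::field mat"
  assumes ex: "dual_exact A B g2 g1 g0" and X: "graded_mat X rs g0" and Y: "graded_mat Y rs g0"
    and eq: "X * B = Y * B"
  shows "X = Y"
proof (rule eq_rowI)
  have B: "B \<in> carrier_mat (length g0) (length g1)"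
    using ex graded_matD(1) unfolding dual_exact_def by blast
  note dim = graded_matD(1)[OF X] graded_matD(1)[OF Y]
  show "dim_row X = dim_row Y" "dim_col X = dim_col Y" using dim by auto
  fix i assume "i < dim_row Y"
  then have i: "i < length rs" using dim by simp
  have "transpose_mat B *\<^sub>v row X i = transpose_mat B *\<^sub>v row Y i"
    using row_eq_transpose_mult[OF dim(1) B i] row_eq_transpose_mult[OF dim(2) B i] eq by simp
  then show "row X i = row Y i"
    using ex row_cofree_at[OF X i] row_cofree_at[OF Y i] unfolding dual_exact_def bij_betw_def
    by (meson inj_onD)
qed

lemma graded_mat_add:
  assumes X: "graded_mat X rs cs" and Y: "graded_mat Y rs cs"
  shows "graded_mat (X + Y) rs cs"
  unfolding graded_mat_def
proof (intro conjI allI impI)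
  show "X + Y \<in> carrier_mat (length rs) (length cs)" using graded_matD(1)[OF Y] by auto
  fix i j assume ij: "i < length rs" "j < length cs" "(X + Y) $$ (i, j) \<noteq> 0"
  then have "X $$ (i, j) \<noteq> 0 \<or> Y $$ (i, j) \<noteq> 0" using graded_matD(1)[OF X] graded_matD(1)[OF Y] by auto
  then show "rs ! i \<le> cs ! j" using graded_matD(2)[OF X] graded_matD(2)[OF Y] ij by blast
qed

lemma mat_eq_add_of_minus:
  fixes X :: "'k::field mat"
  assumes "X \<in> carrier_mat n n" "Z \<in> carrier_mat n n" "X - 1\<^sub>m n = Z"
  shows "X = 1\<^sub>m n + Z"
proof (rule eq_matI)
  fix i j assume "i < dim_row (1\<^sub>m n + Z)" "j < dim_col (1\<^sub>m n + Z)"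
  then have ij: "i < n" "j < n" using assms by auto
  have "Z $$ (i, j) = X $$ (i, j) - 1\<^sub>m n $$ (i, j)"
    using ij assms(1) by (simp add: assms(3)[symmetric])
  then show "X $$ (i, j) = (1\<^sub>m n + Z) $$ (i, j)" using ij assms(1,2) by simp
qed (use assms in auto)

text \<open>Projective resolutions with isomorphic cokernels are homotopy equivalent; here the resolutions
  are the transposes, so that the homotopy equivalence can be transposed back.\<close>

lemma dual_exact_homotopy:
  fixes A B I D' :: "'k::field mat"
  assumes AB: "dual_exact A B g2 g1 g0" and ID: "dual_exact I D' g2 r1 r0"
    and im: "\<And>w. (\<lambda>u. transpose_mat A *\<^sub>v u) ` cofree_at g1 w = (\<lambda>u. transpose_mat I *\<^sub>v u) ` cofree_at r1 w"
  obtains \<Phi> \<Psi> S T \<Phi>0 \<Psi>0 where "graded_mat \<Phi> r1 g1" "graded_mat \<Psi> g1 r1" "graded_mat S g1 g0"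
    "graded_mat T r1 r0" "graded_mat \<Phi>0 r0 g0" "graded_mat \<Psi>0 g0 r0"
    "I = \<Phi> * A" "A = \<Psi> * I" "\<Psi> * \<Phi> = 1\<^sub>m (length g1) + S * B"
    "D' * \<Phi> = \<Phi>0 * B" "B * \<Psi> = \<Psi>0 * D'"
    "\<Phi>0 * \<Psi>0 = 1\<^sub>m (length r0) + D' * T" "\<Psi>0 * \<Phi>0 = 1\<^sub>m (length g0) + B * S"
proof -
  have gA: "graded_mat A g1 g2" and gB: "graded_mat B g0 g1"
    and gI: "graded_mat I r1 g2" and gD: "graded_mat D' r0 r1"
    using AB ID unfolding dual_exact_def by blast+
  note A = graded_matD(1)[OF gA] and B = graded_matD(1)[OF gB]
    and I = graded_matD(1)[OF gI] and D = graded_matD(1)[OF gD]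
  \<comment> \<open>A row is the image under the transpose of a dual basis element, taken in its own
    grade; \<open>im\<close> then moves it from one image to the other.\<close>
  have row_im: "row X i \<in> (\<lambda>u. transpose_mat X *\<^sub>v u) ` cofree_at gs (gs ! i)"
    if "X \<in> carrier_mat (length gs) n" "i < length gs" for X :: "'k mat" and gs n i
    using that mult_unit_vec[of "transpose_mat X" n "length gs" i] unit_vec_cofree_at[OF that(2) order_refl]
    by (intro image_eqI[of _ _ "unit_vec (length gs) i"]) auto
  obtain \<Phi> where gP: "graded_mat \<Phi> r1 g1" and IA: "I = \<Phi> * A"
  proof (rule factor_through_rows[OF A I])
    fix i assume "i < length r1"
    then have "row I i \<in> (\<lambda>u. transpose_mat A *\<^sub>v u) ` cofree_at g1 (r1 ! i)"
      using row_im[OF I] im by blast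
    then show "\<exists>u\<in>cofree_at g1 (r1 ! i). transpose_mat A *\<^sub>v u = row I i" by auto
  qed
  obtain \<Psi> where gQ: "graded_mat \<Psi> g1 r1" and AI: "A = \<Psi> * I"
  proof (rule factor_through_rows[OF I A])
    fix i assume "i < length g1"
    then have "row A i \<in> (\<lambda>u. transpose_mat I *\<^sub>v u) ` cofree_at r1 (g1 ! i)"
      using row_im[OF A] im by blast
    then show "\<exists>u\<in>cofree_at r1 (g1 ! i). transpose_mat I *\<^sub>v u = row A i" by auto
  qed
  note P = graded_matD(1)[OF gP] and Q = graded_matD(1)[OF gQ]
  note DI = dual_exact_composition[OF ID] and BA = dual_exact_composition[OF AB]
  \<comment> \<open>As \<open>A = \<Psi> * I\<close> and \<open>I = \<Phi> * A\<close>, the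
    composite acts as the identity on \<open>A\<close>; the difference from the identity therefore
    factors through \<open>B\<close>, and the factor is the homotopy.\<close>
  have "(\<Psi> * \<Phi> - 1\<^sub>m (length g1)) * A = \<Psi> * (\<Phi> * A) - A"
    using A P Q by (simp add: minus_mult_distrib_mat[of _ "length g1" "length g1"])
  also have "\<dots> = 0\<^sub>m (length g1) (length g2)" unfolding IA[symmetric] AI[symmetric] using A by simp
  finally obtain S where gS: "graded_mat S g1 g0" and "\<Psi> * \<Phi> - 1\<^sub>m (length g1) = S * B"
    using dual_exact_factor[OF AB graded_mat_minus[OF graded_mat_mult[OF gQ gP] graded_mat_one]] by blast
  then have QP: "\<Psi> * \<Phi> = 1\<^sub>m (length g1) + S * B"
    using P Q graded_matD(1)[OF gS] B by (intro mat_eq_add_of_minus) auto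
  have "(\<Phi> * \<Psi> - 1\<^sub>m (length r1)) * I = \<Phi> * (\<Psi> * I) - I"
    using I P Q by (simp add: minus_mult_distrib_mat[of _ "length r1" "length r1"])
  also have "\<dots> = 0\<^sub>m (length r1) (length g2)" unfolding AI[symmetric] IA[symmetric] using I by simp
  finally obtain T where gT: "graded_mat T r1 r0" and "\<Phi> * \<Psi> - 1\<^sub>m (length r1) = T * D'"
    using dual_exact_factor[OF ID graded_mat_minus[OF graded_mat_mult[OF gP gQ] graded_mat_one]] by blast
  then have PQ: "\<Phi> * \<Psi> = 1\<^sub>m (length r1) + T * D'"
    using P Q graded_matD(1)[OF gT] D by (intro mat_eq_add_of_minus) auto
  note S = graded_matD(1)[OF gS] and T = graded_matD(1)[OF gT]
  \<comment> \<open>The maps between the last modules are induced: \<open>D' * \<Phi>\<close>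
    annihilates \<open>A\<close> because \<open>D' * I\<close> vanishes, and likewise for
    \<Psi>.\<close>
  have "D' * \<Phi> * A = D' * (\<Phi> * A)" using D P A by simp
  also have "\<dots> = 0\<^sub>m (length r0) (length g2)" unfolding IA[symmetric] by (rule DI)
  finally obtain \<Phi>0 where gP0: "graded_mat \<Phi>0 r0 g0" and P0: "D' * \<Phi> = \<Phi>0 * B"
    using dual_exact_factor[OF AB graded_mat_mult[OF gD gP]] by blast
  have "B * \<Psi> * I = B * (\<Psi> * I)" using B Q I by simp
  also have "\<dots> = 0\<^sub>m (length g0) (length g2)" unfolding AI[symmetric] by (rule BA)
  finally obtain \<Psi>0 where gQ0: "graded_mat \<Psi>0 g0 r0" and Q0: "B * \<Psi> = \<Psi>0 * D'"
    using dual_exact_factor[OF ID graded_mat_mult[OF gB gQ]] by blast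
  note P0c = graded_matD(1)[OF gP0] and Q0c = graded_matD(1)[OF gQ0]
  \<comment> \<open>The homotopy identity on the last module is verified after multiplication by
    \<open>D'\<close>, which can be cancelled by dual exactness; the homotopy is the same
    \<open>T\<close>.\<close>
  have "\<Phi>0 * \<Psi>0 * D' = \<Phi>0 * (\<Psi>0 * D')" using P0c Q0c D by simp
  also have "\<dots> = (\<Phi>0 * B) * \<Psi>" unfolding Q0[symmetric] using P0c B Q by simp
  also have "\<dots> = D' * (\<Phi> * \<Psi>)" unfolding P0[symmetric] using D P Q by simp
  also have "\<dots> = (1\<^sub>m (length r0) + D' * T) * D'"
    unfolding PQ using D T by (simp add: mult_add_distrib_mat[of D' "length r0" "length r1" _ "length r1"]
        add_mult_distrib_mat[of _ "length r0" "length r0" _ D' "length r1"])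
  finally have PQ0: "\<Phi>0 * \<Psi>0 = 1\<^sub>m (length r0) + D' * T"
    by (rule dual_exact_cancel[OF ID graded_mat_mult[OF gP0 gQ0]
          graded_mat_add[OF graded_mat_one graded_mat_mult[OF gD gT]]])
  have "\<Psi>0 * \<Phi>0 * B = \<Psi>0 * (\<Phi>0 * B)" using P0c Q0c B by simp
  also have "\<dots> = (\<Psi>0 * D') * \<Phi>" unfolding P0[symmetric] using Q0c D P by simp
  also have "\<dots> = B * (\<Psi> * \<Phi>)" unfolding Q0[symmetric] using B P Q by simp
  also have "\<dots> = (1\<^sub>m (length g0) + B * S) * B"
    unfolding QP using B S by (simp add: mult_add_distrib_mat[of B "length g0" "length g1" _ "length g1"]
        add_mult_distrib_mat[of _ "length g0" "length g0" _ B "length g1"])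
  finally have QP0: "\<Psi>0 * \<Phi>0 = 1\<^sub>m (length g0) + B * S"
    by (rule dual_exact_cancel[OF AB graded_mat_mult[OF gQ0 gP0]
          graded_mat_add[OF graded_mat_one graded_mat_mult[OF gB gS]]])
  show ?thesis using that[OF gP gQ gS gT gP0 gQ0 IA AI QP P0 Q0 PQ0 QP0] .
qed

section \<open>Large grades, and the dual of the cocycle modules\<close>

lemma grade_upper_bound: "\<exists>z::grade. (\<forall>g\<in>set gs. g \<le> z) \<and> M \<le> fst z \<and> M \<le> snd z"
proof (induction gs)
  case Nil
  show ?case by (rule exI[of _ "(M, M)"]) simp
next
  case (Cons g gs)
  then obtain z where z: "\<forall>g\<in>set gs. g \<le> z" "M \<le> fst z" "M \<le> snd z" by blast
  have "fst z \<le> fst (sup g z)" "snd z \<le> snd (sup g z)" by (simp_all add: sup_prod_def)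
  then have "M \<le> fst (sup g z)" "M \<le> snd (sup g z)" using z(2,3) by linarith+
  moreover have "\<forall>g'\<in>set (g # gs). g' \<le> sup g z" using z(1) by (auto intro: le_supI2)
  ultimately show ?case by blast
qed

text \<open>A grade above all generators stands in for the colimit: there every coefficient vector
  is an element of the module. Linear algebra without grades is reduced to statements in one such
  grade.\<close>

lemma free_at_UNIV:
  assumes "\<forall>g\<in>set gs. g \<le> z"
  shows "free_at gs z = carrier_vec (length gs)"
  unfolding free_pm_carrier using assms by auto

lemma free_at_minus:
  assumes "u \<in> free_at gs z" "v \<in> free_at gs z"
  shows "u - v \<in> free_at gs z"
proof (rule free_atI)
  note dim = free_atD(1)[OF assms(1)] free_atD(1)[OF assms(2)]
  show "u - v \<in> carrier_vec (length gs)" using dim by simp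
  fix i assume i: "i < length gs" "(u - v) $ i \<noteq> 0"
  then have "u $ i \<noteq> 0 \<or> v $ i \<noteq> 0" using dim by auto
  then show "gs ! i \<le> z" using i(1) free_atD(2)[OF assms(1)] free_atD(2)[OF assms(2)] by blast
qed

lemma zero_free_at: "0\<^sub>v (length gs) \<in> free_at gs z"
  by (rule free_atI) auto

text \<open>Injectivity in a single grade above all generators is already injectivity on all
  coefficient vectors.\<close>

lemma basis_injective:
  fixes J :: "'k::field mat"
  assumes "\<And>z. inj_on (\<lambda>v. J *\<^sub>v v) (free_at q z)"
    and "a \<in> carrier_vec (length q)" "b \<in> carrier_vec (length q)" "J *\<^sub>v a = J *\<^sub>v b"
  shows "a = b"
proof -
  obtain z where "\<forall>g\<in>set q. g \<le> z" using grade_upper_bound by blast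
  then have "free_at q z = (carrier_vec (length q) :: 'k vec set)" by (rule free_at_UNIV)
  then show ?thesis using assms(1)[of z] assms(2-) by (simp add: inj_on_def)
qed

text \<open>The counterpart of \<open>factor_through_rows\<close> for the modules themselves: the
  basis elements of the source are lifted one at a time.\<close>

lemma factor_through_columns:
  fixes J D :: "'k::field mat"
  assumes J: "J \<in> carrier_mat n (length q)" and D: "D \<in> carrier_mat n (length r)"
    and lift: "\<And>i. i < length r \<Longrightarrow> \<exists>c\<in>free_at q (r ! i). J *\<^sub>v c = col D i"
  obtains D' where "graded_mat D' q r" "D = J * D'"
proof -
  obtain c where c: "\<And>i. i < length r \<Longrightarrow> c i \<in> free_at q (r ! i)"
    "\<And>i. i < length r \<Longrightarrow> J *\<^sub>v c i = col D i"
    using lift by metis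
  let ?D = "mat (length q) (length r) (\<lambda>(l, i). c i $ l)"
  have "graded_mat ?D q r" unfolding graded_mat_def using free_atD(2)[OF c(1)] by auto
  moreover have "D = J * ?D"
  proof (rule eq_matI)
    fix s i assume "s < dim_row (J * ?D)" "i < dim_col (J * ?D)"
    then have si: "s < n" "i < length r" using J by auto
    have "col ?D i = c i" using si free_atD(1)[OF c(1)[OF si(2)]] by (intro eq_vecI) auto
    then have "(J * ?D) $$ (s, i) = (J *\<^sub>v c i) $ s" using si J by simp
    also have "\<dots> = D $$ (s, i)" using c(2)[OF si(2)] si D by simp
    finally show "D $$ (s, i) = (J * ?D) $$ (s, i)" by simp
  qed (use J D in auto)
  ultimately show ?thesis using that by blast
qed

text \<open>Finiteness of the cohomology enters here: the basis element of grade \<open>q ! l\<close> becomes a coboundary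
  when one coordinate of its grade is increased far enough, the other one being kept.\<close>

lemma cocycles_dual_exact:
  fixes D I J :: "'k::field mat"
  assumes D: "graded_mat D r' r" and I: "graded_mat I r h" and J: "graded_mat J r' q"
    and bI: "\<And>z. bij_betw (\<lambda>v. I *\<^sub>v v) (free_at h z) {v \<in> free_at r z. D *\<^sub>v v = 0\<^sub>v (length r')}"
    and bJ: "\<And>z. bij_betw (\<lambda>v. J *\<^sub>v v) (free_at q z) (mat_range D \<inter> free_at r' z)"
    and vanish: "\<And>z v. M \<le> fst z \<or> M \<le> snd z \<Longrightarrow> v \<in> mat_range D \<Longrightarrow> v \<in> free_at r' z \<Longrightarrow>
      \<exists>u\<in>free_at r z. D *\<^sub>v u = v"
  obtains D' where "graded_mat D' q r" "D = J * D'" "dual_exact I D' h r q"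
proof -
  note Dc = graded_matD(1)[OF D] and Ic = graded_matD(1)[OF I] and Jc = graded_matD(1)[OF J]
  have "\<exists>c\<in>free_at q (r ! i). J *\<^sub>v c = col D i" if i: "i < length r" for i
  proof -
    have "D *\<^sub>v unit_vec (length r) i \<in> free_at r' (r ! i)"
      by (rule graded_mat_mult_vec[OF D unit_vec_free_at[OF i order_refl]])
    then have "col D i \<in> free_at r' (r ! i)" unfolding mult_unit_vec[OF Dc i] .
    moreover have "col D i \<in> mat_range D"
      unfolding mat_range_def mult_unit_vec[OF Dc i, symmetric] using Dc by auto
    ultimately have "col D i \<in> (\<lambda>v. J *\<^sub>v v) ` free_at q (r ! i)" using bJ unfolding bij_betw_def by blast
    then show ?thesis by auto
  qed
  then obtain D' where D': "graded_mat D' q r" and DJ: "D = J * D'"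
    using factor_through_columns[OF Jc Dc] by blast
  note D'c = graded_matD(1)[OF D']
  have J_inj: "a = b" if "a \<in> carrier_vec (length q)" "b \<in> carrier_vec (length q)" "J *\<^sub>v a = J *\<^sub>v b" for a b
    using basis_injective[OF _ that] bJ unfolding bij_betw_def by blast
  have D_eq: "D *\<^sub>v v = J *\<^sub>v (D' *\<^sub>v v)" if "v \<in> carrier_vec (length r)" for v
    unfolding DJ using that Jc D'c by simp
  \<comment> \<open>The basis element \<open>l\<close> is a cocycle under \<open>J\<close>. In a
    grade \<open>z\<close> with one coordinate at least \<open>M\<close> it is also a coboundary,
    and injectivity of \<open>J\<close> turns this into a preimage under \<open>D'\<close>.\<close>
  have preimage: "\<exists>c\<in>free_at r z. D' *\<^sub>v c = unit_vec (length q) l"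
    if l: "l < length q" "q ! l \<le> z" and z: "M \<le> fst z \<or> M \<le> snd z" for l z
  proof -
    have "J *\<^sub>v unit_vec (length q) l \<in> mat_range D \<inter> free_at r' z"
      using bJ unit_vec_free_at[OF l] unfolding bij_betw_def by blast
    then obtain c where c: "c \<in> free_at r z" "D *\<^sub>v c = J *\<^sub>v unit_vec (length q) l"
      using vanish[OF z] by blast
    then have "J *\<^sub>v (D' *\<^sub>v c) = J *\<^sub>v unit_vec (length q) l" using D_eq free_atD(1) by metis
    then have "D' *\<^sub>v c = unit_vec (length q) l"
      using J_inj[of "D' *\<^sub>v c"] D'c free_atD(1)[OF c(1)] by simp
    then show ?thesis using c(1) by blast
  qed
  obtain z0 where z0: "\<forall>g\<in>set (q @ r). g \<le> z0" "M \<le> fst z0" "M \<le> snd z0"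
    using grade_upper_bound by blast
  have "\<exists>c. \<forall>l<length q. c l \<in> free_at r z0 \<and> D' *\<^sub>v c l = unit_vec (length q) l"
  proof (rule choice_iff[THEN iffD1, of "\<lambda>l x. l < length q \<longrightarrow> x \<in> free_at r z0 \<and> D' *\<^sub>v x = unit_vec (length q) l", rule_format])
    fix l
    show "\<exists>x. l < length q \<longrightarrow> x \<in> free_at r z0 \<and> D' *\<^sub>v x = unit_vec (length q) l"
      using preimage[of l z0] z0 by (cases "l < length q") auto
  qed
  then obtain c where c: "\<And>l. l < length q \<Longrightarrow> c l \<in> free_at r z0"
    "\<And>l. l < length q \<Longrightarrow> D' *\<^sub>v c l = unit_vec (length q) l" by blast
  \<comment> \<open>A right inverse of \<open>D'\<close>, assembled from the preimages in the large
    grade \<open>z0\<close>. It serves as an ungraded matrix; grades are restored at the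
    end.\<close>
  define C where "C = mat (length r) (length q) (\<lambda>(i, l). c l $ i)"
  have Cc: "C \<in> carrier_mat (length r) (length q)" unfolding C_def by simp
  have D'C: "D' * C = 1\<^sub>m (length q)"
  proof (rule eq_matI)
    fix l' l assume "l' < dim_row (1\<^sub>m (length q) :: 'k mat)" "l < dim_col (1\<^sub>m (length q) :: 'k mat)"
    then have l: "l' < length q" "l < length q" by auto
    have "col C l = c l" unfolding C_def using l free_atD(1)[OF c(1)[OF l(2)]] by (intro eq_vecI) auto
    then have "(D' * C) $$ (l', l) = (D' *\<^sub>v c l) $ l'" using l D'c Cc by simp
    then show "(D' * C) $$ (l', l) = 1\<^sub>m (length q) $$ (l', l)" using c(2)[OF l(2)] l by simp
  qed (use D'c Cc in auto)
  \<comment> \<open>In the grade \<open>z0\<close> a kernel vector of \<open>D'\<close> is a kernel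
    vector of \<open>D\<close> in the domain of \<open>bI\<close>, hence a combination of the
    columns of \<open>I\<close>.\<close>
  have kerD: "\<exists>a\<in>carrier_vec (length h). v = I *\<^sub>v a"
    if v: "v \<in> carrier_vec (length r)" "D' *\<^sub>v v = 0\<^sub>v (length q)" for v
  proof -
    have "v \<in> free_at r z0" using z0(1) v(1) by (subst free_at_UNIV) auto
    moreover have "D *\<^sub>v v = 0\<^sub>v (length r')" unfolding D_eq[OF v(1)] v(2) using Jc by auto
    ultimately have "v \<in> (\<lambda>v. I *\<^sub>v v) ` free_at h z0" using bI unfolding bij_betw_def by blast
    then show ?thesis using free_atD(1) by blast
  qed
  have ID': "D' * I = 0\<^sub>m (length q) (length h)"
  proof (rule eq_matI)
    fix l j assume "l < dim_row (0\<^sub>m (length q) (length h) :: 'k mat)" "j < dim_col (0\<^sub>m (length q) (length h) :: 'k mat)"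
    then have lj: "l < length q" "j < length h" by auto
    have "I *\<^sub>v unit_vec (length h) j \<in> {v \<in> free_at r (h ! j). D *\<^sub>v v = 0\<^sub>v (length r')}"
      using bI unit_vec_free_at[OF lj(2) order_refl] unfolding bij_betw_def by blast
    then have "D *\<^sub>v col I j = 0\<^sub>v (length r')" unfolding mult_unit_vec[OF Ic lj(2)] by blast
    moreover have "col I j \<in> carrier_vec (length r)" using Ic lj(2) by (intro col_carrier_vec) auto
    moreover have "J *\<^sub>v 0\<^sub>v (length q) = 0\<^sub>v (length r')" using Jc by auto
    ultimately have "D' *\<^sub>v col I j = 0\<^sub>v (length q)"
      using D_eq J_inj[of "D' *\<^sub>v col I j" "0\<^sub>v (length q)"] D'c by simp
    moreover have "(D' * I) $$ (l, j) = (D' *\<^sub>v col I j) $ l" using lj D'c Ic by simp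
    ultimately show "(D' * I) $$ (l, j) = 0\<^sub>m (length q) (length h) $$ (l, j)" using lj by simp
  qed (use D'c Ic in auto)
  have bij: "bij_betw (\<lambda>u. transpose_mat D' *\<^sub>v u) (cofree_at q w)
      {v \<in> cofree_at r w. transpose_mat I *\<^sub>v v = 0\<^sub>v (length h)}" for w
    unfolding bij_betw_def
  proof
    have left_inv: "transpose_mat C *\<^sub>v (transpose_mat D' *\<^sub>v u) = u" if "u \<in> carrier_vec (length q)" for u
    proof -
      have "transpose_mat C *\<^sub>v (transpose_mat D' *\<^sub>v u) = transpose_mat (D' * C) *\<^sub>v u"
        using transpose_mult[OF D'c Cc] that D'c Cc by simp
      then show ?thesis unfolding D'C using that by simp
    qed
    show "inj_on (\<lambda>u. transpose_mat D' *\<^sub>v u) (cofree_at q w)"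
      using left_inv cofree_atD(1) by (metis (no_types, lifting) inj_on_def)
    show "(\<lambda>u. transpose_mat D' *\<^sub>v u) ` cofree_at q w =
        {v \<in> cofree_at r w. transpose_mat I *\<^sub>v v = 0\<^sub>v (length h)}"
    proof (intro equalityI subsetI)
      fix x assume "x \<in> (\<lambda>u. transpose_mat D' *\<^sub>v u) ` cofree_at q w"
      then obtain u where u: "u \<in> cofree_at q w" "x = transpose_mat D' *\<^sub>v u" by blast
      have "transpose_mat I *\<^sub>v x = transpose_mat (D' * I) *\<^sub>v u"
        using transpose_mult[OF D'c Ic] cofree_atD(1)[OF u(1)] u(2) D'c Ic by simp
      also have "\<dots> = 0\<^sub>v (length h)" unfolding ID' using cofree_atD(1)[OF u(1)] by auto
      finally show "x \<in> {v \<in> cofree_at r w. transpose_mat I *\<^sub>v v = 0\<^sub>v (length h)}"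
        using graded_mat_transpose_mult_vec[OF D' u(1)] u(2) by blast
    next
      fix u assume "u \<in> {v \<in> cofree_at r w. transpose_mat I *\<^sub>v v = 0\<^sub>v (length h)}"
      then have u: "u \<in> cofree_at r w" "transpose_mat I *\<^sub>v u = 0\<^sub>v (length h)" by auto
      note uc = cofree_atD(1)[OF u(1)]
      \<comment> \<open>The candidate for the preimage of \<open>u\<close>, found without regard to
        grades. It remains to show that it is a preimage, and that it lies in the right
        grade.\<close>
      define t where "t = transpose_mat C *\<^sub>v u"
      have tc: "t \<in> carrier_vec (length q)" unfolding t_def using Cc uc by auto
      have ut: "u = transpose_mat D' *\<^sub>v t"
      proof (rule eq_vecI)
        fix i assume "i < dim_vec (transpose_mat D' *\<^sub>v t)"
        then have i: "i < length r" using D'c by simp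
        let ?e = "unit_vec (length r) i :: 'k vec"
        \<comment> \<open>The component of the unit vector in the kernel of \<open>D'\<close>, along
          the image of \<open>C\<close>. Since \<open>u\<close> is orthogonal to the columns of
          \<open>I\<close>, it is orthogonal to this kernel, so its pairing with the unit vector is
          determined by \<open>t\<close>.\<close>
        let ?v = "?e - C *\<^sub>v (D' *\<^sub>v ?e)"
        have ec: "D' *\<^sub>v ?e \<in> carrier_vec (length q)" "C *\<^sub>v (D' *\<^sub>v ?e) \<in> carrier_vec (length r)"
          using D'c Cc by auto
        have "D' *\<^sub>v (C *\<^sub>v (D' *\<^sub>v ?e)) = (D' * C) *\<^sub>v (D' *\<^sub>v ?e)" using ec D'c Cc by simp
        also have "\<dots> = D' *\<^sub>v ?e" unfolding D'C using ec by simp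
        finally have "D' *\<^sub>v ?v = D' *\<^sub>v ?e - D' *\<^sub>v ?e"
          using ec by (subst mult_minus_distrib_mat_vec[OF D'c]) auto
        also have "\<dots> = 0\<^sub>v (length q)" using ec by simp
        finally obtain a where a: "a \<in> carrier_vec (length h)" "?v = I *\<^sub>v a"
          using kerD[of ?v] ec by auto
        have "u \<bullet> ?v = (transpose_mat I *\<^sub>v u) \<bullet> a"
          unfolding a(2) using transpose_vec_mult_scalar[OF Ic a(1) uc] by simp
        also have "\<dots> = 0" unfolding u(2) using a(1) by simp
        finally have "u \<bullet> ?e = u \<bullet> (C *\<^sub>v (D' *\<^sub>v ?e))"
          using scalar_prod_minus_distrib[OF uc _ ec(2), of ?e] by simp
        also have "\<dots> = t \<bullet> (D' *\<^sub>v ?e)"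
          unfolding t_def using transpose_vec_mult_scalar[OF Cc ec(1) uc] by simp
        also have "\<dots> = (transpose_mat D' *\<^sub>v t) \<bullet> ?e"
          using transpose_vec_mult_scalar[OF D'c _ tc, of ?e] by simp
        finally show "u $ i = (transpose_mat D' *\<^sub>v t) $ i"
          using i uc tc D'c by (simp add: scalar_prod_right_unit[of _ "length r"])
      qed (use uc D'c in auto)
      have "t \<in> cofree_at q w"
      proof (rule cofree_atI[OF tc])
        fix l assume l: "l < length q" "t $ l \<noteq> 0"
        show "w \<le> q ! l"
        proof (rule ccontr)
          assume "\<not> w \<le> q ! l"
          then have "fst (q ! l) < fst w \<or> snd (q ! l) < snd w" by (auto simp: less_eq_prod_def)
          \<comment> \<open>The coordinate in which \<open>w \<le> q ! l\<close> fails is kept and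
            the other one is raised to at least \<open>M\<close>: the grade becomes large enough for
            a preimage to exist, yet does not get above \<open>w\<close>.\<close>
          then obtain z where z: "q ! l \<le> z" "M \<le> fst z \<or> M \<le> snd z" "\<not> w \<le> z"
          proof
            assume "fst (q ! l) < fst w"
            then show ?thesis
              by (intro that[of "(fst (q ! l), max M (snd (q ! l)))"]) (auto simp: less_eq_prod_def)
          next
            assume "snd (q ! l) < snd w"
            then show ?thesis
              by (intro that[of "(max M (fst (q ! l)), snd (q ! l))"]) (auto simp: less_eq_prod_def)
          qed
          obtain c where c: "c \<in> free_at r z" "D' *\<^sub>v c = unit_vec (length q) l"
            using preimage[OF l(1) z(1,2)] by blast
          have "t $ l = t \<bullet> (D' *\<^sub>v c)" unfolding c(2) using l(1) tc by simp
          also have "\<dots> = u \<bullet> c" unfolding ut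
            using transpose_vec_mult_scalar[OF D'c free_atD(1)[OF c(1)] tc] by simp
          \<comment> \<open>The nonzero rows of \<open>u\<close> have grades at least
            \<open>w\<close>, those of \<open>c\<close> grades at most \<open>z\<close>. A common
            one would give \<open>w \<le> z\<close>.\<close>
          also have "\<dots> = 0"
            unfolding scalar_prod_def
          proof (rule sum.neutral, rule ballI)
            fix i assume "i \<in> {0..<dim_vec c}"
            then have i: "i < length r" using free_atD(1)[OF c(1)] by simp
            show "u $ i * c $ i = 0"
              using cofree_atD(2)[OF u(1) i] free_atD(2)[OF c(1) i] z(3) order_trans by fastforce
          qed
          finally show False using l(2) by simp
        qed
      qed
      then show "u \<in> (\<lambda>u. transpose_mat D' *\<^sub>v u) ` cofree_at q w" using ut by blast
    qed
  qed
  show ?thesis using that[OF D' DJ] bij I D' unfolding dual_exact_def by blast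
qed

text \<open>The homotopy equivalence in the form needed for elements: in every grade
  \<open>E\<close> identifies the cokernel of \<open>B\<close> with the cocycles in
  \<open>mat_range D\<close> modulo the image of \<open>D\<close>, and the complex of
  \<open>A\<close> and \<open>B\<close> is exact elsewhere. \<open>E\<close> is
  \<open>\<Phi>0\<close> followed by the inclusion \<open>J\<close> of the cocycle module, so that
  its values represent cohomology classes directly.\<close>

lemma dual_resolution:
  fixes D I J A B :: "'k::field mat"
  assumes D: "graded_mat D r' r" and I: "graded_mat I r h" and J: "graded_mat J r' q"
    and bI: "\<And>z. bij_betw (\<lambda>v. I *\<^sub>v v) (free_at h z) {v \<in> free_at r z. D *\<^sub>v v = 0\<^sub>v (length r')}"
    and bJ: "\<And>z. bij_betw (\<lambda>v. J *\<^sub>v v) (free_at q z) (mat_range D \<inter> free_at r' z)"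
    and vanish: "\<And>z v. M \<le> fst z \<or> M \<le> snd z \<Longrightarrow> v \<in> mat_range D \<Longrightarrow> v \<in> free_at r' z \<Longrightarrow>
      \<exists>u\<in>free_at r z. D *\<^sub>v u = v"
    and AB: "dual_exact A B h g1 g0"
    and im: "\<And>w. (\<lambda>u. transpose_mat A *\<^sub>v u) ` cofree_at g1 w = (\<lambda>u. transpose_mat I *\<^sub>v u) ` cofree_at r w"
  obtains E where "graded_mat E r' g0"
    and "\<And>x. x \<in> carrier_vec (length g0) \<Longrightarrow> E *\<^sub>v x \<in> mat_range D"
    and "\<And>z y. y \<in> mat_range D \<Longrightarrow> y \<in> free_at r' z \<Longrightarrow>
      \<exists>x\<in>free_at g0 z. \<exists>u\<in>free_at r z. E *\<^sub>v x = y + D *\<^sub>v u"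
    and "\<And>z x u. x \<in> free_at g0 z \<Longrightarrow> u \<in> free_at r z \<Longrightarrow> E *\<^sub>v x = D *\<^sub>v u \<Longrightarrow> \<exists>w\<in>free_at g1 z. x = B *\<^sub>v w"
    and "\<And>z w. w \<in> free_at g1 z \<Longrightarrow> \<exists>u\<in>free_at r z. E *\<^sub>v (B *\<^sub>v w) = D *\<^sub>v u"
    and "\<And>z w. w \<in> free_at g1 z \<Longrightarrow> B *\<^sub>v w = 0\<^sub>v (length g0) \<Longrightarrow> \<exists>v\<in>free_at h z. w = A *\<^sub>v v"
    and "\<And>z v. v \<in> free_at h z \<Longrightarrow> A *\<^sub>v v = 0\<^sub>v (length g1) \<Longrightarrow> v = 0\<^sub>v (length h)"
proof -
  obtain D' where D': "graded_mat D' q r" and DJ: "D = J * D'" and ID: "dual_exact I D' h r q"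
    using cocycles_dual_exact[OF D I J bI bJ vanish] by blast
  obtain \<Phi> \<Psi> S T \<Phi>0 \<Psi>0 where g: "graded_mat \<Phi> r g1" "graded_mat \<Psi> g1 r" "graded_mat S g1 g0"
    "graded_mat T r q" "graded_mat \<Phi>0 q g0" "graded_mat \<Psi>0 g0 q"
    and IA: "I = \<Phi> * A" and AI: "A = \<Psi> * I" and QP: "\<Psi> * \<Phi> = 1\<^sub>m (length g1) + S * B"
    and P0: "D' * \<Phi> = \<Phi>0 * B" and Q0: "B * \<Psi> = \<Psi>0 * D'"
    and PQ0: "\<Phi>0 * \<Psi>0 = 1\<^sub>m (length q) + D' * T" and QP0: "\<Psi>0 * \<Phi>0 = 1\<^sub>m (length g0) + B * S"
    using dual_exact_homotopy[OF AB ID im] by blast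
  have gA: "graded_mat A g1 h" and gB: "graded_mat B g0 g1" using AB unfolding dual_exact_def by blast+
  note car = graded_matD(1)[OF g(1)] graded_matD(1)[OF g(2)] graded_matD(1)[OF g(3)]
    graded_matD(1)[OF g(4)] graded_matD(1)[OF g(5)] graded_matD(1)[OF g(6)]
    graded_matD(1)[OF D] graded_matD(1)[OF I] graded_matD(1)[OF J] graded_matD(1)[OF D']
    graded_matD(1)[OF gA] graded_matD(1)[OF gB]
  note Phi = car(1) and Psi = car(2) and S = car(3) and T = car(4) and Phi0 = car(5) and Psi0 = car(6)
    and Dc = car(7) and Ic = car(8) and Jc = car(9) and D'c = car(10) and Ac = car(11) and Bc = car(12)
  have J_inj: "a = b" if "a \<in> carrier_vec (length q)" "b \<in> carrier_vec (length q)" "J *\<^sub>v a = J *\<^sub>v b" for a b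
    using basis_injective[OF _ that] bJ unfolding bij_betw_def by blast
  have I_inj: "a = b" if "a \<in> carrier_vec (length h)" "b \<in> carrier_vec (length h)" "I *\<^sub>v a = I *\<^sub>v b" for a b
    using basis_injective[OF _ that] bI unfolding bij_betw_def by blast
  have D_eq: "D *\<^sub>v v = J *\<^sub>v (D' *\<^sub>v v)" if "v \<in> carrier_vec (length r)" for v
    unfolding DJ using that Jc D'c by simp
  define E where "E = J * \<Phi>0"
  have gE: "graded_mat E r' g0" unfolding E_def by (rule graded_mat_mult[OF J g(5)])
  have E_eq: "E *\<^sub>v x = J *\<^sub>v (\<Phi>0 *\<^sub>v x)" if "x \<in> carrier_vec (length g0)" for x
    unfolding E_def using that Jc Phi0 by simp
  \<comment> \<open>\<open>E * B = J * \<Phi>0 * B = J * D' * \<Phi> = D * \<Phi>\<close>, so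
    boundaries go to coboundaries.\<close>
  have E_B: "E *\<^sub>v (B *\<^sub>v w) = D *\<^sub>v (\<Phi> *\<^sub>v w)" if w: "w \<in> carrier_vec (length g1)" for w
  proof -
    have "\<Phi>0 *\<^sub>v (B *\<^sub>v w) = D' *\<^sub>v (\<Phi> *\<^sub>v w)"
      using assoc_mult_mat_vec[OF Phi0 Bc w] assoc_mult_mat_vec[OF D'c Phi w] P0 by simp
    then show ?thesis using E_eq[of "B *\<^sub>v w"] D_eq[of "\<Phi> *\<^sub>v w"] w Bc Phi by simp
  qed
  show ?thesis
  proof (rule that[OF gE])
    fix x :: "'k vec" assume x: "x \<in> carrier_vec (length g0)"
    obtain z where z: "\<forall>g\<in>set q. g \<le> z" using grade_upper_bound by blast
    have "\<Phi>0 *\<^sub>v x \<in> free_at q z" unfolding free_at_UNIV[OF z] using Phi0 x by simp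
    then show "E *\<^sub>v x \<in> mat_range D" unfolding E_eq[OF x] using bJ unfolding bij_betw_def by blast
  next
    fix z y assume "y \<in> mat_range D" "y \<in> free_at r' z"
    then have "y \<in> (\<lambda>v. J *\<^sub>v v) ` free_at q z" using bJ[of z] unfolding bij_betw_def by blast
    then obtain a where a: "a \<in> free_at q z" "y = J *\<^sub>v a" by blast
    note ac = free_atD(1)[OF a(1)]
    \<comment> \<open>The preimage is \<open>\<Psi>0\<close> applied to the coordinates
      \<open>a\<close> of \<open>y\<close>; the homotopy \<open>T\<close> accounts for the error,
      which is a coboundary.\<close>
    have "\<Phi>0 *\<^sub>v (\<Psi>0 *\<^sub>v a) = (1\<^sub>m (length q) + D' * T) *\<^sub>v a"
      using assoc_mult_mat_vec[OF Phi0 Psi0 ac] PQ0 by simp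
    also have "\<dots> = a + D' *\<^sub>v (T *\<^sub>v a)"
      using add_mult_distrib_mat_vec[OF one_carrier_mat mult_carrier_mat[OF D'c T] ac]
        assoc_mult_mat_vec[OF D'c T ac] ac by simp
    finally have eq: "\<Phi>0 *\<^sub>v (\<Psi>0 *\<^sub>v a) = a + D' *\<^sub>v (T *\<^sub>v a)" .
    have "E *\<^sub>v (\<Psi>0 *\<^sub>v a) = J *\<^sub>v (a + D' *\<^sub>v (T *\<^sub>v a))"
      using E_eq[of "\<Psi>0 *\<^sub>v a"] Psi0 ac eq by simp
    also have "\<dots> = y + D *\<^sub>v (T *\<^sub>v a)"
      using mult_add_distrib_mat_vec[OF Jc ac, of "D' *\<^sub>v (T *\<^sub>v a)"] D_eq[of "T *\<^sub>v a"] D'c T ac a(2) by simp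
    finally show "\<exists>x\<in>free_at g0 z. \<exists>u\<in>free_at r z. E *\<^sub>v x = y + D *\<^sub>v u"
      using graded_mat_mult_vec[OF g(6) a(1)] graded_mat_mult_vec[OF g(4) a(1)] by blast
  next
    fix z x u assume x: "x \<in> free_at g0 z" and u: "u \<in> free_at r z" and eq: "E *\<^sub>v x = D *\<^sub>v u"
    note xc = free_atD(1)[OF x] and uc = free_atD(1)[OF u]
    have "\<Phi>0 *\<^sub>v x = D' *\<^sub>v u"
      using J_inj[of "\<Phi>0 *\<^sub>v x" "D' *\<^sub>v u"] eq E_eq[OF xc] D_eq[OF uc] Phi0 D'c xc uc by simp
    \<comment> \<open>Applying \<open>\<Psi>0\<close> gives \<open>B\<close> applied to the image of
      \<open>u\<close> under \<Psi>, and also \<open>x\<close> plus \<open>B\<close> applied to the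
      image of \<open>x\<close> under \<open>S\<close>; the difference exhibits \<open>x\<close> as
      a boundary.\<close>
    then have "\<Psi>0 *\<^sub>v (\<Phi>0 *\<^sub>v x) = B *\<^sub>v (\<Psi> *\<^sub>v u)"
      using assoc_mult_mat_vec[OF Bc Psi uc] assoc_mult_mat_vec[OF Psi0 D'c uc] Q0 by simp
    moreover have "\<Psi>0 *\<^sub>v (\<Phi>0 *\<^sub>v x) = x + B *\<^sub>v (S *\<^sub>v x)"
      using assoc_mult_mat_vec[OF Psi0 Phi0 xc] QP0 xc
        add_mult_distrib_mat_vec[OF one_carrier_mat mult_carrier_mat[OF Bc S] xc]
        assoc_mult_mat_vec[OF Bc S xc] by simp
    ultimately have "x + B *\<^sub>v (S *\<^sub>v x) = B *\<^sub>v (\<Psi> *\<^sub>v u)" by simp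
    moreover have "x = x + B *\<^sub>v (S *\<^sub>v x) - B *\<^sub>v (S *\<^sub>v x)"
      using xc Bc by (intro eq_vecI) auto
    ultimately have "x = B *\<^sub>v (\<Psi> *\<^sub>v u) - B *\<^sub>v (S *\<^sub>v x)" by simp
    also have "\<dots> = B *\<^sub>v (\<Psi> *\<^sub>v u - S *\<^sub>v x)"
      using mult_minus_distrib_mat_vec[OF Bc, of "\<Psi> *\<^sub>v u" "S *\<^sub>v x"] Psi S uc xc by simp
    finally show "\<exists>w\<in>free_at g1 z. x = B *\<^sub>v w"
      using free_at_minus[OF graded_mat_mult_vec[OF g(2) u] graded_mat_mult_vec[OF g(3) x]] by blast
  next
    fix z and w :: "'k vec" assume w: "w \<in> free_at g1 z"
    show "\<exists>u\<in>free_at r z. E *\<^sub>v (B *\<^sub>v w) = D *\<^sub>v u"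
      using E_B[OF free_atD(1)[OF w]] graded_mat_mult_vec[OF g(1) w] by blast
  next
    fix z w assume w: "w \<in> free_at g1 z" and Bw: "B *\<^sub>v w = 0\<^sub>v (length g0)"
    note wc = free_atD(1)[OF w]
    have "E *\<^sub>v 0\<^sub>v (length g0) = 0\<^sub>v (length r')" using graded_matD(1)[OF gE] by auto
    then have "D *\<^sub>v (\<Phi> *\<^sub>v w) = 0\<^sub>v (length r')" using E_B[OF wc] Bw by simp
    \<comment> \<open>A kernel vector of \<open>B\<close> is sent by \<Phi> to a cocycle, hence to a
      combination of the columns of \<open>I\<close>. Going back by \<Psi> reproduces
      \<open>w\<close>, as the homotopy term contains \<open>B\<close>, and turns \<open>I\<close>
      into \<open>A\<close>.\<close>
    then have "\<Phi> *\<^sub>v w \<in> {v \<in> free_at r z. D *\<^sub>v v = 0\<^sub>v (length r')}"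
      using graded_mat_mult_vec[OF g(1) w] by blast
    then have "\<Phi> *\<^sub>v w \<in> (\<lambda>v. I *\<^sub>v v) ` free_at h z" using bI[of z] unfolding bij_betw_def by blast
    then obtain v where v: "v \<in> free_at h z" "\<Phi> *\<^sub>v w = I *\<^sub>v v" by blast
    note vc = free_atD(1)[OF v(1)]
    have "\<Psi> *\<^sub>v (\<Phi> *\<^sub>v w) = w + S *\<^sub>v (B *\<^sub>v w)"
      using assoc_mult_mat_vec[OF Psi Phi wc] QP wc
        add_mult_distrib_mat_vec[OF one_carrier_mat mult_carrier_mat[OF S Bc] wc]
        assoc_mult_mat_vec[OF S Bc wc] by simp
    also have "S *\<^sub>v (B *\<^sub>v w) = 0\<^sub>v (length g1)" unfolding Bw using S by auto
    finally have "w = \<Psi> *\<^sub>v (I *\<^sub>v v)" using v(2) wc by simp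
    also have "\<dots> = A *\<^sub>v v" using assoc_mult_mat_vec[OF Psi Ic vc] AI by simp
    finally show "\<exists>v\<in>free_at h z. w = A *\<^sub>v v" using v(1) by blast
  next
    fix z v assume v: "v \<in> free_at h z" and Av: "A *\<^sub>v v = 0\<^sub>v (length g1)"
    note vc = free_atD(1)[OF v]
    \<comment> \<open>\<open>I\<close> factors through \<open>A\<close> and is injective, hence so
      is \<open>A\<close>.\<close>
    have "I *\<^sub>v v = \<Phi> *\<^sub>v (A *\<^sub>v v)" using assoc_mult_mat_vec[OF Phi Ac vc] IA by simp
    also have "\<dots> = I *\<^sub>v 0\<^sub>v (length h)" unfolding Av using Phi Ic by auto
    finally show "v = 0\<^sub>v (length h)" using I_inj vc by simp
  qed
qed

section \<open>Graded transposes\<close>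

definition dual_grades :: "grade list \<Rightarrow> grade list" where
  "dual_grades gs = rev (map uminus gs)"

text \<open>The graded transpose reverses the order of rows and columns besides transposing. This
  permutation translates between it and \<open>transpose_mat\<close>, with which the duality
  arguments work.\<close>

definition reverse_vec :: "'k vec \<Rightarrow> 'k vec" where
  "reverse_vec u = vec (dim_vec u) (\<lambda>i. u $ (dim_vec u - Suc i))"

lemma length_dual_grades[simp]: "length (dual_grades gs) = length gs"
  unfolding dual_grades_def by simp

lemma dual_grades_nth: "i < length gs \<Longrightarrow> dual_grades gs ! i = - (gs ! (length gs - Suc i))"
  unfolding dual_grades_def by (simp add: rev_nth)

lemma dual_grades_dual_grades[simp]: "dual_grades (dual_grades gs) = gs"
  by (rule nth_equalityI) (auto simp: dual_grades_nth)

lemma dim_reverse_vec[simp]: "dim_vec (reverse_vec u) = dim_vec u"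
  unfolding reverse_vec_def by simp

lemma reverse_vec_carrier[simp]: "reverse_vec u \<in> carrier_vec n \<longleftrightarrow> u \<in> carrier_vec n"
  unfolding carrier_vec_def mem_Collect_eq dim_reverse_vec ..

lemma reverse_vec_reverse_vec[simp]: "reverse_vec (reverse_vec u) = u"
  by (rule eq_vecI) (simp_all add: reverse_vec_def)

lemma reverse_vec_zero[simp]: "reverse_vec (0\<^sub>v n) = 0\<^sub>v n"
  by (rule eq_vecI) (simp_all add: reverse_vec_def)

lemma neg_grade_le: "- a \<le> - b \<longleftrightarrow> b \<le> (a::grade)"
  by (auto simp: less_eq_prod_def)

lemma reverse_vec_free_at:
  "reverse_vec u \<in> free_at (dual_grades gs) (- w) \<longleftrightarrow> u \<in> cofree_at gs w"
proof
  assume u: "u \<in> cofree_at gs w"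
  note uc = cofree_atD(1)[OF u]
  show "reverse_vec u \<in> free_at (dual_grades gs) (- w)"
  proof (rule free_atI)
    fix i assume i: "i < length (dual_grades gs)" "reverse_vec u $ i \<noteq> 0"
    then have "u $ (length gs - Suc i) \<noteq> 0" using uc unfolding reverse_vec_def by simp
    then have "w \<le> gs ! (length gs - Suc i)" using i(1) by (intro cofree_atD(2)[OF u]) auto
    then show "dual_grades gs ! i \<le> - w" using i(1) by (simp add: dual_grades_nth neg_grade_le)
  qed (use uc in simp)
next
  assume u: "reverse_vec u \<in> free_at (dual_grades gs) (- w)"
  then have uc: "u \<in> carrier_vec (length gs)" using free_atD(1)[OF u] by simp
  show "u \<in> cofree_at gs w"
  proof (rule cofree_atI[OF uc])
    fix i assume i: "i < length gs" "u $ i \<noteq> 0"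
    let ?i = "length gs - Suc i"
    have idx: "length gs - Suc ?i = i" using i(1) by arith
    have dim: "dim_vec u = length gs" "?i < length gs" using i(1) uc by auto
    have "reverse_vec u $ ?i = u $ (length gs - Suc ?i)"
      unfolding reverse_vec_def dim(1) index_vec[OF dim(2)] ..
    then have "reverse_vec u $ ?i \<noteq> 0" using i(2) unfolding idx by simp
    then have "dual_grades gs ! ?i \<le> - w" using i(1) by (intro free_atD(2)[OF u]) auto
    then have "- (gs ! (length gs - Suc ?i)) \<le> - w" using i(1) by (simp add: dual_grades_nth)
    then show "w \<le> gs ! i" unfolding idx neg_grade_le .
  qed
qed

lemma reverse_vec_bij: "bij_betw reverse_vec (cofree_at gs w) (free_at (dual_grades gs) (- w))"
  by (rule bij_betw_byWitness[where f' = reverse_vec])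
    (auto simp: reverse_vec_free_at simp flip: reverse_vec_free_at[of "reverse_vec _"])

lemma gtranspose_simps:
  "rgr (gtranspose A) = dual_grades (cgr A)" "cgr (gtranspose A) = dual_grades (rgr A)"
  unfolding gtranspose_def dual_grades_def by (auto simp: Let_def)

lemma ent_gtranspose:
  "ent (gtranspose A) = mat (length (cgr A)) (length (rgr A))
    (\<lambda>(i, j). ent A $$ (length (rgr A) - Suc j, length (cgr A) - Suc i))"
  unfolding gtranspose_def by (simp add: Let_def)

lemma gtranspose_gtranspose:
  assumes "graded_matrix A"
  shows "gtranspose (gtranspose A) = A"
proof -
  have "ent (gtranspose (gtranspose A)) = ent A"
    using assms unfolding graded_matrix_def by (intro eq_matI) (auto simp: ent_gtranspose gtranspose_simps)
  then show ?thesis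
    using gtranspose_simps[of "gtranspose A"] by (simp add: gtranspose_simps)
qed

lemma graded_mat_gtranspose:
  assumes "morphism_matrix A"
  shows "graded_mat (ent (gtranspose A)) (dual_grades (cgr A)) (dual_grades (rgr A))"
  unfolding graded_mat_def
proof (intro conjI allI impI)
  show "ent (gtranspose A) \<in> carrier_mat (length (dual_grades (cgr A))) (length (dual_grades (rgr A)))"
    unfolding ent_gtranspose by simp
  fix i j assume ij: "i < length (dual_grades (cgr A))" "j < length (dual_grades (rgr A))"
    "ent (gtranspose A) $$ (i, j) \<noteq> 0"
  then have "ent A $$ (length (rgr A) - Suc j, length (cgr A) - Suc i) \<noteq> 0"
    by (simp add: ent_gtranspose)
  then have "rgr A ! (length (rgr A) - Suc j) \<le> cgr A ! (length (cgr A) - Suc i)"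
    using ij by (intro graded_matD(2)[OF assms[unfolded morphism_matrix_graded_mat]]) auto
  then show "dual_grades (cgr A) ! i \<le> dual_grades (rgr A) ! j"
    using ij by (simp add: dual_grades_nth neg_grade_le)
qed

text \<open>Reversing the summation index absorbs the reversal of the rows of \<open>A\<close>; the
  reversal of its columns becomes the one of the result.\<close>

lemma gtranspose_mult_reverse_vec:
  fixes A :: "'k::field gmatrix"
  assumes A: "graded_matrix A" and u: "u \<in> carrier_vec (length (rgr A))"
  shows "ent (gtranspose A) *\<^sub>v reverse_vec u = reverse_vec (transpose_mat (ent A) *\<^sub>v u)"
proof (rule eq_vecI)
  let ?m = "length (rgr A)" and ?l = "length (cgr A)"
  have Ac: "ent A \<in> carrier_mat ?m ?l" using A unfolding graded_matrix_def .
  show "dim_vec (ent (gtranspose A) *\<^sub>v reverse_vec u) = dim_vec (reverse_vec (transpose_mat (ent A) *\<^sub>v u))"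
    using Ac by (simp add: ent_gtranspose)
  fix i assume "i < dim_vec (reverse_vec (transpose_mat (ent A) *\<^sub>v u))"
  then have i: "i < ?l" using Ac by simp
  have "(ent (gtranspose A) *\<^sub>v reverse_vec u) $ i =
    (\<Sum>j<?m. ent A $$ (?m - Suc j, ?l - Suc i) * u $ (?m - Suc j))"
    using i u by (auto simp: ent_gtranspose scalar_prod_def atLeast0LessThan reverse_vec_def intro!: sum.cong)
  also have "\<dots> = (\<Sum>j<?m. ent A $$ (j, ?l - Suc i) * u $ j)"
    by (rule sum.nat_diff_reindex)
  also have "\<dots> = (transpose_mat (ent A) *\<^sub>v u) $ (?l - Suc i)"
    using i u Ac by (auto simp: scalar_prod_def atLeast0LessThan intro!: sum.cong)
  also have "\<dots> = reverse_vec (transpose_mat (ent A) *\<^sub>v u) $ i"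
    using i Ac by (simp add: reverse_vec_def)
  finally show "(ent (gtranspose A) *\<^sub>v reverse_vec u) $ i = reverse_vec (transpose_mat (ent A) *\<^sub>v u) $ i" .
qed

lemma image_at_gtranspose:
  fixes A :: "'k::field gmatrix"
  assumes A: "graded_matrix A"
  shows "image_at (gtranspose A) (- w) =
    reverse_vec ` (\<lambda>u. transpose_mat (ent A) *\<^sub>v u) ` cofree_at (rgr A) w"
proof -
  have "free_at (cgr (gtranspose A)) (- w) = reverse_vec ` (cofree_at (rgr A) w :: 'k vec set)"
    unfolding gtranspose_simps by (rule bij_betw_imp_surj_on[OF reverse_vec_bij, symmetric])
  then show ?thesis
    unfolding image_at_def image_image
    by (auto simp: image_image intro!: image_cong gtranspose_mult_reverse_vec[OF A] cofree_atD(1))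
qed

lemma kernel_at_gtranspose:
  fixes A :: "'k::field gmatrix"
  assumes A: "graded_matrix A"
  shows "bij_betw reverse_vec (kernel_at (gtranspose A) (- w))
    {v \<in> cofree_at (rgr A) w. transpose_mat (ent A) *\<^sub>v v = 0\<^sub>v (length (cgr A))}"
proof (rule bij_betw_byWitness[where f' = reverse_vec])
  have eq: "ent (gtranspose A) *\<^sub>v reverse_vec v = 0\<^sub>v (length (cgr A)) \<longleftrightarrow>
      transpose_mat (ent A) *\<^sub>v v = 0\<^sub>v (length (cgr A))"
    if "v \<in> cofree_at (rgr A) w" for v
    unfolding gtranspose_mult_reverse_vec[OF A cofree_atD(1)[OF that]]
    by (metis reverse_vec_reverse_vec reverse_vec_zero)
  have cofree: "reverse_vec v \<in> cofree_at (rgr A) w \<longleftrightarrow> v \<in> free_at (dual_grades (rgr A)) (- w)" for v :: "'k vec"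
    using reverse_vec_free_at[of "reverse_vec v" "rgr A" w] by simp
  show "reverse_vec ` kernel_at (gtranspose A) (- w) \<subseteq>
      {v \<in> cofree_at (rgr A) w. transpose_mat (ent A) *\<^sub>v v = 0\<^sub>v (length (cgr A))}"
  proof
    fix x assume "x \<in> reverse_vec ` kernel_at (gtranspose A) (- w)"
    then obtain v where v: "x = reverse_vec v" "v \<in> free_at (dual_grades (rgr A)) (- w)"
      "ent (gtranspose A) *\<^sub>v v = 0\<^sub>v (length (cgr A))"
      unfolding kernel_at_def gtranspose_simps by auto
    then have "x \<in> cofree_at (rgr A) w" "v = reverse_vec x" using cofree by auto
    then show "x \<in> {v \<in> cofree_at (rgr A) w. transpose_mat (ent A) *\<^sub>v v = 0\<^sub>v (length (cgr A))}"
      using eq v(3) by auto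
  qed
  show "reverse_vec ` {v \<in> cofree_at (rgr A) w. transpose_mat (ent A) *\<^sub>v v = 0\<^sub>v (length (cgr A))} \<subseteq>
      kernel_at (gtranspose A) (- w)"
    unfolding kernel_at_def gtranspose_simps using eq by (auto simp: reverse_vec_free_at)
qed auto

lemma generated_by_all: "generated_by A {..<length (cgr A)} = image_at A"
  unfolding generated_by_def image_at_def by (auto simp: fun_eq_iff)

text \<open>Undoing the graded transposes turns the statement that \<open>P'\<close> is a basis of
  the kernel of \<open>I'\<close> into dual exactness. The common column grades and the equality of
  the images of the transposes are the only links between \<open>A\<close> and \<open>I\<close>;
  they are what the comparison of resolutions starts from.\<close>

lemma mgs_with_ker_transposed:
  fixes I :: "'k::field gmatrix"
  assumes spec: "mgs_with_ker_spec mgs" and I: "morphism_matrix I"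
    and res: "mgs (gtranspose I) = (I', P')"
  defines "A \<equiv> gtranspose I'" and "B \<equiv> gtranspose P'"
  shows "cgr A = cgr I" "rgr A = cgr B" "morphism_matrix A" "morphism_matrix B"
    "dual_exact (ent A) (ent B) (cgr A) (rgr A) (rgr B)"
    "\<And>w. (\<lambda>u. transpose_mat (ent A) *\<^sub>v u) ` cofree_at (rgr A) w =
      (\<lambda>u. transpose_mat (ent I) *\<^sub>v u) ` cofree_at (rgr I) w"
proof -
  have gI: "morphism_matrix (gtranspose I)"
    unfolding morphism_matrix_graded_mat gtranspose_simps by (rule graded_mat_gtranspose[OF I])
  have s: "rgr I' = dual_grades (cgr I)" "minimal_generating_system I' (image_at (gtranspose I))"
    "rgr P' = cgr I'" "basis_matrix P' (kernel_at I')"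
    using spec[unfolded mgs_with_ker_spec_def, rule_format, OF gI res] unfolding gtranspose_simps by blast+
  have mI': "morphism_matrix I'" and mP': "morphism_matrix P'"
    and im: "image_at I' = image_at (gtranspose I)"
    and bas: "\<And>z. bij_betw (\<lambda>v. ent P' *\<^sub>v v) (free_at (cgr P') z) (kernel_at I' z)"
    using s(2,4) unfolding minimal_generating_system_def generated_by_all basis_matrix_def by blast+
  have mor: "morphism_matrix A" "morphism_matrix B"
    unfolding A_def B_def morphism_matrix_graded_mat gtranspose_simps
    using graded_mat_gtranspose mI' mP' by blast+
  have gm: "graded_matrix A" "graded_matrix B" "graded_matrix I" "graded_matrix I'" "graded_matrix P'"
    using mor I mI' mP' unfolding morphism_matrix_def by auto
  have tr: "gtranspose A = I'" "gtranspose B = P'"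
    unfolding A_def B_def using gtranspose_gtranspose gm(4,5) by auto
  show g: "cgr A = cgr I" "rgr A = cgr B"
    unfolding A_def B_def gtranspose_simps using s(1,3) by simp_all
  show "morphism_matrix A" "morphism_matrix B" by (rule mor)+
  show "(\<lambda>u. transpose_mat (ent A) *\<^sub>v u) ` cofree_at (rgr A) w =
      (\<lambda>u. transpose_mat (ent I) *\<^sub>v u) ` cofree_at (rgr I) w" (is "?L = ?R") for w
  proof -
    have "reverse_vec ` ?L = reverse_vec ` ?R"
      using image_at_gtranspose[OF gm(1), of w] image_at_gtranspose[OF gm(3), of w] im tr(1) by simp
    then have "reverse_vec ` reverse_vec ` ?L = reverse_vec ` reverse_vec ` ?R" by simp
    then show ?thesis by (simp add: image_image)
  qed
  have "bij_betw (\<lambda>u. transpose_mat (ent B) *\<^sub>v u) (cofree_at (rgr B) w)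
      {v \<in> cofree_at (rgr A) w. transpose_mat (ent A) *\<^sub>v v = 0\<^sub>v (length (cgr A))}" for w
  proof -
    have 1: "bij_betw reverse_vec (cofree_at (rgr B) w) (free_at (cgr P') (- w) :: 'k vec set)"
      using reverse_vec_bij[of "rgr B" w] unfolding tr(2)[symmetric] gtranspose_simps .
    have 3: "bij_betw reverse_vec (kernel_at I' (- w))
        {v \<in> cofree_at (rgr A) w. transpose_mat (ent A) *\<^sub>v v = 0\<^sub>v (length (cgr A))}"
      using kernel_at_gtranspose[OF gm(1), of w] unfolding tr(1) .
    \<comment> \<open>The plain transpose of \<open>B\<close> is multiplication by \<open>P'\<close>
      with a reversal on either side.\<close>
    have bij: "bij_betw (reverse_vec \<circ> ((\<lambda>v. ent P' *\<^sub>v v) \<circ> reverse_vec)) (cofree_at (rgr B) w)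
        {v \<in> cofree_at (rgr A) w. transpose_mat (ent A) *\<^sub>v v = 0\<^sub>v (length (cgr A))}"
      by (rule bij_betw_trans[OF bij_betw_trans[OF 1 bas] 3])
    have "(reverse_vec \<circ> ((\<lambda>v. ent P' *\<^sub>v v) \<circ> reverse_vec)) u = transpose_mat (ent B) *\<^sub>v u"
      if "u \<in> cofree_at (rgr B) w" for u
      using gtranspose_mult_reverse_vec[OF gm(2) cofree_atD(1)[OF that]] unfolding tr(2) by simp
    then show ?thesis using bij bij_betw_cong[of "cofree_at (rgr B) w"] by (metis (no_types, lifting))
  qed
  then show "dual_exact (ent A) (ent B) (cgr A) (rgr A) (rgr B)"
    unfolding dual_exact_def using mor g(2) unfolding morphism_matrix_graded_mat by simp
qed

section \<open>Clearing\<close>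

lemma piv_nonzero:
  fixes b :: "'k::zero vec"
  assumes "b \<noteq> 0\<^sub>v (dim_vec b)"
  shows "piv b < dim_vec b" "b $ piv b \<noteq> 0" "\<And>i. i < dim_vec b \<Longrightarrow> piv b < i \<Longrightarrow> b $ i = 0"
proof -
  let ?S = "{i. i < dim_vec b \<and> b $ i \<noteq> 0}"
  have ne: "?S \<noteq> {}"
  proof
    assume "?S = {}"
    then have "b = 0\<^sub>v (dim_vec b)" by (intro eq_vecI) auto
    then show False using assms by blast
  qed
  have "finite ?S" by simp
  then have "piv b \<in> ?S" and max: "\<And>i. i \<in> ?S \<Longrightarrow> i \<le> piv b"
    unfolding piv_def using Max_in[of ?S] ne by auto
  then show "piv b < dim_vec b" "b $ piv b \<noteq> 0" by auto
  show "b $ i = 0" if "i < dim_vec b" "piv b < i" for i using max[of i] that by force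
qed

text \<open>A column whose index is the pivot of a kernel vector is a combination of earlier columns.\<close>

lemma clear_preimage:
  fixes D :: "'k::field mat"
  assumes D: "D \<in> carrier_mat m n"
    and Z: "\<And>b. b \<in> Z \<Longrightarrow> b \<in> carrier_vec n \<and> b \<noteq> 0\<^sub>v n \<and> D *\<^sub>v b = 0\<^sub>v m"
    and a: "a \<in> carrier_vec n" "\<And>i. i < n \<Longrightarrow> k \<le> i \<Longrightarrow> a $ i = 0"
  shows "\<exists>a'\<in>carrier_vec n. D *\<^sub>v a' = D *\<^sub>v a \<and> (\<forall>j<n. j \<in> piv ` Z \<longrightarrow> a' $ j = 0)"
  using a
\<comment> \<open>\<open>k\<close> bounds the support of the coefficient vector from above, so each
  step decides its topmost coefficient.\<close>
proof (induction k arbitrary: a)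
  case 0
  then show ?case by (intro bexI[of _ a]) auto
next
  case (Suc k)
  note ac = \<open>a \<in> carrier_vec n\<close>
  show ?case
  proof (cases "k < n")
    case False
    have "a $ i = 0" if "i < n" "k \<le> i" for i using that False by simp
    then show ?thesis using Suc.IH[OF ac] by blast
  next
    case kn: True
    show ?thesis
    proof (cases "k \<in> piv ` Z")
      case True
      then obtain b where b: "b \<in> Z" "k = piv b" by blast
      have bc: "b \<in> carrier_vec n" "D *\<^sub>v b = 0\<^sub>v m" using Z[OF b(1)] by blast+
      have bn: "b \<noteq> 0\<^sub>v (dim_vec b)" using Z[OF b(1)] unfolding carrier_vecD[OF bc(1)] by blast
      note P = piv_nonzero[OF bn]
      \<comment> \<open>The kernel vector with pivot \<open>k\<close> removes the topmost
        coefficient. It changes only lower ones besides, and leaves the product with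
        \<open>D\<close> as it is.\<close>
      let ?a = "a - (a $ k / b $ k) \<cdot>\<^sub>v b"
      have "?a $ i = 0" if i: "i < n" "k \<le> i" for i
      proof (cases "i = k")
        case True
        then show ?thesis using P(2) b(2) bc(1) ac i by simp
      next
        case False
        then show ?thesis using P(3)[of i] b(2) bc(1) ac i Suc.prems(2)[of i] by simp
      qed
      moreover have "?a \<in> carrier_vec n" using ac bc(1) by simp
      ultimately obtain a' where a': "a' \<in> carrier_vec n" "D *\<^sub>v a' = D *\<^sub>v ?a"
        "\<forall>j<n. j \<in> piv ` Z \<longrightarrow> a' $ j = 0"
        using Suc.IH[of ?a] by blast
      have "D *\<^sub>v ?a = D *\<^sub>v a - (a $ k / b $ k) \<cdot>\<^sub>v (D *\<^sub>v b)"
        using mult_minus_distrib_mat_vec[OF D ac, of "(a $ k / b $ k) \<cdot>\<^sub>v b"] mult_mat_vec[OF D bc(1)] bc(1) by simp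
      also have "\<dots> = D *\<^sub>v a" unfolding bc(2) using D ac by (intro eq_vecI) auto
      finally show ?thesis using a' by metis
    next
      case False
      \<comment> \<open>Column \<open>k\<close> is not cleared, so its coefficient may stay: it is
        split off, and added back after the lower part has been treated.\<close>
      let ?e = "a $ k \<cdot>\<^sub>v unit_vec n k"
      have ec: "?e \<in> carrier_vec n" by simp
      have "(a - ?e) $ i = 0" if i: "i < n" "k \<le> i" for i
        using Suc.prems(2)[of i] i ac kn by (cases "i = k") auto
      moreover have "a - ?e \<in> carrier_vec n" using ac ec by simp
      ultimately obtain a' where a': "a' \<in> carrier_vec n" "D *\<^sub>v a' = D *\<^sub>v (a - ?e)"
        "\<forall>j<n. j \<in> piv ` Z \<longrightarrow> a' $ j = 0"
        using Suc.IH[of "a - ?e"] by blast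
      have "D *\<^sub>v (a' + ?e) = D *\<^sub>v (a - ?e) + D *\<^sub>v ?e"
        using mult_add_distrib_mat_vec[OF D a'(1) ec] a'(2) by simp
      also have "\<dots> = D *\<^sub>v (a - ?e + ?e)"
        using mult_add_distrib_mat_vec[OF D _ ec, of "a - ?e"] ac by simp
      also have "a - ?e + ?e = a" using ac by (intro eq_vecI) auto
      finally have "D *\<^sub>v (a' + ?e) = D *\<^sub>v a" .
      moreover have "(a' + ?e) $ j = 0" if "j < n" "j \<in> piv ` Z" for j
        using a'(1,3) that False kn by (auto split: if_splits)
      ultimately show ?thesis using a'(1) ec by (intro bexI[of _ "a' + ?e"]) auto
    qed
  qed
qed

text \<open>Multiplication by the cleared matrix amounts to setting the coefficients of the cleared
  columns to zero, and every element of the column space has a coefficient vector that vanishes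
  there to begin with.\<close>

lemma mat_range_clear_columns:
  fixes A :: "'k::field gmatrix"
  assumes A: "ent A \<in> carrier_mat m n"
    and Z: "\<And>b. b \<in> Z \<Longrightarrow> b \<in> carrier_vec n \<and> b \<noteq> 0\<^sub>v n \<and> ent A *\<^sub>v b = 0\<^sub>v m"
  shows "mat_range (ent (clear_columns (piv ` Z) A)) = mat_range (ent A)"
proof -
  let ?q = "piv ` Z"
  let ?C = "ent (clear_columns ?q A)"
  have C: "?C \<in> carrier_mat m n" using A unfolding clear_columns_def by simp
  have mult: "?C *\<^sub>v a = ent A *\<^sub>v vec n (\<lambda>j. if j \<in> ?q then 0 else a $ j)" if "a \<in> carrier_vec n" for a
    using that A by (intro eq_vecI) (auto simp: clear_columns_def scalar_prod_def intro!: sum.cong)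
  show ?thesis
  proof
    show "mat_range ?C \<subseteq> mat_range (ent A)"
      unfolding mat_range_def using C A mult by fastforce
    show "mat_range (ent A) \<subseteq> mat_range ?C"
    proof
      fix x assume "x \<in> mat_range (ent A)"
      then obtain a where a: "a \<in> carrier_vec n" "x = ent A *\<^sub>v a" using A unfolding mat_range_def by auto
      obtain a' where a': "a' \<in> carrier_vec n" "ent A *\<^sub>v a' = ent A *\<^sub>v a" "\<forall>j<n. j \<in> ?q \<longrightarrow> a' $ j = 0"
        using clear_preimage[OF A Z a(1), where k = n] by force
      have "vec n (\<lambda>j. if j \<in> ?q then 0 else a' $ j) = a'" using a'(1,3) by (intro eq_vecI) auto
      then have "x = ?C *\<^sub>v a'" using mult[OF a'(1)] a' a(2) by simp
      then show "x \<in> mat_range ?C" using a'(1) C unfolding mat_range_def by auto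
    qed
  qed
qed

lemma clear_columns_simps[simp]: "rgr (clear_columns q A) = rgr A" "cgr (clear_columns q A) = cgr A"
  unfolding clear_columns_def by auto

lemma graded_matrix_clear_columns: "graded_matrix A \<Longrightarrow> graded_matrix (clear_columns q A)"
  unfolding graded_matrix_def clear_columns_def by auto

text \<open>Otherwise a unit vector and zero would have the same image. The next clearing relies on
  this: for a zero column, \<open>piv\<close> would be the maximum of an empty set.\<close>

lemma basis_matrix_col_nonzero:
  fixes A :: "'k::field gmatrix"
  assumes A: "basis_matrix A S" and j: "j < length (cgr A)"
  shows "col (ent A) j \<noteq> 0\<^sub>v (length (rgr A))"
proof
  assume 0: "col (ent A) j = 0\<^sub>v (length (rgr A))"
  have Ac: "ent A \<in> carrier_mat (length (rgr A)) (length (cgr A))"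
    using A unfolding basis_matrix_def morphism_matrix_def graded_matrix_def by blast
  have "ent A *\<^sub>v 0\<^sub>v (length (cgr A)) = 0\<^sub>v (length (rgr A))" using Ac by auto
  then have "ent A *\<^sub>v unit_vec (length (cgr A)) j = ent A *\<^sub>v 0\<^sub>v (length (cgr A))"
    unfolding mult_unit_vec[OF Ac j] 0 by simp
  then have "unit_vec (length (cgr A)) j = (0\<^sub>v (length (cgr A)) :: 'k vec)"
    using basis_injective[of "ent A" "cgr A"] A unfolding basis_matrix_def bij_betw_def by simp
  then show False using j by simp
qed

section \<open>Quotients of vector spaces\<close>

text \<open>Linearly independent subsets of \<open>W\<close> have at most \<open>dim\<close>
  elements, so a maximal one exists, and a maximal one generates.\<close>

lemma (in vectorspace) subspace_fin_dim:
  assumes W: "VectorSpace.subspace K W V" and fd: "fin_dim"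
  shows "vectorspace.fin_dim K (vs W)"
proof -
  have sub: "submodule K W V" using W unfolding VectorSpace.subspace_def by blast
  have WV: "W \<subseteq> carrier V" using sub unfolding submodule_def by blast
  interpret W: vectorspace K "vs W" by (rule subspace_is_vs[OF W])
  have "\<exists>A. finite A \<and> maximal A (\<lambda>S. S \<subseteq> W \<and> lin_indpt S)"
  proof (rule maximal_exists[where N = dim])
    show "finite A \<and> card A \<le> dim" if "A \<subseteq> W \<and> lin_indpt A" for A
      using li_le_dim[OF fd, of A] that WV by blast
    show "{} \<subseteq> W \<and> lin_indpt {}" unfolding lin_dep_def by auto
  qed
  then obtain A where A: "finite A" "maximal A (\<lambda>S. S \<subseteq> W \<and> lin_indpt S)" by blast
  have "(S \<subseteq> W \<and> lin_indpt S) = (S \<subseteq> carrier (vs W) \<and> \<not> W.lin_dep S)" for S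
    using span_li_not_depend(2)[OF _ sub, of S] by auto
  then have "maximal A (\<lambda>S. S \<subseteq> carrier (vs W) \<and> \<not> W.lin_dep S)" using A(2) by simp
  moreover have "A \<subseteq> carrier (vs W)" using A(2) unfolding maximal_def by auto
  ultimately show ?thesis
    unfolding W.fin_dim_def using W.max_li_is_gen A(1) by blast
qed

section \<open>Cosets of a submodule\<close>

context submodule
begin

interpretation M: Module.module R M by (rule module)

lemma coset_mem: "w \<in> N +>\<^bsub>M\<^esub> x \<longleftrightarrow> (\<exists>n\<in>N. w = n \<oplus>\<^bsub>M\<^esub> x)"
  unfolding a_r_coset_def' by blast

lemma minus_closed: "n \<in> N \<Longrightarrow> \<ominus>\<^bsub>M\<^esub> n \<in> N"
proof -
  assume n: "n \<in> N"
  then have nM: "n \<in> carrier M" using subset by blast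
  have "(\<ominus>\<^bsub>R\<^esub> \<one>\<^bsub>R\<^esub>) \<odot>\<^bsub>M\<^esub> n \<in> N" using n by (intro smult_closed) auto
  then show "\<ominus>\<^bsub>M\<^esub> n \<in> N" using M.smult_minus_1[OF nM] by simp
qed

lemma coset_self: "x \<in> carrier M \<Longrightarrow> x \<in> N +>\<^bsub>M\<^esub> x"
  unfolding coset_mem using zero_closed by (intro bexI[of _ "\<zero>\<^bsub>M\<^esub>"]) auto

lemma coset_add_eq:
  assumes "n \<in> N" "x \<in> carrier M"
  shows "N +>\<^bsub>M\<^esub> (n \<oplus>\<^bsub>M\<^esub> x) = N +>\<^bsub>M\<^esub> x"
proof -
  have nM: "n \<in> carrier M" and NM: "\<And>a. a \<in> N \<Longrightarrow> a \<in> carrier M" using assms subset by auto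
  show ?thesis
  proof (intro equalityI subsetI)
    fix w assume "w \<in> N +>\<^bsub>M\<^esub> (n \<oplus>\<^bsub>M\<^esub> x)"
    then obtain a where a: "a \<in> N" "w = a \<oplus>\<^bsub>M\<^esub> (n \<oplus>\<^bsub>M\<^esub> x)" unfolding coset_mem by blast
    then have "w = (a \<oplus>\<^bsub>M\<^esub> n) \<oplus>\<^bsub>M\<^esub> x" using NM nM assms by (simp add: M.a_assoc)
    then show "w \<in> N +>\<^bsub>M\<^esub> x" unfolding coset_mem using a assms by blast
  next
    fix w assume "w \<in> N +>\<^bsub>M\<^esub> x"
    then obtain a where a: "a \<in> N" "w = a \<oplus>\<^bsub>M\<^esub> x" unfolding coset_mem by blast
    have "(a \<oplus>\<^bsub>M\<^esub> \<ominus>\<^bsub>M\<^esub> n) \<oplus>\<^bsub>M\<^esub> (n \<oplus>\<^bsub>M\<^esub> x) = a \<oplus>\<^bsub>M\<^esub> x"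
      using NM[OF a(1)] nM assms(2) by (simp add: M.a_assoc M.r_neg2 M.r_neg1)
    moreover have "a \<oplus>\<^bsub>M\<^esub> \<ominus>\<^bsub>M\<^esub> n \<in> N" using a(1) assms(1) minus_closed by blast
    ultimately show "w \<in> N +>\<^bsub>M\<^esub> (n \<oplus>\<^bsub>M\<^esub> x)" unfolding coset_mem using a(2) by metis
  qed
qed

lemma coset_eq_iff:
  assumes "x \<in> carrier M" "y \<in> carrier M"
  shows "N +>\<^bsub>M\<^esub> x = N +>\<^bsub>M\<^esub> y \<longleftrightarrow> (\<exists>n\<in>N. x = n \<oplus>\<^bsub>M\<^esub> y)"
  using coset_self[OF assms(1)] coset_mem coset_add_eq assms by metis

lemma coset_zero: "N +>\<^bsub>M\<^esub> \<zero>\<^bsub>M\<^esub> = N"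
proof -
  have "n \<oplus>\<^bsub>M\<^esub> \<zero>\<^bsub>M\<^esub> = n" if "n \<in> N" for n using that subset by auto
  then show ?thesis using coset_mem by (metis (no_types, lifting) subsetI subset_antisym)
qed

lemma coset_eq_self_iff: "x \<in> carrier M \<Longrightarrow> N +>\<^bsub>M\<^esub> x = N \<longleftrightarrow> x \<in> N"
  using coset_eq_iff[of x "\<zero>\<^bsub>M\<^esub>"] coset_zero subset by (metis M.r_zero M.zero_closed subsetD)

lemma coset_set_add:
  assumes "x \<in> carrier M" "y \<in> carrier M"
  shows "(N +>\<^bsub>M\<^esub> x) <+>\<^bsub>M\<^esub> (N +>\<^bsub>M\<^esub> y) = N +>\<^bsub>M\<^esub> (x \<oplus>\<^bsub>M\<^esub> y)"
proof -
  have NM: "\<And>a. a \<in> N \<Longrightarrow> a \<in> carrier M" using subset by auto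
  have swap: "(a \<oplus>\<^bsub>M\<^esub> x) \<oplus>\<^bsub>M\<^esub> (b \<oplus>\<^bsub>M\<^esub> y) = (a \<oplus>\<^bsub>M\<^esub> b) \<oplus>\<^bsub>M\<^esub> (x \<oplus>\<^bsub>M\<^esub> y)" if "a \<in> N" "b \<in> N" for a b
    using NM[OF that(1)] NM[OF that(2)] assms by (simp add: M.a_ac)
  show ?thesis
  proof (intro equalityI subsetI)
    fix w assume "w \<in> (N +>\<^bsub>M\<^esub> x) <+>\<^bsub>M\<^esub> (N +>\<^bsub>M\<^esub> y)"
    then obtain a b where "a \<in> N" "b \<in> N" "w = (a \<oplus>\<^bsub>M\<^esub> x) \<oplus>\<^bsub>M\<^esub> (b \<oplus>\<^bsub>M\<^esub> y)"
      unfolding set_add_def' a_r_coset_def' by blast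
    then show "w \<in> N +>\<^bsub>M\<^esub> (x \<oplus>\<^bsub>M\<^esub> y)" unfolding coset_mem using swap by blast
  next
    fix w assume "w \<in> N +>\<^bsub>M\<^esub> (x \<oplus>\<^bsub>M\<^esub> y)"
    then obtain a where a: "a \<in> N" "w = a \<oplus>\<^bsub>M\<^esub> (x \<oplus>\<^bsub>M\<^esub> y)" unfolding coset_mem by blast
    then have "w = (a \<oplus>\<^bsub>M\<^esub> x) \<oplus>\<^bsub>M\<^esub> y" using NM assms by (simp add: M.a_assoc)
    moreover have "a \<oplus>\<^bsub>M\<^esub> x \<in> N +>\<^bsub>M\<^esub> x" using a(1) coset_mem by blast
    ultimately show "w \<in> (N +>\<^bsub>M\<^esub> x) <+>\<^bsub>M\<^esub> (N +>\<^bsub>M\<^esub> y)"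
      unfolding set_add_def' using coset_self[OF assms(2)] by blast
  qed
qed

text \<open>The scalar multiple of a coset is defined as a union over all representatives; linearity
  makes all members of this union the same coset.\<close>

lemma coset_smult:
  assumes "a \<in> carrier R" "x \<in> carrier M"
  shows "(\<Union>w\<in>N +>\<^bsub>M\<^esub> x. N +>\<^bsub>M\<^esub> (a \<odot>\<^bsub>M\<^esub> w)) = N +>\<^bsub>M\<^esub> (a \<odot>\<^bsub>M\<^esub> x)"
proof -
  have const: "N +>\<^bsub>M\<^esub> (a \<odot>\<^bsub>M\<^esub> w) = N +>\<^bsub>M\<^esub> (a \<odot>\<^bsub>M\<^esub> x)" if w: "w \<in> N +>\<^bsub>M\<^esub> x" for w
  proof -
    obtain n where n: "n \<in> N" "w = n \<oplus>\<^bsub>M\<^esub> x" using w coset_mem by blast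
    have nM: "n \<in> carrier M" using n(1) subset by blast
    have "a \<odot>\<^bsub>M\<^esub> w = a \<odot>\<^bsub>M\<^esub> n \<oplus>\<^bsub>M\<^esub> a \<odot>\<^bsub>M\<^esub> x"
      unfolding n(2) using M.smult_r_distr[OF assms(1) nM assms(2)] .
    then show ?thesis using coset_add_eq[OF smult_closed[OF assms(1) n(1)] M.smult_closed[OF assms]] by simp
  qed
  have ne: "N +>\<^bsub>M\<^esub> x \<noteq> {}" using coset_self[OF assms(2)] by blast
  show ?thesis by (rule SUP_eq_const[OF ne const])
qed

end

section \<open>The quotient as a finite-dimensional vector space\<close>

lemma quotient_space_simps:
  "carrier (quotient_space V N) = (\<lambda>x. N +>\<^bsub>V\<^esub> x) ` carrier V"
  "\<zero>\<^bsub>quotient_space V N\<^esub> = N"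
  "X \<oplus>\<^bsub>quotient_space V N\<^esub> Y = X <+>\<^bsub>V\<^esub> Y"
  "a \<odot>\<^bsub>quotient_space V N\<^esub> X = (\<Union>x\<in>X. N +>\<^bsub>V\<^esub> (a \<odot>\<^bsub>V\<^esub> x))"
  unfolding quotient_space_def A_RCOSETS_def' by auto

lemma quotient_space_vectorspace:
  assumes V: "vectorspace K V" and N: "submodule K N V"
  shows "vectorspace K (quotient_space V N)"
proof -
  interpret V: vectorspace K V by (rule V)
  let ?Q = "quotient_space V N"
  let ?c = "\<lambda>x. N +>\<^bsub>V\<^esub> x"
  have carE: thesis if "X \<in> carrier ?Q" "\<And>x. x \<in> carrier V \<Longrightarrow> X = ?c x \<Longrightarrow> thesis" for X thesis
    using that unfolding quotient_space_simps by (elim imageE) blast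
  have mem: "?c x \<in> carrier ?Q" if "x \<in> carrier V" for x
    using that unfolding quotient_space_simps by blast
  have add: "?c x \<oplus>\<^bsub>?Q\<^esub> ?c y = ?c (x \<oplus>\<^bsub>V\<^esub> y)" if "x \<in> carrier V" "y \<in> carrier V" for x y
    unfolding quotient_space_simps by (rule submodule.coset_set_add[OF N that])
  have smult: "a \<odot>\<^bsub>?Q\<^esub> ?c x = ?c (a \<odot>\<^bsub>V\<^esub> x)" if "a \<in> carrier K" "x \<in> carrier V" for a x
    unfolding quotient_space_simps by (rule submodule.coset_smult[OF N that])
  have zero: "\<zero>\<^bsub>?Q\<^esub> = ?c \<zero>\<^bsub>V\<^esub>" unfolding quotient_space_simps submodule.coset_zero[OF N] ..
  show ?thesis
  proof (rule vs_criteria)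
    show "field K" by (rule V.field_axioms)
    show "\<zero>\<^bsub>?Q\<^esub> \<in> carrier ?Q" unfolding zero by (rule mem[OF V.zero_closed])
    show "\<forall>v w. v \<in> carrier ?Q \<and> w \<in> carrier ?Q \<longrightarrow> v \<oplus>\<^bsub>?Q\<^esub> w \<in> carrier ?Q"
    proof (intro allI impI)
      fix X Y assume "X \<in> carrier ?Q \<and> Y \<in> carrier ?Q"
      then obtain x y where xy: "x \<in> carrier V" "y \<in> carrier V" "X = ?c x" "Y = ?c y" by (elim conjE carE) blast
      show "X \<oplus>\<^bsub>?Q\<^esub> Y \<in> carrier ?Q" unfolding xy(3,4) add[OF xy(1,2)] by (rule mem[OF V.a_closed[OF xy(1,2)]])
    qed
    show "\<forall>v\<in>carrier ?Q. \<exists>neg_v\<in>carrier ?Q. v \<oplus>\<^bsub>?Q\<^esub> neg_v = \<zero>\<^bsub>?Q\<^esub>"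
    proof
      fix v assume "v \<in> carrier ?Q"
      then obtain x where x: "x \<in> carrier V" "v = ?c x" by (elim conjE carE) blast
      have neg: "\<ominus>\<^bsub>V\<^esub> x \<in> carrier V" by (rule V.a_inv_closed[OF x(1)])
      have "v \<oplus>\<^bsub>?Q\<^esub> ?c (\<ominus>\<^bsub>V\<^esub> x) = \<zero>\<^bsub>?Q\<^esub>"
        unfolding x(2) add[OF x(1) neg] zero using V.r_neg[OF x(1)] by simp
      then show "\<exists>neg_v\<in>carrier ?Q. v \<oplus>\<^bsub>?Q\<^esub> neg_v = \<zero>\<^bsub>?Q\<^esub>" using mem[OF neg] by blast
    qed
    show "\<forall>c v. c \<in> carrier K \<and> v \<in> carrier ?Q \<longrightarrow> c \<odot>\<^bsub>?Q\<^esub> v \<in> carrier ?Q"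
    proof (intro allI impI)
      fix a X assume aX: "a \<in> carrier K \<and> X \<in> carrier ?Q"
      then obtain x where x: "x \<in> carrier V" "X = ?c x" by (elim conjE carE) blast
      have a: "a \<in> carrier K" using aX by blast
      show "a \<odot>\<^bsub>?Q\<^esub> X \<in> carrier ?Q" unfolding x(2) smult[OF a x(1)] by (rule mem[OF V.smult_closed[OF a x(1)]])
    qed
    show "\<forall>v w. v \<in> carrier ?Q \<and> w \<in> carrier ?Q \<longrightarrow> v \<oplus>\<^bsub>?Q\<^esub> w = w \<oplus>\<^bsub>?Q\<^esub> v"
    proof (intro allI impI)
      fix X Y assume "X \<in> carrier ?Q \<and> Y \<in> carrier ?Q"
      then obtain x y where xy: "x \<in> carrier V" "y \<in> carrier V" "X = ?c x" "Y = ?c y" by (elim conjE carE) blast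
      show "X \<oplus>\<^bsub>?Q\<^esub> Y = Y \<oplus>\<^bsub>?Q\<^esub> X"
        unfolding xy(3,4) add[OF xy(1,2)] add[OF xy(2,1)] V.a_comm[OF xy(1,2)] ..
    qed
    show "\<forall>v w x. v \<in> carrier ?Q \<and> w \<in> carrier ?Q \<and> x \<in> carrier ?Q \<longrightarrow>
        v \<oplus>\<^bsub>?Q\<^esub> w \<oplus>\<^bsub>?Q\<^esub> x = v \<oplus>\<^bsub>?Q\<^esub> (w \<oplus>\<^bsub>?Q\<^esub> x)"
    proof (intro allI impI)
      fix X Y Z assume "X \<in> carrier ?Q \<and> Y \<in> carrier ?Q \<and> Z \<in> carrier ?Q"
      then obtain x y z where "x \<in> carrier V" "y \<in> carrier V" "z \<in> carrier V" "X = ?c x" "Y = ?c y" "Z = ?c z"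
        by (elim conjE carE) blast
      then show "X \<oplus>\<^bsub>?Q\<^esub> Y \<oplus>\<^bsub>?Q\<^esub> Z = X \<oplus>\<^bsub>?Q\<^esub> (Y \<oplus>\<^bsub>?Q\<^esub> Z)" by (simp add: add V.a_assoc)
    qed
    show "\<forall>v\<in>carrier ?Q. v \<oplus>\<^bsub>?Q\<^esub> \<zero>\<^bsub>?Q\<^esub> = v" 
    proof
      fix X assume "X \<in> carrier ?Q"
      then obtain x where x: "x \<in> carrier V" "X = ?c x" by (elim conjE carE) blast
      show "X \<oplus>\<^bsub>?Q\<^esub> \<zero>\<^bsub>?Q\<^esub> = X" unfolding x(2) zero add[OF x(1) V.zero_closed] V.r_zero[OF x(1)] ..
    qed
    show "\<forall>a b v. a \<in> carrier K \<and> b \<in> carrier K \<and> v \<in> carrier ?Q \<longrightarrow>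
        (a \<otimes>\<^bsub>K\<^esub> b) \<odot>\<^bsub>?Q\<^esub> v = a \<odot>\<^bsub>?Q\<^esub> (b \<odot>\<^bsub>?Q\<^esub> v)"
    proof (intro allI impI)
      fix a b X assume ab: "a \<in> carrier K \<and> b \<in> carrier K \<and> X \<in> carrier ?Q"
      then obtain x where "x \<in> carrier V" "X = ?c x" by (elim conjE carE) blast
      then show "(a \<otimes>\<^bsub>K\<^esub> b) \<odot>\<^bsub>?Q\<^esub> X = a \<odot>\<^bsub>?Q\<^esub> (b \<odot>\<^bsub>?Q\<^esub> X)" using ab by (simp add: smult V.smult_assoc1)
    qed
    show "\<forall>v\<in>carrier ?Q. \<one>\<^bsub>K\<^esub> \<odot>\<^bsub>?Q\<^esub> v = v" 
    proof
      fix X assume "X \<in> carrier ?Q"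
      then obtain x where x: "x \<in> carrier V" "X = ?c x" by (elim conjE carE) blast
      show "\<one>\<^bsub>K\<^esub> \<odot>\<^bsub>?Q\<^esub> X = X" unfolding x(2) smult[OF V.one_closed x(1)] V.smult_one[OF x(1)] ..
    qed
    show "\<forall>a b v. a \<in> carrier K \<and> b \<in> carrier K \<and> v \<in> carrier ?Q \<longrightarrow>
        (a \<oplus>\<^bsub>K\<^esub> b) \<odot>\<^bsub>?Q\<^esub> v = a \<odot>\<^bsub>?Q\<^esub> v \<oplus>\<^bsub>?Q\<^esub> b \<odot>\<^bsub>?Q\<^esub> v"
    proof (intro allI impI)
      fix a b X assume ab: "a \<in> carrier K \<and> b \<in> carrier K \<and> X \<in> carrier ?Q"
      then obtain x where "x \<in> carrier V" "X = ?c x" by (elim conjE carE) blast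
      then show "(a \<oplus>\<^bsub>K\<^esub> b) \<odot>\<^bsub>?Q\<^esub> X = a \<odot>\<^bsub>?Q\<^esub> X \<oplus>\<^bsub>?Q\<^esub> b \<odot>\<^bsub>?Q\<^esub> X"
        using ab by (simp add: smult add V.smult_l_distr)
    qed
    show "\<forall>a v w. a \<in> carrier K \<and> v \<in> carrier ?Q \<and> w \<in> carrier ?Q \<longrightarrow>
        a \<odot>\<^bsub>?Q\<^esub> (v \<oplus>\<^bsub>?Q\<^esub> w) = a \<odot>\<^bsub>?Q\<^esub> v \<oplus>\<^bsub>?Q\<^esub> a \<odot>\<^bsub>?Q\<^esub> w"
    proof (intro allI impI)
      fix a X Y assume aX: "a \<in> carrier K \<and> X \<in> carrier ?Q \<and> Y \<in> carrier ?Q"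
      then obtain x y where "x \<in> carrier V" "y \<in> carrier V" "X = ?c x" "Y = ?c y" by (elim conjE carE) blast
      then show "a \<odot>\<^bsub>?Q\<^esub> (X \<oplus>\<^bsub>?Q\<^esub> Y) = a \<odot>\<^bsub>?Q\<^esub> X \<oplus>\<^bsub>?Q\<^esub> a \<odot>\<^bsub>?Q\<^esub> Y"
        using aX by (simp add: smult add V.smult_r_distr)
    qed
  qed
qed

lemma quotient_map_hom:
  assumes V: "vectorspace K V" and N: "submodule K N V"
  shows "(\<lambda>x. N +>\<^bsub>V\<^esub> x) \<in> module_hom K V (quotient_space V N)"
proof -
  have "N +>\<^bsub>V\<^esub> (x \<oplus>\<^bsub>V\<^esub> y) = (N +>\<^bsub>V\<^esub> x) \<oplus>\<^bsub>quotient_space V N\<^esub> (N +>\<^bsub>V\<^esub> y)"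
    if "x \<in> carrier V" "y \<in> carrier V" for x y
    unfolding quotient_space_simps using submodule.coset_set_add[OF N that] by (rule sym)
  moreover have "N +>\<^bsub>V\<^esub> (a \<odot>\<^bsub>V\<^esub> x) = a \<odot>\<^bsub>quotient_space V N\<^esub> (N +>\<^bsub>V\<^esub> x)"
    if "a \<in> carrier K" "x \<in> carrier V" for a x
    unfolding quotient_space_simps using submodule.coset_smult[OF N that] by (rule sym)
  moreover have "(\<lambda>x. N +>\<^bsub>V\<^esub> x) \<in> carrier V \<rightarrow> carrier (quotient_space V N)"
    unfolding quotient_space_simps by blast
  ultimately show ?thesis unfolding LinearCombinations.module_hom_def by blast
qed

lemma quotient_space_fin_dim:
  assumes V: "vectorspace K V" and N: "submodule K N V" and fd: "vectorspace.fin_dim K V"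
  shows "vectorspace.fin_dim K (quotient_space V N)"
proof -
  interpret linear_map K V "quotient_space V N" "\<lambda>x. N +>\<^bsub>V\<^esub> x"
    using V quotient_space_vectorspace[OF V N] quotient_map_hom[OF V N]
    unfolding linear_map_def mod_hom_def mod_hom_axioms_def vectorspace_def by blast
  show ?thesis by (rule surj_fin_dim[OF fd]) (simp add: quotient_space_simps)
qed

lemma (in vectorspace) dim_zero_carrier:
  assumes "fin_dim" "dim = 0"
  shows "carrier V = {\<zero>\<^bsub>V\<^esub>}"
proof -
  obtain B where B: "finite B" "basis B" using finite_basis_exists[OF assms(1)] by blast
  then have "card B = 0" using dim_basis assms(2) by simp
  then have "B = {}" using B(1) by simp
  then have "span {} = carrier V" using B(2) unfolding basis_def by simp
  moreover have "span {} = {\<zero>\<^bsub>V\<^esub>}" unfolding span_def lincomb_def by auto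
  ultimately show ?thesis by simp
qed

text \<open>Cosets inside the space of cocycles are the same sets as in the ambient space, which
  allows cohomology classes to be written without restricting the carrier.\<close>

lemma a_r_coset_carrier_update[simp]: "N +>\<^bsub>V\<lparr>carrier := W\<rparr>\<^esub> x = N +>\<^bsub>V\<^esub> x"
  unfolding a_r_coset_def' by simp

section \<open>Cohomology of cochain complexes\<close>

text \<open>Over \<open>class_ring\<close> every field element is a scalar, so the membership
  conditions on scalars disappear.\<close>

lemma class_module_homD:
  assumes "f \<in> module_hom class_ring V W"
  shows "\<And>x. x \<in> carrier V \<Longrightarrow> f x \<in> carrier W"
    and "\<And>x y. x \<in> carrier V \<Longrightarrow> y \<in> carrier V \<Longrightarrow> f (x \<oplus>\<^bsub>V\<^esub> y) = f x \<oplus>\<^bsub>W\<^esub> f y"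
    and "\<And>a x. x \<in> carrier V \<Longrightarrow> f (a \<odot>\<^bsub>V\<^esub> x) = a \<odot>\<^bsub>W\<^esub> f x"
  using assms unfolding LinearCombinations.module_hom_def by auto

lemma class_module_homI:
  assumes "\<And>x. x \<in> carrier V \<Longrightarrow> f x \<in> carrier W"
    and "\<And>x y. x \<in> carrier V \<Longrightarrow> y \<in> carrier V \<Longrightarrow> f (x \<oplus>\<^bsub>V\<^esub> y) = f x \<oplus>\<^bsub>W\<^esub> f y"
    and "\<And>a x. x \<in> carrier V \<Longrightarrow> f (a \<odot>\<^bsub>V\<^esub> x) = a \<odot>\<^bsub>W\<^esub> f x"
  shows "f \<in> module_hom class_ring V W"
  using assms unfolding LinearCombinations.module_hom_def by auto

lemma vectorspace_zero_smult:
  fixes V :: "('k::field, 'v) module"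
  assumes V: "vectorspace class_ring V" and x: "x \<in> carrier V"
  shows "0 \<odot>\<^bsub>V\<^esub> x = \<zero>\<^bsub>V\<^esub>"
proof -
  interpret V: vectorspace class_ring V by (rule V)
  show ?thesis using V.smult_l_null[OF x] by simp
qed

lemma vectorspace_closed:
  fixes V :: "('k::field, 'v) module"
  assumes V: "vectorspace class_ring V"
  shows "\<zero>\<^bsub>V\<^esub> \<in> carrier V" "\<And>x y. x \<in> carrier V \<Longrightarrow> y \<in> carrier V \<Longrightarrow> x \<oplus>\<^bsub>V\<^esub> y \<in> carrier V"
    "\<And>a x. x \<in> carrier V \<Longrightarrow> a \<odot>\<^bsub>V\<^esub> x \<in> carrier V"
    "\<And>x. x \<in> carrier V \<Longrightarrow> x \<oplus>\<^bsub>V\<^esub> \<zero>\<^bsub>V\<^esub> = x" "\<And>x. x \<in> carrier V \<Longrightarrow> \<zero>\<^bsub>V\<^esub> \<oplus>\<^bsub>V\<^esub> x = x"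
    "\<And>a. a \<odot>\<^bsub>V\<^esub> \<zero>\<^bsub>V\<^esub> = \<zero>\<^bsub>V\<^esub>"
proof -
  interpret V: vectorspace class_ring V by (rule V)
  show "\<zero>\<^bsub>V\<^esub> \<in> carrier V" by (rule V.zero_closed)
  show "x \<oplus>\<^bsub>V\<^esub> y \<in> carrier V" if "x \<in> carrier V" "y \<in> carrier V" for x y by (rule V.a_closed[OF that])
  show "a \<odot>\<^bsub>V\<^esub> x \<in> carrier V" if "x \<in> carrier V" for a x by (rule V.smult_closed[OF _ that]) simp
  show "x \<oplus>\<^bsub>V\<^esub> \<zero>\<^bsub>V\<^esub> = x" if "x \<in> carrier V" for x by (rule V.r_zero[OF that])
  show "\<zero>\<^bsub>V\<^esub> \<oplus>\<^bsub>V\<^esub> x = x" if "x \<in> carrier V" for x by (rule V.l_zero[OF that])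
  show "a \<odot>\<^bsub>V\<^esub> \<zero>\<^bsub>V\<^esub> = \<zero>\<^bsub>V\<^esub>" for a by (rule V.smult_r_null) simp
qed

lemma class_module_hom_zero:
  fixes V :: "('k::field, 'v) module" and W :: "('k, 'w) module"
  assumes V: "vectorspace class_ring V" and W: "vectorspace class_ring W"
    and f: "f \<in> module_hom class_ring V W"
  shows "f \<zero>\<^bsub>V\<^esub> = \<zero>\<^bsub>W\<^esub>"
proof -
  note z = vectorspace_closed(1)[OF V]
  have "f (0 \<odot>\<^bsub>V\<^esub> \<zero>\<^bsub>V\<^esub>) = 0 \<odot>\<^bsub>W\<^esub> f \<zero>\<^bsub>V\<^esub>" by (rule class_module_homD(3)[OF f z])
  then show ?thesis
    unfolding vectorspace_zero_smult[OF V z] vectorspace_zero_smult[OF W class_module_homD(1)[OF f z]] .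
qed

lemma class_submoduleI:
  fixes V :: "('k::field, 'v) module"
  assumes "vectorspace class_ring V" "N \<subseteq> carrier V" "\<zero>\<^bsub>V\<^esub> \<in> N"
    and "\<And>x y. x \<in> N \<Longrightarrow> y \<in> N \<Longrightarrow> x \<oplus>\<^bsub>V\<^esub> y \<in> N" "\<And>a x. x \<in> N \<Longrightarrow> a \<odot>\<^bsub>V\<^esub> x \<in> N"
  shows "submodule class_ring N V"
  using assms unfolding submodule_def vectorspace_def by blast

lemma submodule_carrier_update:
  fixes V :: "('k::field, 'v) module"
  assumes V: "vectorspace class_ring V" and W: "submodule class_ring W V"
  shows "vectorspace class_ring (V\<lparr>carrier := W\<rparr>)"
    and "submodule class_ring N V \<Longrightarrow> N \<subseteq> W \<Longrightarrow> submodule class_ring N (V\<lparr>carrier := W\<rparr>)"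
    and "vectorspace.fin_dim class_ring V \<Longrightarrow> vectorspace.fin_dim class_ring (V\<lparr>carrier := W\<rparr>)"
proof -
  have sub: "VectorSpace.subspace class_ring W V" using V W unfolding VectorSpace.subspace_def by blast
  show vs: "vectorspace class_ring (V\<lparr>carrier := W\<rparr>)" by (rule vectorspace.subspace_is_vs[OF V sub])
  show "vectorspace.fin_dim class_ring (V\<lparr>carrier := W\<rparr>)" if "vectorspace.fin_dim class_ring V"
    by (rule vectorspace.subspace_fin_dim[OF V sub that])
  show "submodule class_ring N (V\<lparr>carrier := W\<rparr>)" if "submodule class_ring N V" "N \<subseteq> W"
    using that by (intro class_submoduleI[OF vs]) (simp_all add: submodule_def)
qed

section \<open>Cocycles, coboundaries and cohomology classes\<close>

lemma cochain_complexD: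
  assumes "cochain_complex C"
  shows "vectorspace class_ring (pspace (pobj C d) z)"
    and "vectorspace.fin_dim class_ring (pspace (pobj C d) z)"
    and "pdiff C d z \<in> module_hom class_ring (pspace (pobj C (d - 1)) z) (pspace (pobj C d) z)"
    and "pdiff C (d + 1) z \<in> module_hom class_ring (pspace (pobj C d) z) (pspace (pobj C (d + 1)) z)"
    and "x \<in> pcarrier (pobj C (d - 1)) z \<Longrightarrow> pdiff C (d + 1) z (pdiff C d z x) = \<zero>\<^bsub>pspace (pobj C (d + 1)) z\<^esub>"
proof -
  have p: "persistence_module (pobj C d)" and
    m: "\<And>d. pmorphism (pobj C (d - 1)) (pobj C d) (pdiff C d)"
    using assms unfolding cochain_complex_def by blast+
  show "vectorspace class_ring (pspace (pobj C d) z)"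
    "vectorspace.fin_dim class_ring (pspace (pobj C d) z)"
    using p[unfolded persistence_module_def, THEN conjunct1, THEN spec, of z] by (rule conjunct1, rule conjunct2)
  show "pdiff C d z \<in> module_hom class_ring (pspace (pobj C (d - 1)) z) (pspace (pobj C d) z)"
    using m[unfolded pmorphism_def, THEN conjunct1] by (rule spec)
  show "pdiff C (d + 1) z \<in> module_hom class_ring (pspace (pobj C d) z) (pspace (pobj C (d + 1)) z)"
    using m[unfolded pmorphism_def, THEN conjunct1, THEN spec, of "d + 1" z] by simp
  show "x \<in> pcarrier (pobj C (d - 1)) z \<Longrightarrow> pdiff C (d + 1) z (pdiff C d z x) = \<zero>\<^bsub>pspace (pobj C (d + 1)) z\<^esub>"
    using assms[unfolded cochain_complex_def, THEN conjunct2, THEN conjunct2] by (elim allE) (rule bspec)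
qed

lemma cohomology_space:
  "pspace (cohomology C d) z =
    quotient_space ((pspace (pobj C d) z)\<lparr>carrier := cocycles C d z\<rparr>) (coboundaries C d z)"
  unfolding cohomology_def by simp

lemma cohomology_carrier:
  "pcarrier (cohomology C d) z = (\<lambda>x. coboundaries C d z +>\<^bsub>pspace (pobj C d) z\<^esub> x) ` cocycles C d z"
  unfolding cohomology_space quotient_space_simps by simp

context
  fixes C :: "('k::field, 'v) pcomplex"
  assumes C: "cochain_complex C"
begin

lemma cocycles_carrier: "cocycles C d z \<subseteq> pcarrier (pobj C d) z"
  unfolding cocycles_def by blast

lemma cocycles_submodule: "submodule class_ring (cocycles C d z) (pspace (pobj C d) z)"
proof (rule class_submoduleI)
  note V = cochain_complexD(1)[OF C, of d z] and W = cochain_complexD(1)[OF C, of "d + 1" z]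
    and f = cochain_complexD(4)[OF C, of d z]
  note fD = class_module_homD[OF f]
  show "vectorspace class_ring (pspace (pobj C d) z)" by (rule V)
  show "cocycles C d z \<subseteq> pcarrier (pobj C d) z" by (rule cocycles_carrier)
  show "\<zero>\<^bsub>pspace (pobj C d) z\<^esub> \<in> cocycles C d z"
    unfolding cocycles_def using class_module_hom_zero[OF V W f] vectorspace_closed(1)[OF V] by simp
  show "x \<oplus>\<^bsub>pspace (pobj C d) z\<^esub> y \<in> cocycles C d z" if "x \<in> cocycles C d z" "y \<in> cocycles C d z" for x y
    using that unfolding cocycles_def
    by (simp add: fD(2) vectorspace_closed(2)[OF V] vectorspace_closed(5)[OF W vectorspace_closed(1)[OF W]])
  show "a \<odot>\<^bsub>pspace (pobj C d) z\<^esub> x \<in> cocycles C d z" if "x \<in> cocycles C d z" for a x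
    using that unfolding cocycles_def
    by (simp add: fD(3) vectorspace_closed(3)[OF V] vectorspace_closed(6)[OF W])
qed

lemma coboundaries_subset: "coboundaries C d z \<subseteq> cocycles C d z"
  unfolding coboundaries_def cocycles_def
  using class_module_homD(1)[OF cochain_complexD(3)[OF C]] cochain_complexD(5)[OF C] by blast

lemma coboundaries_submodule: "submodule class_ring (coboundaries C d z) (pspace (pobj C d) z)"
proof (rule class_submoduleI)
  note V = cochain_complexD(1)[OF C, of "d - 1" z] and W = cochain_complexD(1)[OF C, of d z]
    and f = cochain_complexD(3)[OF C, of d z]
  note fD = class_module_homD[OF f]
  show "vectorspace class_ring (pspace (pobj C d) z)" by (rule W)
  show "coboundaries C d z \<subseteq> pcarrier (pobj C d) z" using coboundaries_subset cocycles_carrier by blast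
  show "\<zero>\<^bsub>pspace (pobj C d) z\<^esub> \<in> coboundaries C d z"
    unfolding coboundaries_def
    using class_module_hom_zero[OF V W f] vectorspace_closed(1)[OF V] by (intro image_eqI) auto
  show "x \<oplus>\<^bsub>pspace (pobj C d) z\<^esub> y \<in> coboundaries C d z"
    if xy: "x \<in> coboundaries C d z" "y \<in> coboundaries C d z" for x y
  proof -
    obtain u where u: "u \<in> pcarrier (pobj C (d - 1)) z" "x = pdiff C d z u"
      using xy(1) unfolding coboundaries_def by blast
    obtain v where v: "v \<in> pcarrier (pobj C (d - 1)) z" "y = pdiff C d z v"
      using xy(2) unfolding coboundaries_def by blast
    show ?thesis
      unfolding coboundaries_def u(2) v(2) fD(2)[OF u(1) v(1), symmetric]
      by (rule imageI) (rule vectorspace_closed(2)[OF V u(1) v(1)])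
  qed
  show "a \<odot>\<^bsub>pspace (pobj C d) z\<^esub> x \<in> coboundaries C d z" if x: "x \<in> coboundaries C d z" for a x
  proof -
    obtain u where u: "u \<in> pcarrier (pobj C (d - 1)) z" "x = pdiff C d z u"
      using x unfolding coboundaries_def by blast
    show ?thesis
      unfolding coboundaries_def u(2) fD(3)[OF u(1), symmetric]
      by (rule imageI) (rule vectorspace_closed(3)[OF V u(1)])
  qed
qed

lemma cohomology_vectorspace:
  "vectorspace class_ring (pspace (cohomology C d) z)"
  "vectorspace.fin_dim class_ring (pspace (cohomology C d) z)"
proof -
  let ?Z = "(pspace (pobj C d) z)\<lparr>carrier := cocycles C d z\<rparr>"
  note V = cochain_complexD(1)[OF C, of d z] and fd = cochain_complexD(2)[OF C, of d z]
  note Z = submodule_carrier_update[OF V cocycles_submodule]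
  note B = Z(2)[OF coboundaries_submodule coboundaries_subset]
  show "vectorspace class_ring (pspace (cohomology C d) z)"
    unfolding cohomology_space by (rule quotient_space_vectorspace[OF Z(1) B])
  show "vectorspace.fin_dim class_ring (pspace (cohomology C d) z)"
    unfolding cohomology_space by (rule quotient_space_fin_dim[OF Z(1) B Z(3)[OF fd]])
qed

lemma cohomology_class_hom:
  "(\<lambda>x. coboundaries C d z +>\<^bsub>pspace (pobj C d) z\<^esub> x) \<in>
    module_hom class_ring ((pspace (pobj C d) z)\<lparr>carrier := cocycles C d z\<rparr>) (pspace (cohomology C d) z)"
proof -
  note V = cochain_complexD(1)[OF C, of d z]
  note Z = submodule_carrier_update[OF V cocycles_submodule]
  show ?thesis
    using quotient_map_hom[OF Z(1) Z(2)[OF coboundaries_submodule coboundaries_subset]]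
    unfolding cohomology_space by simp
qed

lemma cohomology_class_eq_iff:
  assumes "x \<in> cocycles C d z" "y \<in> cocycles C d z"
  shows "coboundaries C d z +>\<^bsub>pspace (pobj C d) z\<^esub> x = coboundaries C d z +>\<^bsub>pspace (pobj C d) z\<^esub> y \<longleftrightarrow>
    (\<exists>n\<in>coboundaries C d z. x = n \<oplus>\<^bsub>pspace (pobj C d) z\<^esub> y)"
  using assms cocycles_carrier by (intro submodule.coset_eq_iff[OF coboundaries_submodule]) blast+

lemma cohomology_class_zero_iff:
  assumes "x \<in> cocycles C d z"
  shows "coboundaries C d z +>\<^bsub>pspace (pobj C d) z\<^esub> x = coboundaries C d z \<longleftrightarrow> x \<in> coboundaries C d z"
  using assms cocycles_carrier by (intro submodule.coset_eq_self_iff[OF coboundaries_submodule]) blast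

lemma cohomology_trivial_iff:
  "pcarrier (cohomology C d) z = {\<zero>\<^bsub>pspace (cohomology C d) z\<^esub>} \<longleftrightarrow> cocycles C d z \<subseteq> coboundaries C d z"
proof -
  have zero: "\<zero>\<^bsub>pspace (cohomology C d) z\<^esub> = coboundaries C d z"
    unfolding cohomology_space quotient_space_simps ..
  have ne: "\<zero>\<^bsub>pspace (pobj C d) z\<^esub> \<in> cocycles C d z"
    using cocycles_submodule unfolding submodule_def by blast
  show ?thesis
  proof
    assume eq: "pcarrier (cohomology C d) z = {\<zero>\<^bsub>pspace (cohomology C d) z\<^esub>}"
    show "cocycles C d z \<subseteq> coboundaries C d z"
    proof
      fix x assume x: "x \<in> cocycles C d z"
      then have "coboundaries C d z +>\<^bsub>pspace (pobj C d) z\<^esub> x \<in> pcarrier (cohomology C d) z"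
        unfolding cohomology_carrier by (rule imageI)
      then show "x \<in> coboundaries C d z" unfolding eq zero using cohomology_class_zero_iff[OF x] by simp
    qed
  next
    assume sub: "cocycles C d z \<subseteq> coboundaries C d z"
    have "coboundaries C d z +>\<^bsub>pspace (pobj C d) z\<^esub> x = coboundaries C d z" if "x \<in> cocycles C d z" for x
      using cohomology_class_zero_iff[OF that] that sub by (simp add: subset_iff)
    then show "pcarrier (cohomology C d) z = {\<zero>\<^bsub>pspace (cohomology C d) z\<^esub>}"
      unfolding cohomology_carrier zero using ne by force
  qed
qed

text \<open>Nonzero cohomology occurs in finitely many grades only. A grade with either coordinate
  beyond all of theirs is not among them; the disjunction in the statement is essential for the
  duality argument, which can raise only one coordinate at a time.\<close>

lemma cohomology_vanishing:
  assumes fin: "total_dim (cohomology C d) < \<infinity>"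
  shows "\<exists>M. \<forall>z. M \<le> fst z \<or> M \<le> snd z \<longrightarrow> cocycles C d z \<subseteq> coboundaries C d z"
proof -
  let ?dim = "\<lambda>z. vectorspace.dim class_ring (pspace (cohomology C d) z)"
  let ?S = "{z. ?dim z \<noteq> 0}"
  have "finite ?S"
  proof (rule ccontr)
    assume inf: "infinite ?S"
    have sm: "(\<lambda>z. of_nat (?dim z) :: ennreal) summable_on A" for A
      by (rule nonneg_summable_on_complete) simp
    \<comment> \<open>Dimensions are natural numbers, so each of the infinitely many nonzero terms
      is at least 1.\<close>
    have "\<infinity> = (\<Sum>\<^sub>\<infinity>z\<in>?S. of_nat (?dim z) :: ennreal)"
    proof (rule infsum_superconst_infinite_ennreal[OF _ _ inf, of 1, symmetric])
      fix z assume "z \<in> ?S"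
      then have "1 \<le> ?dim z" by simp
      then have "of_nat 1 \<le> (of_nat (?dim z) :: ennreal)" by (rule of_nat_mono)
      then show "1 \<le> (of_nat (?dim z) :: ennreal)" by simp
    qed simp
    also have "\<dots> \<le> (\<Sum>\<^sub>\<infinity>z. of_nat (?dim z) :: ennreal)"
      by (rule infsum_mono_neutral[OF sm sm]) auto
    finally show False using fin unfolding total_dim_def by simp
  qed
  then have "finite (fst ` ?S \<union> snd ` ?S)" by simp
  then have "bdd_above (fst ` ?S \<union> snd ` ?S)" by (rule bdd_above_finite)
  then obtain M where M0: "\<forall>t\<in>fst ` ?S \<union> snd ` ?S. t \<le> M" unfolding bdd_above_def by blast
  \<comment> \<open>\<open>M\<close> itself may still be a coordinate of a grade with nonzero
    cohomology, hence the threshold \<open>M + 1\<close>.\<close>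
  have M: "t < M + 1" if "t \<in> fst ` ?S \<union> snd ` ?S" for t using bspec[OF M0 that] by simp
  have "cocycles C d z \<subseteq> coboundaries C d z" if "M + 1 \<le> fst z \<or> M + 1 \<le> snd z" for z
  proof -
    have "z \<notin> ?S"
    proof
      assume "z \<in> ?S"
      then have "fst z < M + 1" "snd z < M + 1" using M by blast+
      then show False using that by linarith
    qed
    then have "?dim z = 0" by simp
    then have "pcarrier (cohomology C d) z = {\<zero>\<^bsub>pspace (cohomology C d) z\<^esub>}"
      by (rule vectorspace.dim_zero_carrier[OF cohomology_vectorspace])
    then show ?thesis using cohomology_trivial_iff by blast
  qed
  then show ?thesis by blast
qed

end

section \<open>Chain maps and quasi-isomorphisms in terms of elements\<close>

lemma chain_mapD:
  assumes "chain_map C D f"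
  shows "f d z \<in> module_hom class_ring (pspace (pobj C d) z) (pspace (pobj D d) z)"
    and "x \<in> pcarrier (pobj C (d - 1)) z \<Longrightarrow> f d z (pdiff C d z x) = pdiff D d z (f (d - 1) z x)"
    and "z \<le> w \<Longrightarrow> x \<in> pcarrier (pobj C d) z \<Longrightarrow>
      f d w (pmap (pobj C d) z w x) = pmap (pobj D d) z w (f d z x)"
  using assms unfolding chain_map_def pmorphism_def by blast+

lemma chain_map_cocycles:
  fixes C :: "('k::field, 'v) pcomplex" and D :: "('k, 'w) pcomplex"
  assumes C: "cochain_complex C" and D: "cochain_complex D" and f: "chain_map C D f"
  shows "x \<in> cocycles C d z \<Longrightarrow> f d z x \<in> cocycles D d z"
    and "x \<in> coboundaries C d z \<Longrightarrow> f d z x \<in> coboundaries D d z"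
proof -
  assume x: "x \<in> cocycles C d z"
  then have xc: "x \<in> pcarrier (pobj C d) z" "pdiff C (d + 1) z x = \<zero>\<^bsub>pspace (pobj C (d + 1)) z\<^esub>"
    unfolding cocycles_def by blast+
  have "pdiff D (d + 1) z (f d z x) = f (d + 1) z (pdiff C (d + 1) z x)"
    using chain_mapD(2)[OF f, of x "d + 1" z] xc(1) by simp
  also have "\<dots> = \<zero>\<^bsub>pspace (pobj D (d + 1)) z\<^esub>"
    unfolding xc(2)
    by (rule class_module_hom_zero[OF cochain_complexD(1)[OF C] cochain_complexD(1)[OF D] chain_mapD(1)[OF f]])
  finally show "f d z x \<in> cocycles D d z"
    using class_module_homD(1)[OF chain_mapD(1)[OF f] xc(1)] unfolding cocycles_def by blast
next
  assume "x \<in> coboundaries C d z"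
  then obtain u where u: "u \<in> pcarrier (pobj C (d - 1)) z" "x = pdiff C d z u"
    unfolding coboundaries_def by blast
  show "f d z x \<in> coboundaries D d z"
    unfolding u(2) chain_mapD(2)[OF f u(1)] coboundaries_def
    by (rule imageI) (rule class_module_homD(1)[OF chain_mapD(1)[OF f] u(1)])
qed

text \<open>\<open>cohomology_map\<close> is a union over all representatives of a class; it is a
  single coset because \<open>f\<close> sends coboundaries to coboundaries.\<close>

lemma cohomology_map_class:
  fixes C :: "('k::field, 'v) pcomplex" and D :: "('k, 'w) pcomplex"
  assumes C: "cochain_complex C" and D: "cochain_complex D" and x: "x \<in> cocycles C d z"
    and f: "f \<in> module_hom class_ring (pspace (pobj C d) z) (pspace (pobj D d) z)"
    and fB: "\<And>n. n \<in> coboundaries C d z \<Longrightarrow> f n \<in> coboundaries D d z"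
  shows "cohomology_map D d z f (coboundaries C d z +>\<^bsub>pspace (pobj C d) z\<^esub> x) =
    coboundaries D d z +>\<^bsub>pspace (pobj D d) z\<^esub> f x"
proof -
  note B = coboundaries_submodule[OF C, of d z] and BD = coboundaries_submodule[OF D, of d z]
  have xc: "x \<in> pcarrier (pobj C d) z" using x cocycles_carrier[OF C] by blast
  have const: "coboundaries D d z +>\<^bsub>pspace (pobj D d) z\<^esub> f w = coboundaries D d z +>\<^bsub>pspace (pobj D d) z\<^esub> f x"
    if w: "w \<in> coboundaries C d z +>\<^bsub>pspace (pobj C d) z\<^esub> x" for w
  proof -
    obtain n where n: "n \<in> coboundaries C d z" "w = n \<oplus>\<^bsub>pspace (pobj C d) z\<^esub> x"
      using w submodule.coset_mem[OF B] by blast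
    have nc: "n \<in> pcarrier (pobj C d) z" using n(1) coboundaries_subset[OF C] cocycles_carrier[OF C] by blast
    show ?thesis unfolding n(2) class_module_homD(2)[OF f nc xc]
      by (rule submodule.coset_add_eq[OF BD fB[OF n(1)] class_module_homD(1)[OF f xc]])
  qed
  have ne: "coboundaries C d z +>\<^bsub>pspace (pobj C d) z\<^esub> x \<noteq> {}" using submodule.coset_self[OF B xc] by blast
  show ?thesis unfolding cohomology_map_def by (rule SUP_eq_const[OF ne const])
qed

text \<open>Surjectivity and injectivity on cohomology, freed from cosets.\<close>

lemma quasi_isomorphismD:
  fixes C :: "('k::field, 'v) pcomplex" and D :: "('k, 'w) pcomplex"
  assumes C: "cochain_complex C" and D: "cochain_complex D" and f: "quasi_isomorphism C D f"
  shows "y \<in> cocycles D d z \<Longrightarrow>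
      \<exists>x\<in>cocycles C d z. \<exists>b\<in>coboundaries D d z. y = b \<oplus>\<^bsub>pspace (pobj D d) z\<^esub> f d z x"
    and "x \<in> cocycles C d z \<Longrightarrow> f d z x \<in> coboundaries D d z \<Longrightarrow> x \<in> coboundaries C d z"
proof -
  have cm: "chain_map C D f" and bij: "bij_betw (cohomology_map D d z (f d z))
      (pcarrier (cohomology C d) z) (pcarrier (cohomology D d) z)"
    using f unfolding quasi_isomorphism_def by blast+
  let ?BC = "\<lambda>x. coboundaries C d z +>\<^bsub>pspace (pobj C d) z\<^esub> x"
  let ?BD = "\<lambda>x. coboundaries D d z +>\<^bsub>pspace (pobj D d) z\<^esub> x"
  note fc = chain_map_cocycles[OF C D cm]
  have map: "cohomology_map D d z (f d z) (?BC x) = ?BD (f d z x)" if "x \<in> cocycles C d z" for x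
    by (rule cohomology_map_class[OF C D that chain_mapD(1)[OF cm] fc(2)])
  show "\<exists>x\<in>cocycles C d z. \<exists>b\<in>coboundaries D d z. y = b \<oplus>\<^bsub>pspace (pobj D d) z\<^esub> f d z x"
    if y: "y \<in> cocycles D d z"
  proof -
    have "?BD y \<in> pcarrier (cohomology D d) z" unfolding cohomology_carrier using y by (rule imageI)
    then have "?BD y \<in> cohomology_map D d z (f d z) ` (?BC ` cocycles C d z)"
      using bij unfolding bij_betw_def cohomology_carrier by blast
    then obtain x where x: "x \<in> cocycles C d z" "?BD y = cohomology_map D d z (f d z) (?BC x)" by blast
    then have "?BD y = ?BD (f d z x)" using map by simp
    then show ?thesis using cohomology_class_eq_iff[OF D y fc(1)[OF x(1)]] x(1) by blast
  qed
  show "x \<in> coboundaries C d z" if x: "x \<in> cocycles C d z" "f d z x \<in> coboundaries D d z"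
  proof -
    let ?o = "\<zero>\<^bsub>pspace (pobj C d) z\<^esub>"
    have 0: "?o \<in> cocycles C d z" "?o \<in> coboundaries C d z"
      using cocycles_submodule[OF C] coboundaries_submodule[OF C] unfolding submodule_def by blast+
    have "?BD (f d z x) = ?BD (f d z ?o)"
      using cohomology_class_zero_iff[OF D fc(1)[OF 0(1)]] fc(2)[OF 0(2)]
        cohomology_class_zero_iff[OF D fc(1)[OF x(1)]] x(2) by simp
    then have eq: "cohomology_map D d z (f d z) (?BC x) = cohomology_map D d z (f d z) (?BC ?o)"
      using map x(1) 0(1) by simp
    have inj: "inj_on (cohomology_map D d z (f d z)) (?BC ` cocycles C d z)"
      using bij unfolding bij_betw_def cohomology_carrier by blast
    have "?BC x = ?BC ?o" by (rule inj_onD[OF inj eq imageI[OF x(1)] imageI[OF 0(1)]])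
    then have "?BC x = coboundaries C d z" using cohomology_class_zero_iff[OF C 0(1)] 0(2) by simp
    then show ?thesis using cohomology_class_zero_iff[OF C x(1)] by blast
  qed
qed

section \<open>Augmented complexes\<close>

lemma vectorspace_minus:
  fixes V :: "('k::field, 'v) module"
  assumes V: "vectorspace class_ring V" and x: "x \<in> carrier V" and y: "y \<in> carrier V"
  shows "(x \<oplus>\<^bsub>V\<^esub> (- 1) \<odot>\<^bsub>V\<^esub> y) \<oplus>\<^bsub>V\<^esub> y = x" "(x \<oplus>\<^bsub>V\<^esub> y) \<oplus>\<^bsub>V\<^esub> (- 1) \<odot>\<^bsub>V\<^esub> y = x"
proof -
  interpret V: vectorspace class_ring V by (rule V)
  note m = vectorspace_closed(3)[OF V y, of "- 1"]
  have 1: "1 \<odot>\<^bsub>V\<^esub> y = y" using V.smult_one[OF y] by simp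
  have "(- 1) \<odot>\<^bsub>V\<^esub> y \<oplus>\<^bsub>V\<^esub> y = (- 1) \<odot>\<^bsub>V\<^esub> y \<oplus>\<^bsub>V\<^esub> 1 \<odot>\<^bsub>V\<^esub> y" unfolding 1 ..
  also have "\<dots> = (- 1 + 1) \<odot>\<^bsub>V\<^esub> y" using V.smult_l_distr[of "- 1" 1 y] y by simp
  also have "\<dots> = \<zero>\<^bsub>V\<^esub>" using vectorspace_zero_smult[OF V y] by simp
  finally have l: "(- 1) \<odot>\<^bsub>V\<^esub> y \<oplus>\<^bsub>V\<^esub> y = \<zero>\<^bsub>V\<^esub>" .
  have r: "y \<oplus>\<^bsub>V\<^esub> (- 1) \<odot>\<^bsub>V\<^esub> y = \<zero>\<^bsub>V\<^esub>" using l V.a_comm[OF m y] by simp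
  show "(x \<oplus>\<^bsub>V\<^esub> (- 1) \<odot>\<^bsub>V\<^esub> y) \<oplus>\<^bsub>V\<^esub> y = x" unfolding V.a_assoc[OF x m y] l by (rule V.r_zero[OF x])
  show "(x \<oplus>\<^bsub>V\<^esub> y) \<oplus>\<^bsub>V\<^esub> (- 1) \<odot>\<^bsub>V\<^esub> y = x" unfolding V.a_assoc[OF x y m] r by (rule V.r_zero[OF x])
qed

lemma pmorphismD:
  assumes "pmorphism M N f"
  shows "f z \<in> module_hom class_ring (pspace M z) (pspace N z)"
    and "z \<le> w \<Longrightarrow> x \<in> pcarrier M z \<Longrightarrow> f w (pmap M z w x) = pmap N z w (f z x)"
  using assms unfolding pmorphism_def by blast+

lemma pmorphismI:
  assumes "\<And>z. f z \<in> module_hom class_ring (pspace M z) (pspace N z)"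
    and "\<And>z w x. z \<le> w \<Longrightarrow> x \<in> pcarrier M z \<Longrightarrow> f w (pmap M z w x) = pmap N z w (f z x)"
  shows "pmorphism M N f"
  using assms unfolding pmorphism_def by blast

lemma cochain_complex_pmorphism: "cochain_complex C \<Longrightarrow> pmorphism (pobj C (d - 1)) (pobj C d) (pdiff C d)"
  unfolding cochain_complex_def by blast

lemma cochain_complex_pmap:
  assumes "cochain_complex C" "z \<le> w"
  shows "pmap (pobj C d) z w \<in> module_hom class_ring (pspace (pobj C d) z) (pspace (pobj C d) w)"
proof -
  have "persistence_module (pobj C d)" using assms(1) unfolding cochain_complex_def by blast
  from this[unfolded persistence_module_def, THEN conjunct2, THEN conjunct1] assms(2) show ?thesis
    by (elim allE impE)
qed

lemma pmap_coboundaries: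
  assumes C: "cochain_complex C" and zw: "z \<le> w" and n: "n \<in> coboundaries C d z"
  shows "pmap (pobj C d) z w n \<in> coboundaries C d w"
proof -
  obtain u where u: "u \<in> pcarrier (pobj C (d - 1)) z" "n = pdiff C d z u"
    using n unfolding coboundaries_def by blast
  show ?thesis
    unfolding u(2) pmorphismD(2)[OF cochain_complex_pmorphism[OF C] zw u(1), symmetric] coboundaries_def
    by (rule imageI) (rule class_module_homD(1)[OF cochain_complex_pmap[OF C zw] u(1)])
qed

lemma cohomology_pmap_class:
  assumes C: "cochain_complex C" and zw: "z \<le> w" and x: "x \<in> cocycles C d z"
  shows "pmap (cohomology C d) z w (coboundaries C d z +>\<^bsub>pspace (pobj C d) z\<^esub> x) =
    coboundaries C d w +>\<^bsub>pspace (pobj C d) w\<^esub> pmap (pobj C d) z w x"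
proof -
  let ?f = "pmap (pobj C d) z w"
  note B = coboundaries_submodule[OF C, of d z] and B' = coboundaries_submodule[OF C, of d w]
    and f = cochain_complex_pmap[OF C zw]
  have xc: "x \<in> pcarrier (pobj C d) z" using x cocycles_carrier[OF C] by blast
  have const: "coboundaries C d w +>\<^bsub>pspace (pobj C d) w\<^esub> ?f y = coboundaries C d w +>\<^bsub>pspace (pobj C d) w\<^esub> ?f x"
    if y: "y \<in> coboundaries C d z +>\<^bsub>pspace (pobj C d) z\<^esub> x" for y
  proof -
    obtain n where n: "n \<in> coboundaries C d z" "y = n \<oplus>\<^bsub>pspace (pobj C d) z\<^esub> x"
      using y submodule.coset_mem[OF B] by blast
    have nc: "n \<in> pcarrier (pobj C d) z" using n(1) coboundaries_subset[OF C] cocycles_carrier[OF C] by blast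
    show ?thesis unfolding n(2) class_module_homD(2)[OF f nc xc]
      by (rule submodule.coset_add_eq[OF B' pmap_coboundaries[OF C zw n(1)] class_module_homD(1)[OF f xc]])
  qed
  have ne: "coboundaries C d z +>\<^bsub>pspace (pobj C d) z\<^esub> x \<noteq> {}" using submodule.coset_self[OF B xc] by blast
  have "pmap (cohomology C d) z w = cohomology_map C d w ?f" unfolding cohomology_def by simp
  then show ?thesis unfolding cohomology_map_def by (simp add: SUP_eq_const[OF ne const])
qed

text \<open>A resolution as an exact augmented complex. For complexes in nonpositive degrees it
  encodes a quasi-isomorphism to \<open>in_degree_zero M\<close>, but by conditions on elements,
  which are easier to verify for matrices and to carry over to another complex.\<close>

definition augmentation :: "('k::field, 'v) pcomplex \<Rightarrow> ('k, 'w) pmodule \<Rightarrow> (grade \<Rightarrow> 'v \<Rightarrow> 'w) \<Rightarrow> bool" where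
  "augmentation F M \<epsilon> \<longleftrightarrow> pmorphism (pobj F 0) M \<epsilon> \<and>
    (\<forall>z. \<epsilon> z ` pcarrier (pobj F 0) z = pcarrier M z) \<and>
    (\<forall>z. \<forall>x\<in>pcarrier (pobj F 0) z. \<epsilon> z x = \<zero>\<^bsub>pspace M z\<^esub> \<longleftrightarrow> x \<in> coboundaries F 0 z) \<and>
    (\<forall>d z. d \<noteq> 0 \<longrightarrow> cocycles F d z \<subseteq> coboundaries F d z)"

lemma augmentationD:
  assumes "augmentation F M \<epsilon>"
  shows "pmorphism (pobj F 0) M \<epsilon>"
    and "\<epsilon> z ` pcarrier (pobj F 0) z = pcarrier M z"
    and "x \<in> pcarrier (pobj F 0) z \<Longrightarrow> \<epsilon> z x = \<zero>\<^bsub>pspace M z\<^esub> \<longleftrightarrow> x \<in> coboundaries F 0 z"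
    and "d \<noteq> 0 \<Longrightarrow> cocycles F d z \<subseteq> coboundaries F d z"
  using assms unfolding augmentation_def by blast+

lemma cocycles_top:
  assumes F: "cochain_complex F" and zero: "\<forall>d>0. zero_pmodule (pobj F d)"
  shows "cocycles F 0 z = pcarrier (pobj F 0) z"
proof -
  have "zero_pmodule (pobj F 1)" using zero by simp
  then have "pcarrier (pobj F 1) z = {\<zero>\<^bsub>pspace (pobj F 1) z\<^esub>}"
    unfolding zero_pmodule_def by (rule spec)
  then show ?thesis
    using class_module_homD(1)[OF cochain_complexD(4)[OF F, of 0 z]] unfolding cocycles_def by auto
qed

lemma in_degree_zero_coboundaries:
  fixes M :: "('k::field, 'v) pmodule"
  assumes M: "\<And>z. vectorspace class_ring (pspace M z)"
  shows "coboundaries (in_degree_zero M) d z = {\<zero>\<^bsub>pspace M z\<^esub>}"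
    and "cocycles (in_degree_zero M) d z = pcarrier (pobj (in_degree_zero M) d) z"
    and "x \<in> pcarrier M z \<Longrightarrow>
      coboundaries (in_degree_zero M) d z +>\<^bsub>pspace (pobj (in_degree_zero M) d) z\<^esub> x = {x}"
proof -
  note zM = vectorspace_closed(1)[OF M, of z]
  have ne: "pcarrier (pobj (in_degree_zero M) (d - 1)) z \<noteq> {}"
    using zM unfolding in_degree_zero_def by auto
  have "pdiff (in_degree_zero M) d z = (\<lambda>x. \<zero>\<^bsub>pspace M z\<^esub>)" by (simp add: in_degree_zero_def)
  then show B: "coboundaries (in_degree_zero M) d z = {\<zero>\<^bsub>pspace M z\<^esub>}"
    unfolding coboundaries_def using ne by (simp add: image_constant_conv)
  show "cocycles (in_degree_zero M) d z = pcarrier (pobj (in_degree_zero M) d) z"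
    unfolding cocycles_def by (simp add: in_degree_zero_def)
  assume x: "x \<in> pcarrier M z"
  have "x \<oplus>\<^bsub>pspace M z\<^esub> y = x \<oplus>\<^bsub>pspace (pobj (in_degree_zero M) d) z\<^esub> y" for x y
    by (simp add: in_degree_zero_def)
  then show "coboundaries (in_degree_zero M) d z +>\<^bsub>pspace (pobj (in_degree_zero M) d) z\<^esub> x = {x}"
    unfolding B a_r_coset_def' using vectorspace_closed(5)[OF M x] by simp
qed

text \<open>The kernel of \<epsilon> consists of the coboundaries; applied to the difference of
  \<open>x\<close> and \<open>y\<close>, this makes \<epsilon> injective on cohomology classes in
  degree zero.\<close>

lemma augmentation_fiber:
  fixes F :: "('k::field, 'v) pcomplex" and M :: "('k, 'w) pmodule"
  assumes F: "cochain_complex F" and zero: "\<forall>d>0. zero_pmodule (pobj F d)"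
    and M: "\<And>z. vectorspace class_ring (pspace M z)" and \<epsilon>: "augmentation F M \<epsilon>"
    and x: "x \<in> pcarrier (pobj F 0) z" and y: "y \<in> pcarrier (pobj F 0) z"
  shows "\<epsilon> z x = \<epsilon> z y \<longleftrightarrow>
    coboundaries F 0 z +>\<^bsub>pspace (pobj F 0) z\<^esub> x = coboundaries F 0 z +>\<^bsub>pspace (pobj F 0) z\<^esub> y"
proof -
  note V = cochain_complexD(1)[OF F, of 0 z]
  note hom = pmorphismD(1)[OF augmentationD(1)[OF \<epsilon>], of z]
  note h = class_module_homD[OF hom]
  let ?V = "pspace (pobj F 0) z" and ?M = "pspace M z"
  have cos: "coboundaries F 0 z +>\<^bsub>?V\<^esub> x = coboundaries F 0 z +>\<^bsub>?V\<^esub> y \<longleftrightarrow> (\<exists>n\<in>coboundaries F 0 z. x = n \<oplus>\<^bsub>?V\<^esub> y)"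
    using x y cocycles_top[OF F zero] by (intro cohomology_class_eq_iff[OF F]) auto
  show ?thesis
    unfolding cos
  proof
    assume eq: "\<epsilon> z x = \<epsilon> z y"
    let ?d = "x \<oplus>\<^bsub>?V\<^esub> (- 1) \<odot>\<^bsub>?V\<^esub> y"
    note my = vectorspace_closed(3)[OF V y, of "- 1"]
    note d = vectorspace_closed(2)[OF V x my]
    have "\<epsilon> z ?d = \<epsilon> z y \<oplus>\<^bsub>?M\<^esub> (- 1) \<odot>\<^bsub>?M\<^esub> \<epsilon> z y" unfolding h(2)[OF x my] h(3)[OF y] eq ..
    also have "\<dots> = (\<zero>\<^bsub>?M\<^esub> \<oplus>\<^bsub>?M\<^esub> \<epsilon> z y) \<oplus>\<^bsub>?M\<^esub> (- 1) \<odot>\<^bsub>?M\<^esub> \<epsilon> z y"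
      unfolding vectorspace_closed(5)[OF M h(1)[OF y]] ..
    also have "\<dots> = \<zero>\<^bsub>?M\<^esub>" by (rule vectorspace_minus(2)[OF M vectorspace_closed(1)[OF M] h(1)[OF y]])
    finally have "?d \<in> coboundaries F 0 z" using augmentationD(3)[OF \<epsilon> d] by blast
    then show "\<exists>n\<in>coboundaries F 0 z. x = n \<oplus>\<^bsub>?V\<^esub> y"
      using vectorspace_minus(1)[OF V x y] by (intro bexI[of _ ?d]) simp_all
  next
    assume "\<exists>n\<in>coboundaries F 0 z. x = n \<oplus>\<^bsub>?V\<^esub> y"
    then obtain n where n: "n \<in> coboundaries F 0 z" "x = n \<oplus>\<^bsub>?V\<^esub> y" by blast
    have nc: "n \<in> carrier ?V" using n(1) coboundaries_subset[OF F] cocycles_carrier[OF F] by blast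
    have "\<epsilon> z n = \<zero>\<^bsub>?M\<^esub>" using augmentationD(3)[OF \<epsilon> nc] n(1) by blast
    then show "\<epsilon> z x = \<epsilon> z y"
      unfolding n(2) h(2)[OF nc y] using vectorspace_closed(5)[OF M h(1)[OF y]] by simp
  qed
qed

text \<open>The chain map is \<epsilon> in degree zero and zero elsewhere. All coboundaries in the
  target are zero, so its cohomology classes are singletons, and the class of \<open>x\<close> goes
  to the singleton of its value under \<epsilon>.\<close>

lemma augmentation_free_resolution:
  fixes F :: "('k::field, 'v) pcomplex" and M :: "('k, 'w) pmodule"
  assumes F: "cochain_complex F" and free: "\<And>d. free_finite_rank (pobj F d)"
    and zero: "\<forall>d>0. zero_pmodule (pobj F d)"
    and M: "\<And>z. vectorspace class_ring (pspace M z)" and \<epsilon>: "augmentation F M \<epsilon>"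
  shows "free_resolution F M"
proof -
  let ?D = "in_degree_zero M"
  define g where "g = (\<lambda>d::int. \<lambda>z x. if d = 0 then \<epsilon> z x else \<zero>\<^bsub>pspace M z\<^esub>)"
  note D = in_degree_zero_coboundaries[OF M]
  have hom: "\<epsilon> z \<in> module_hom class_ring (pspace (pobj F 0) z) (pspace M z)" for z
    by (rule pmorphismD(1)[OF augmentationD(1)[OF \<epsilon>]])
  note h = class_module_homD[OF hom]
  have gM: "g d z x \<in> pcarrier M z" if "x \<in> pcarrier (pobj F d) z" for d z x
    using that h(1)[of x z] vectorspace_closed(1)[OF M] unfolding g_def by (cases "d = 0") simp_all
  have chain: "chain_map F ?D g"
    unfolding chain_map_def
  proof (intro conjI allI ballI)
    fix d
    show "pmorphism (pobj F d) (pobj ?D d) (g d)"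
    proof (cases "d = 0")
      case True
      then show ?thesis using augmentationD(1)[OF \<epsilon>] unfolding g_def in_degree_zero_def by simp
    next
      case False
      show ?thesis
      proof (rule pmorphismI)
        show "g d z \<in> module_hom class_ring (pspace (pobj F d) z) (pspace (pobj ?D d) z)" for z
          using False vectorspace_closed(1,4,6)[OF M[of z]]
          by (intro class_module_homI) (simp_all add: g_def in_degree_zero_def)
        show "g d w (pmap (pobj F d) z w x) = pmap (pobj ?D d) z w (g d z x)" for z w x
          using False by (simp add: g_def in_degree_zero_def)
      qed
    qed
  next
    fix d z x assume x: "x \<in> pcarrier (pobj F (d - 1)) z"
    show "g d z (pdiff F d z x) = pdiff ?D d z (g (d - 1) z x)"
    proof (cases "d = 0")
      case True
      have "pdiff F 0 z x \<in> coboundaries F 0 z" using x unfolding coboundaries_def True by (rule imageI)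
      moreover from this have "pdiff F 0 z x \<in> pcarrier (pobj F 0) z"
        using coboundaries_subset[OF F] cocycles_carrier[OF F] by blast
      ultimately show ?thesis using augmentationD(3)[OF \<epsilon>] True by (simp add: g_def in_degree_zero_def)
    qed (simp add: g_def in_degree_zero_def)
  qed
  have coh_D: "pcarrier (cohomology ?D d) z = (\<lambda>x. {x}) ` pcarrier (pobj ?D d) z" for d z
    unfolding cohomology_carrier D(2)
  proof (rule image_cong[OF refl])
    fix x assume "x \<in> pcarrier (pobj ?D d) z"
    then have "x \<in> pcarrier M z"
      using vectorspace_closed(1)[OF M, of z] by (cases "d = 0") (simp_all add: in_degree_zero_def)
    then show "coboundaries ?D d z +>\<^bsub>pspace (pobj ?D d) z\<^esub> x = {x}" by (rule D(3))
  qed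
  have map: "cohomology_map ?D d z (g d z) X = g d z ` X" if "X \<subseteq> pcarrier (pobj F d) z" for d z X
  proof -
    have "coboundaries ?D d z +>\<^bsub>pspace (pobj ?D d) z\<^esub> g d z x = {g d z x}" if "x \<in> X" for x
      using that \<open>X \<subseteq> _\<close> by (intro D(3) gM) blast
    then show ?thesis unfolding cohomology_map_def by auto
  qed
  have bij: "bij_betw (cohomology_map ?D d z (g d z)) (pcarrier (cohomology F d) z) (pcarrier (cohomology ?D d) z)" for d z
  proof (cases "d = 0")
    case True
    let ?V = "pspace (pobj F 0) z"
    let ?c = "\<lambda>x. coboundaries F 0 z +>\<^bsub>?V\<^esub> x"
    note B = coboundaries_submodule[OF F, of 0 z]
    have cm: "cohomology_map ?D 0 z (g 0 z) (?c x) = {\<epsilon> z x}" if x: "x \<in> carrier ?V" for x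
    proof -
      have sub: "?c x \<subseteq> carrier ?V"
      proof
        fix w assume "w \<in> ?c x"
        then obtain n where n: "n \<in> coboundaries F 0 z" "w = n \<oplus>\<^bsub>?V\<^esub> x" using submodule.coset_mem[OF B] by blast
        have "n \<in> carrier ?V" using n(1) coboundaries_subset[OF F] cocycles_carrier[OF F] by blast
        then show "w \<in> carrier ?V" unfolding n(2) by (rule vectorspace_closed(2)[OF cochain_complexD(1)[OF F] _ x])
      qed
      have const: "\<epsilon> z w = \<epsilon> z x" if w: "w \<in> ?c x" for w
      proof -
        obtain n where n: "n \<in> coboundaries F 0 z" "w = n \<oplus>\<^bsub>?V\<^esub> x" using w submodule.coset_mem[OF B] by blast
        have "?c w = ?c x" unfolding n(2) by (rule submodule.coset_add_eq[OF B n(1) x])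
        then show ?thesis using augmentation_fiber[OF F zero M \<epsilon> _ x] sub w by blast
      qed
      have "\<epsilon> z ` ?c x = (\<lambda>w. \<epsilon> z x) ` ?c x" by (rule image_cong[OF refl const])
      also have "\<dots> = {\<epsilon> z x}" by (rule image_constant[OF submodule.coset_self[OF B x]])
      finally show ?thesis unfolding map[OF sub] by (simp add: g_def)
    qed
    have carF: "pcarrier (cohomology F 0) z = ?c ` carrier ?V"
      unfolding cohomology_carrier cocycles_top[OF F zero] ..
    have carD: "pcarrier (cohomology ?D 0) z = (\<lambda>x. {x}) ` pcarrier M z"
      unfolding coh_D by (simp add: in_degree_zero_def)
    show ?thesis
      unfolding True bij_betw_def carF carD
    proof
      show "inj_on (cohomology_map ?D 0 z (g 0 z)) (?c ` carrier ?V)"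
      proof (rule inj_onI)
        fix X Y assume "X \<in> ?c ` carrier ?V" "Y \<in> ?c ` carrier ?V"
          and eq: "cohomology_map ?D 0 z (g 0 z) X = cohomology_map ?D 0 z (g 0 z) Y"
        then obtain x y where xy: "x \<in> carrier ?V" "X = ?c x" "y \<in> carrier ?V" "Y = ?c y" by (elim imageE) blast
        have "\<epsilon> z x = \<epsilon> z y" using eq unfolding xy(2,4) cm[OF xy(1)] cm[OF xy(3)] by simp
        then show "X = Y" unfolding xy(2,4) using augmentation_fiber[OF F zero M \<epsilon> xy(1,3)] by blast
      qed
      have "cohomology_map ?D 0 z (g 0 z) ` ?c ` carrier ?V = (\<lambda>x. {\<epsilon> z x}) ` carrier ?V"
        unfolding image_image by (rule image_cong[OF refl cm])
      also have "\<dots> = (\<lambda>x. {x}) ` \<epsilon> z ` carrier ?V" by (simp add: image_image)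
      also have "\<dots> = (\<lambda>x. {x}) ` pcarrier M z" unfolding augmentationD(2)[OF \<epsilon>] ..
      finally show "cohomology_map ?D 0 z (g 0 z) ` ?c ` carrier ?V = (\<lambda>x. {x}) ` pcarrier M z" .
    qed
  next
    case False
    have "pcarrier (cohomology F d) z = {\<zero>\<^bsub>pspace (cohomology F d) z\<^esub>}"
      using cohomology_trivial_iff[OF F] augmentationD(4)[OF \<epsilon> False] by blast
    then have carF: "pcarrier (cohomology F d) z = {coboundaries F d z}"
      unfolding cohomology_space quotient_space_simps .
    have carD: "pcarrier (cohomology ?D d) z = {{\<zero>\<^bsub>pspace M z\<^esub>}}"
      unfolding coh_D using False by (simp add: in_degree_zero_def)
    have sub: "coboundaries F d z \<subseteq> pcarrier (pobj F d) z"
      using coboundaries_subset[OF F] cocycles_carrier[OF F] by blast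
    have ne: "coboundaries F d z \<noteq> {}" using coboundaries_submodule[OF F] unfolding submodule_def by blast
    have "g d z ` coboundaries F d z = {\<zero>\<^bsub>pspace M z\<^esub>}" using ne False unfolding g_def by (simp add: image_constant_conv)
    then show ?thesis unfolding carF carD bij_betw_def using map[OF sub] by simp
  qed
  have "quasi_isomorphism F ?D g" unfolding quasi_isomorphism_def using chain bij by blast
  then show ?thesis unfolding free_resolution_def quasi_isomorphic_def using F free zero by blast
qed

text \<open>Both \<epsilon> and \<open>f\<close> start at \<open>F\<close>, so composing them is not
  possible. But \<open>f\<close> is bijective on cohomology, and in degree zero every element is a
  cocycle; so \<open>\<epsilon>'\<close> may take at \<open>y\<close> the value of \<epsilon> at any
  \<open>x\<close> whose image under \<open>f\<close> is cohomologous to \<open>y\<close>.\<close>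

lemma augmentation_transfer:
  fixes F :: "('k::field, 'v) pcomplex" and F' :: "('k, 'u) pcomplex" and M :: "('k, 'w) pmodule"
  assumes F: "cochain_complex F" and zero: "\<forall>d>0. zero_pmodule (pobj F d)"
    and F': "cochain_complex F'" and zero': "\<forall>d>0. zero_pmodule (pobj F' d)"
    and M: "\<And>z. vectorspace class_ring (pspace M z)" and \<epsilon>: "augmentation F M \<epsilon>"
    and f: "quasi_isomorphism F F' f"
  shows "\<exists>\<epsilon>'. augmentation F' M \<epsilon>'"
proof -
  let ?V = "\<lambda>z. pspace (pobj F 0) z" and ?W = "\<lambda>z. pspace (pobj F' 0) z"
  let ?c = "\<lambda>z x. coboundaries F 0 z +>\<^bsub>?V z\<^esub> x" and ?c' = "\<lambda>z x. coboundaries F' 0 z +>\<^bsub>?W z\<^esub> x"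
  have cm: "chain_map F F' f" using f unfolding quasi_isomorphism_def by blast
  note top = cocycles_top[OF F zero] and top' = cocycles_top[OF F' zero']
  note B' = coboundaries_submodule[OF F', of 0]
  note V = cochain_complexD(1)[OF F] and W = cochain_complexD(1)[OF F']
  note fh = class_module_homD[OF chain_mapD(1)[OF cm]]
  note eh = class_module_homD[OF pmorphismD(1)[OF augmentationD(1)[OF \<epsilon>]]]
  \<comment> \<open>The correspondence inverse to \<open>f\<close> up to coboundaries. It is
    formulated with cosets, so that its compatibility with sums, multiples and structure maps is
    that of cosets.\<close>
  define P where "P = (\<lambda>z y x. x \<in> carrier (?V z) \<and> ?c' z y = ?c' z (f 0 z x))"
  have ex: "\<exists>x. P z y x" if y: "y \<in> carrier (?W z)" for z y
  proof -
    obtain x b where x: "x \<in> carrier (?V z)" and b: "b \<in> coboundaries F' 0 z" "y = b \<oplus>\<^bsub>?W z\<^esub> f 0 z x"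
      using quasi_isomorphismD(1)[OF F F' f, of y 0 z] y unfolding top top' by blast
    then show ?thesis unfolding P_def using submodule.coset_add_eq[OF B' b(1) fh(1)[OF x]] by blast
  qed
  \<comment> \<open>This makes \<open>\<epsilon>'\<close> independent of the choice of
    \<open>x\<close>: injectivity of \<open>f\<close> on cohomology compares classes in
    \<open>F\<close>, on which \<epsilon> is well defined.\<close>
  have fiber: "?c' z (f 0 z x) = ?c' z (f 0 z x') \<longleftrightarrow> \<epsilon> z x = \<epsilon> z x'"
    if x: "x \<in> carrier (?V z)" and x': "x' \<in> carrier (?V z)" for z x x'
  proof -
    have cl: "?c z x \<in> pcarrier (cohomology F 0) z" "?c z x' \<in> pcarrier (cohomology F 0) z"
      unfolding cohomology_carrier top using x x' by blast+
    have m: "cohomology_map F' 0 z (f 0 z) (?c z x) = ?c' z (f 0 z x)" if "x \<in> carrier (?V z)" for x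
      by (rule cohomology_map_class[OF F F' _ chain_mapD(1)[OF cm] chain_map_cocycles(2)[OF F F' cm]])
        (simp_all add: top that)
    have "inj_on (cohomology_map F' 0 z (f 0 z)) (pcarrier (cohomology F 0) z)"
      using f unfolding quasi_isomorphism_def bij_betw_def by blast
    from inj_on_eq_iff[OF this cl] have "?c' z (f 0 z x) = ?c' z (f 0 z x') \<longleftrightarrow> ?c z x = ?c z x'"
      unfolding m[OF x] m[OF x'] .
    then show ?thesis using augmentation_fiber[OF F zero M \<epsilon> x x'] by simp
  qed
  define \<epsilon>' where "\<epsilon>' = (\<lambda>z y. \<epsilon> z (SOME x. P z y x))"
  have \<epsilon>'_eq: "\<epsilon>' z y = \<epsilon> z x" if "P z y x" for z y x
  proof -
    have P: "P z y (SOME x. P z y x)" using that by (rule someI)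
    have "?c' z (f 0 z (SOME x. P z y x)) = ?c' z (f 0 z x)" using P that unfolding P_def by simp
    then show ?thesis unfolding \<epsilon>'_def using fiber P that unfolding P_def by blast
  qed
  have P_f: "P z (f 0 z x) x" if "x \<in> carrier (?V z)" for z x using that unfolding P_def by simp
  have "augmentation F' M \<epsilon>'"
    unfolding augmentation_def
  proof (intro conjI allI ballI impI)
    show "pmorphism (pobj F' 0) M \<epsilon>'"
    proof (rule pmorphismI)
      fix z
      show "\<epsilon>' z \<in> module_hom class_ring (?W z) (pspace M z)"
      proof (rule class_module_homI)
        fix y assume y: "y \<in> carrier (?W z)"
        obtain x where x: "P z y x" using ex[OF y] by blast
        then have xc: "x \<in> carrier (?V z)" and cx: "?c' z y = ?c' z (f 0 z x)" unfolding P_def by blast+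
        show "\<epsilon>' z y \<in> carrier (pspace M z)" unfolding \<epsilon>'_eq[OF x] by (rule eh(1)[OF xc])
        fix a
        have "?c' z (a \<odot>\<^bsub>?W z\<^esub> y) = (\<Union>w\<in>?c' z y. ?c' z (a \<odot>\<^bsub>?W z\<^esub> w))"
          by (rule submodule.coset_smult[OF B' _ y, symmetric]) simp
        also have "\<dots> = ?c' z (a \<odot>\<^bsub>?W z\<^esub> f 0 z x)"
          unfolding cx by (rule submodule.coset_smult[OF B' _ fh(1)[OF xc]]) simp
        finally have "P z (a \<odot>\<^bsub>?W z\<^esub> y) (a \<odot>\<^bsub>?V z\<^esub> x)"
          unfolding P_def fh(3)[OF xc] using vectorspace_closed(3)[OF V xc] by blast
        then show "\<epsilon>' z (a \<odot>\<^bsub>?W z\<^esub> y) = a \<odot>\<^bsub>pspace M z\<^esub> \<epsilon>' z y"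
          unfolding \<epsilon>'_eq[OF x] using \<epsilon>'_eq eh(3)[OF xc] by simp
        fix y' assume y': "y' \<in> carrier (?W z)"
        obtain x' where x': "P z y' x'" using ex[OF y'] by blast
        then have xc': "x' \<in> carrier (?V z)" and cx': "?c' z y' = ?c' z (f 0 z x')" unfolding P_def by blast+
        have "?c' z (y \<oplus>\<^bsub>?W z\<^esub> y') = ?c' z y <+>\<^bsub>?W z\<^esub> ?c' z y'"
          by (rule submodule.coset_set_add[OF B' y y', symmetric])
        also have "\<dots> = ?c' z (f 0 z x \<oplus>\<^bsub>?W z\<^esub> f 0 z x')"
          unfolding cx cx' by (rule submodule.coset_set_add[OF B' fh(1)[OF xc] fh(1)[OF xc']])
        finally have "P z (y \<oplus>\<^bsub>?W z\<^esub> y') (x \<oplus>\<^bsub>?V z\<^esub> x')"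
          unfolding P_def fh(2)[OF xc xc'] using vectorspace_closed(2)[OF V xc xc'] by blast
        then show "\<epsilon>' z (y \<oplus>\<^bsub>?W z\<^esub> y') = \<epsilon>' z y \<oplus>\<^bsub>pspace M z\<^esub> \<epsilon>' z y'"
          unfolding \<epsilon>'_eq[OF x] \<epsilon>'_eq[OF x'] using \<epsilon>'_eq eh(2)[OF xc xc'] by simp
      qed
    next
      fix z w y assume zw: "z \<le> w" and y: "y \<in> carrier (?W z)"
      let ?p = "pmap (pobj F 0) z w" and ?p' = "pmap (pobj F' 0) z w"
      obtain x where x: "P z y x" using ex[OF y] by blast
      then have xc: "x \<in> carrier (?V z)" and cx: "?c' z y = ?c' z (f 0 z x)" unfolding P_def by blast+
      have px: "?p x \<in> carrier (?V w)" by (rule class_module_homD(1)[OF cochain_complex_pmap[OF F zw] xc])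
      have "?c' w (?p' y) = pmap (cohomology F' 0) z w (?c' z y)"
        by (rule cohomology_pmap_class[OF F' zw, symmetric]) (simp add: top' y)
      also have "\<dots> = ?c' w (?p' (f 0 z x))"
        unfolding cx by (rule cohomology_pmap_class[OF F' zw]) (simp add: top' fh(1)[OF xc])
      finally have "P w (?p' y) (?p x)" unfolding P_def chain_mapD(3)[OF cm zw xc] using px by blast
      then show "\<epsilon>' w (?p' y) = pmap M z w (\<epsilon>' z y)"
        unfolding \<epsilon>'_eq[OF x] using \<epsilon>'_eq pmorphismD(2)[OF augmentationD(1)[OF \<epsilon>] zw xc] by simp
    qed
  next
    fix z
    show "\<epsilon>' z ` carrier (?W z) = pcarrier M z"
    proof (intro equalityI subsetI)
      fix m assume "m \<in> \<epsilon>' z ` carrier (?W z)"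
      then obtain y where y: "y \<in> carrier (?W z)" "m = \<epsilon>' z y" by blast
      obtain x where x: "P z y x" using ex[OF y(1)] by blast
      then have "x \<in> carrier (?V z)" unfolding P_def by blast
      then show "m \<in> pcarrier M z" unfolding y(2) \<epsilon>'_eq[OF x] by (rule eh(1))
    next
      fix m assume "m \<in> pcarrier M z"
      then obtain x where x: "x \<in> carrier (?V z)" "m = \<epsilon> z x"
        unfolding augmentationD(2)[OF \<epsilon>, symmetric] by blast
      show "m \<in> \<epsilon>' z ` carrier (?W z)"
        unfolding x(2) \<epsilon>'_eq[OF P_f[OF x(1)], symmetric] by (rule imageI[OF fh(1)[OF x(1)]])
    qed
  next
    fix z y assume y: "y \<in> carrier (?W z)"
    obtain x where x: "P z y x" using ex[OF y] by blast
    then have xc: "x \<in> carrier (?V z)" and cx: "?c' z y = ?c' z (f 0 z x)" unfolding P_def by blast+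
    have "y \<in> coboundaries F' 0 z \<longleftrightarrow> ?c' z y = coboundaries F' 0 z"
      using cohomology_class_zero_iff[OF F', of y 0 z] y unfolding top' by simp
    also have "\<dots> \<longleftrightarrow> f 0 z x \<in> coboundaries F' 0 z"
      unfolding cx using cohomology_class_zero_iff[OF F', of "f 0 z x" 0 z] fh(1)[OF xc] unfolding top' by simp
    also have "\<dots> \<longleftrightarrow> x \<in> coboundaries F 0 z"
      using quasi_isomorphismD(2)[OF F F' f, of x 0 z] chain_map_cocycles(2)[OF F F' cm, of x 0 z] xc
      unfolding top by blast
    also have "\<dots> \<longleftrightarrow> \<epsilon>' z y = \<zero>\<^bsub>pspace M z\<^esub>"
      unfolding \<epsilon>'_eq[OF x] using augmentationD(3)[OF \<epsilon> xc] by blast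
    finally show "\<epsilon>' z y = \<zero>\<^bsub>pspace M z\<^esub> \<longleftrightarrow> y \<in> coboundaries F' 0 z" by blast
  next
    fix d :: int and z assume d: "d \<noteq> 0"
    show "cocycles F' d z \<subseteq> coboundaries F' d z"
    proof
      fix y assume "y \<in> cocycles F' d z"
      then obtain x b where x: "x \<in> cocycles F d z" and b: "b \<in> coboundaries F' d z"
        "y = b \<oplus>\<^bsub>pspace (pobj F' d) z\<^esub> f d z x"
        using quasi_isomorphismD(1)[OF F F' f] by blast
      have "x \<in> coboundaries F d z" using x augmentationD(4)[OF \<epsilon> d] by blast
      then have "f d z x \<in> coboundaries F' d z" by (rule chain_map_cocycles(2)[OF F F' cm])
      then show "y \<in> coboundaries F' d z"
        unfolding b(2) using coboundaries_submodule[OF F', of d z] b(1) unfolding submodule_def by blast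
    qed
  qed
  then show ?thesis by blast
qed

section \<open>Complexes given by graded matrices\<close>

lemma free_pm_simps:
  "pspace (free_pm gs) z = free_space gs z" "pmap (free_pm gs) z w v = v"
  "\<zero>\<^bsub>free_space gs z\<^esub> = 0\<^sub>v (length gs)" "x \<oplus>\<^bsub>free_space gs z\<^esub> y = x + y"
  "a \<odot>\<^bsub>free_space gs z\<^esub> x = a \<cdot>\<^sub>v x"
  unfolding free_pm_def free_space_def by (simp_all add: module_vec_simps)

lemma carrier_free_space: "carrier (free_space gs z) = free_at gs z"
  by (simp add: free_pm_simps)

lemma free_space_vectorspace:
  "vectorspace class_ring (free_space gs z :: ('k::field, 'k vec) module)"
  "vectorspace.fin_dim class_ring (free_space gs z :: ('k::field, 'k vec) module)"
proof -
  let ?V = "module_vec TYPE('k) (length gs)"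
  let ?W = "free_at gs z :: 'k vec set"
  have V: "vectorspace class_ring ?V" by (rule vec_vs)
  have fd: "vectorspace.fin_dim class_ring ?V" by (rule vec_space.fin_dim)
  have sub: "submodule class_ring ?W ?V"
  proof (rule class_submoduleI[OF V]; unfold module_vec_simps)
    show "?W \<subseteq> carrier_vec (length gs)" using free_atD(1) by blast
    show "0\<^sub>v (length gs) \<in> ?W" by (rule zero_free_at)
    show "x + y \<in> ?W" if x: "x \<in> ?W" and y: "y \<in> ?W" for x y
    proof (rule free_atI)
      note dim = free_atD(1)[OF x] free_atD(1)[OF y]
      show "x + y \<in> carrier_vec (length gs)" using dim by simp
      fix i assume i: "i < length gs" "(x + y) $ i \<noteq> 0"
      then have "x $ i \<noteq> 0 \<or> y $ i \<noteq> 0" using dim by auto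
      then show "gs ! i \<le> z" using i(1) free_atD(2)[OF x] free_atD(2)[OF y] by blast
    qed
    show "a \<cdot>\<^sub>v x \<in> ?W" if x: "x \<in> ?W" for a x
    proof (rule free_atI)
      show "a \<cdot>\<^sub>v x \<in> carrier_vec (length gs)" using free_atD(1)[OF x] by simp
      fix i assume i: "i < length gs" "(a \<cdot>\<^sub>v x) $ i \<noteq> 0"
      then have "x $ i \<noteq> 0" using free_atD(1)[OF x] by auto
      then show "gs ! i \<le> z" by (rule free_atD(2)[OF x i(1)])
    qed
  qed
  have eq: "(free_space gs z :: ('k, 'k vec) module) = ?V\<lparr>carrier := ?W\<rparr>"
    unfolding free_pm_carrier unfolding free_space_def ..
  show "vectorspace class_ring (free_space gs z :: ('k, 'k vec) module)"
    "vectorspace.fin_dim class_ring (free_space gs z :: ('k, 'k vec) module)"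
    unfolding eq using submodule_carrier_update(1,3)[OF V sub] fd by blast+
qed

lemma free_at_mono: "z \<le> w \<Longrightarrow> free_at gs z \<subseteq> free_at gs w"
  unfolding free_pm_carrier using order_trans by blast

lemma persistence_module_free: "persistence_module (free_pm gs :: ('k::field, 'k vec) pmodule)"
  unfolding persistence_module_def
proof (intro conjI allI impI ballI)
  fix z w :: grade assume zw: "z \<le> w"
  show "pmap (free_pm gs) z w \<in> module_hom class_ring (pspace (free_pm gs) z) (pspace (free_pm gs :: ('k, 'k vec) pmodule) w)"
  proof (rule class_module_homI)
    show "pmap (free_pm gs) z w x \<in> free_at gs w" if "x \<in> free_at gs z" for x :: "'k vec"
      unfolding free_pm_simps(2) using free_at_mono[OF zw] that by blast
  qed (simp_all add: free_pm_simps)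
qed (simp_all add: free_pm_simps free_space_vectorspace)

lemma pmorphism_free:
  assumes X: "graded_mat X rs cs"
  shows "pmorphism (free_pm cs) (free_pm rs) (\<lambda>z v. X *\<^sub>v v)"
proof (rule pmorphismI)
  note dim = graded_matD(1)[OF X]
  show "(\<lambda>v. X *\<^sub>v v) \<in> module_hom class_ring (pspace (free_pm cs) z) (pspace (free_pm rs) z)" for z
  proof (rule class_module_homI)
    show "X *\<^sub>v v \<in> free_at rs z" if "v \<in> free_at cs z" for v by (rule graded_mat_mult_vec[OF X that])
    show "X *\<^sub>v (x \<oplus>\<^bsub>pspace (free_pm cs) z\<^esub> y) = X *\<^sub>v x \<oplus>\<^bsub>pspace (free_pm rs) z\<^esub> X *\<^sub>v y"
      if "x \<in> free_at cs z" "y \<in> free_at cs z" for x y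
      unfolding free_pm_simps by (rule mult_add_distrib_mat_vec[OF dim free_atD(1)[OF that(1)] free_atD(1)[OF that(2)]])
    show "X *\<^sub>v (a \<odot>\<^bsub>pspace (free_pm cs) z\<^esub> x) = a \<odot>\<^bsub>pspace (free_pm rs) z\<^esub> (X *\<^sub>v x)"
      if "x \<in> free_at cs z" for a x
      unfolding free_pm_simps by (rule mult_mat_vec[OF dim free_atD(1)[OF that]])
  qed
qed (simp add: free_pm_simps)

lemma pmorphism_free_zero: "pmorphism (free_pm cs :: ('k::field, 'k vec) pmodule) (free_pm rs) (\<lambda>z v. 0\<^sub>v (length rs))"
proof (rule pmorphismI)
  show "(\<lambda>v. 0\<^sub>v (length rs)) \<in> module_hom class_ring (pspace (free_pm cs :: ('k, 'k vec) pmodule) z) (pspace (free_pm rs) z)" for z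
  proof (rule class_module_homI)
    show "0\<^sub>v (length rs) \<in> (free_at rs z :: 'k vec set)" by (rule zero_free_at)
    show "0\<^sub>v (length rs) = a \<odot>\<^bsub>pspace (free_pm rs) z\<^esub> 0\<^sub>v (length rs)" for a :: 'k
      unfolding free_pm_simps by (rule eq_vecI) simp_all
  qed (simp_all add: free_pm_simps)
qed (simp add: free_pm_simps)

section \<open>The three-term complex of a pair of matrices\<close>

lemma matrix_complex_simps:
  "pobj (matrix_complex (A, B)) 0 = free_pm (rgr B)"
  "pobj (matrix_complex (A, B)) (-1) = free_pm (cgr B)"
  "pobj (matrix_complex (A, B)) (-2) = free_pm (cgr A)"
  "d \<noteq> 0 \<Longrightarrow> d \<noteq> -1 \<Longrightarrow> d \<noteq> -2 \<Longrightarrow> pobj (matrix_complex (A, B)) d = free_pm []"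
  "pdiff (matrix_complex (A, B)) 0 z = (\<lambda>v. ent B *\<^sub>v v)"
  "pdiff (matrix_complex (A, B)) (-1) z = (\<lambda>v. ent A *\<^sub>v v)"
  "pdiff (matrix_complex (A, B)) (-2) z = (\<lambda>v. 0\<^sub>v (length (cgr A)))"
  "d \<noteq> 0 \<Longrightarrow> d \<noteq> -1 \<Longrightarrow> d \<noteq> -2 \<Longrightarrow> pdiff (matrix_complex (A, B)) d z = (\<lambda>v. 0\<^sub>v 0)"
  unfolding matrix_complex_def by auto

lemma represents_chain_complexD:
  assumes "represents_chain_complex (A, B)"
  shows "graded_mat (ent A) (rgr A) (cgr A)" "graded_mat (ent B) (rgr B) (cgr B)" "rgr A = cgr B"
    "ent B * ent A = 0\<^sub>m (length (rgr B)) (length (cgr A))"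
  using assms unfolding represents_chain_complex_def morphism_matrix_graded_mat by auto

lemma matrix_complex_cochain_complex:
  fixes A B :: "'k::field gmatrix"
  assumes P: "represents_chain_complex (A, B)"
  shows "cochain_complex (matrix_complex (A, B))"
    and "free_finite_rank (pobj (matrix_complex (A, B)) d)"
    and "\<forall>d>0. zero_pmodule (pobj (matrix_complex (A, B)) d)"
proof -
  let ?F = "matrix_complex (A, B)"
  note D = represents_chain_complexD[OF P]
  have gs: "\<exists>gs. pobj ?F d = free_pm gs" for d
    unfolding matrix_complex_def by auto
  show "free_finite_rank (pobj ?F d)"
  proof -
    obtain gs where "pobj ?F d = free_pm gs" using gs by blast
    moreover have "pisomorphism (free_pm gs) (free_pm gs :: ('k, 'k vec) pmodule) (\<lambda>z v. v)"
      unfolding pisomorphism_def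
      by (auto intro!: pmorphismI class_module_homI simp: free_pm_simps bij_betw_def)
    ultimately show ?thesis unfolding free_finite_rank_def by metis
  qed
  show "\<forall>d>0. zero_pmodule (pobj ?F d)"
  proof (intro allI impI)
    fix d :: int assume "d > 0"
    then have "pobj ?F d = free_pm []" by (intro matrix_complex_simps(4)) auto
    then show "zero_pmodule (pobj ?F d)"
      unfolding zero_pmodule_def by (auto simp: free_pm_simps(1,3)) (auto simp: carrier_free_space free_pm_carrier)
  qed
  show "cochain_complex ?F"
    unfolding cochain_complex_def
  proof (intro conjI allI ballI)
    show "persistence_module (pobj ?F d)" for d using gs[of d] persistence_module_free by metis
  next
    fix d :: int
    consider "d = 0" | "d = -1" | "d = -2" | "d \<noteq> 0" "d \<noteq> -1" "d \<noteq> -2" by blast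
    then show "pmorphism (pobj ?F (d - 1)) (pobj ?F d) (pdiff ?F d)"
    proof cases
      case 1
      then show ?thesis using pmorphism_free[OF D(2)] unfolding matrix_complex_def by simp
    next
      case 2
      then show ?thesis using pmorphism_free[OF D(1)] D(3) unfolding matrix_complex_def by simp
    next
      case 3
      then show ?thesis using pmorphism_free_zero[of "[]" "cgr A"] unfolding matrix_complex_def by simp
    next
      case 4
      obtain gs where "pobj ?F (d - 1) = free_pm gs" using gs by blast
      moreover have "pdiff ?F d = (\<lambda>z v. 0\<^sub>v (length ([] :: grade list)))"
        by (intro ext) (simp add: matrix_complex_simps(8)[OF 4])
      ultimately show ?thesis
        unfolding matrix_complex_simps(4)[OF 4] using pmorphism_free_zero[of gs "[]"] by simp
    qed
  next
    fix d :: int and z x assume x: "x \<in> pcarrier (pobj ?F (d - 1)) z"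
    show "pdiff ?F (d + 1) z (pdiff ?F d z x) = \<zero>\<^bsub>pspace (pobj ?F (d + 1)) z\<^esub>"
    proof -
      consider "d + 1 = 0" | "d + 1 = -1" | "d + 1 = -2" | "d + 1 \<noteq> 0" "d + 1 \<noteq> -1" "d + 1 \<noteq> -2" by blast
      then show ?thesis
      proof cases
        case 1
        then have d: "d = -1" by simp
        then have xc: "x \<in> carrier_vec (length (cgr A))"
          using x free_atD(1)[of x "cgr A" z] by (simp add: matrix_complex_simps)
        then have "ent B *\<^sub>v (ent A *\<^sub>v x) = (ent B * ent A) *\<^sub>v x"
          using graded_matD(1)[OF D(1)] graded_matD(1)[OF D(2)] unfolding D(3) by simp
        also have "\<dots> = 0\<^sub>v (length (rgr B))" unfolding D(4) using xc by auto
        finally show ?thesis unfolding d by (simp add: matrix_complex_simps free_pm_simps)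
      next
        case 2
        then have d: "d = -2" by simp
        have "ent A *\<^sub>v 0\<^sub>v (length (cgr A)) = 0\<^sub>v (length (cgr B))"
          using graded_matD(1)[OF D(1)] unfolding D(3) by auto
        then show ?thesis unfolding d by (simp add: matrix_complex_simps free_pm_simps)
      next
        case 3
        then have d: "d = -3" by simp
        show ?thesis unfolding d by (simp add: matrix_complex_simps free_pm_simps)
      next
        case 4
        show ?thesis unfolding matrix_complex_simps(4,8)[OF 4] by (simp add: free_pm_simps)
      qed
    qed
  qed
qed

text \<open>The conditions on \<epsilon> concern degree zero, \<open>mid\<close> and
  \<open>inj\<close> are exactness in degrees -1 and -2, and in all other degrees the module is
  zero.\<close>

lemma matrix_complex_augmentation:
  fixes A B :: "'k::field gmatrix"
  assumes P: "represents_chain_complex (A, B)"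
    and \<epsilon>: "pmorphism (free_pm (rgr B)) M \<epsilon>"
    and surj: "\<And>z m. m \<in> pcarrier M z \<Longrightarrow> \<exists>x\<in>free_at (rgr B) z. \<epsilon> z x = m"
    and ker: "\<And>z x. x \<in> free_at (rgr B) z \<Longrightarrow>
      \<epsilon> z x = \<zero>\<^bsub>pspace M z\<^esub> \<longleftrightarrow> (\<exists>w\<in>free_at (cgr B) z. x = ent B *\<^sub>v w)"
    and mid: "\<And>z w. w \<in> free_at (cgr B) z \<Longrightarrow> ent B *\<^sub>v w = 0\<^sub>v (length (rgr B)) \<Longrightarrow>
      \<exists>v\<in>free_at (cgr A) z. w = ent A *\<^sub>v v"
    and inj: "\<And>z v. v \<in> free_at (cgr A) z \<Longrightarrow> ent A *\<^sub>v v = 0\<^sub>v (length (rgr A)) \<Longrightarrow> v = 0\<^sub>v (length (cgr A))"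
  shows "augmentation (matrix_complex (A, B)) M \<epsilon>"
  unfolding augmentation_def
proof (intro conjI allI ballI impI)
  let ?F = "matrix_complex (A, B)"
  note D = represents_chain_complexD[OF P]
  note F = matrix_complex_cochain_complex[OF P]
  show "pmorphism (pobj ?F 0) M \<epsilon>" unfolding matrix_complex_simps by (rule \<epsilon>)
  show "\<epsilon> z ` pcarrier (pobj ?F 0) z = pcarrier M z" for z
    unfolding matrix_complex_simps
    using surj class_module_homD(1)[OF pmorphismD(1)[OF \<epsilon>]] by (intro equalityI subsetI) blast+
  show "\<epsilon> z x = \<zero>\<^bsub>pspace M z\<^esub> \<longleftrightarrow> x \<in> coboundaries ?F 0 z" if "x \<in> pcarrier (pobj ?F 0) z" for z x
  proof -
    have "coboundaries ?F 0 z = (\<lambda>v. ent B *\<^sub>v v) ` free_at (cgr B) z"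
      unfolding coboundaries_def by (simp add: matrix_complex_simps)
    then show ?thesis using ker that unfolding matrix_complex_simps by blast
  qed
  fix d :: int and z assume d: "d \<noteq> 0"
  have zero_cob: "\<zero>\<^bsub>pspace (pobj ?F d) z\<^esub> \<in> coboundaries ?F d z"
    using coboundaries_submodule[OF F(1)] unfolding submodule_def by blast
  consider "d = -1" | "d = -2" | "d \<noteq> 0" "d \<noteq> -1" "d \<noteq> -2" using d by blast
  then show "cocycles ?F d z \<subseteq> coboundaries ?F d z"
  proof cases
    case 1
    have "cocycles ?F (-1) z = {w \<in> free_at (cgr B) z. ent B *\<^sub>v w = 0\<^sub>v (length (rgr B))}"
      unfolding cocycles_def by (simp add: matrix_complex_simps free_pm_simps)
    moreover have "coboundaries ?F (-1) z = (\<lambda>v. ent A *\<^sub>v v) ` free_at (cgr A) z"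
      unfolding coboundaries_def by (simp add: matrix_complex_simps)
    ultimately show ?thesis unfolding 1 using mid by blast
  next
    case 2
    have "cocycles ?F (-2) z = {v \<in> free_at (cgr A) z. ent A *\<^sub>v v = 0\<^sub>v (length (rgr A))}"
      unfolding cocycles_def D(3) by (simp add: matrix_complex_simps free_pm_simps)
    then have "cocycles ?F (-2) z \<subseteq> {0\<^sub>v (length (cgr A))}" using inj by blast
    then show ?thesis using zero_cob unfolding 2 matrix_complex_simps free_pm_simps by blast
  next
    case 3
    have "pcarrier (pobj ?F d) z = {0\<^sub>v 0}"
      unfolding matrix_complex_simps(4)[OF 3] by (auto simp: free_pm_carrier)
    then have "cocycles ?F d z \<subseteq> {0\<^sub>v 0}" unfolding cocycles_def by blast
    moreover have "0\<^sub>v 0 \<in> coboundaries ?F d z"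
      using zero_cob unfolding matrix_complex_simps(4)[OF 3] free_pm_simps by simp
    ultimately show ?thesis by blast
  qed
qed

section \<open>The main loop\<close>

lemma pisomorphismD:
  assumes "pisomorphism M N f"
  shows "f z \<in> module_hom class_ring (pspace M z) (pspace N z)"
    and "z \<le> w \<Longrightarrow> x \<in> pcarrier M z \<Longrightarrow> f w (pmap M z w x) = pmap N z w (f z x)"
    and "inj_on (f z) (pcarrier M z)" "f z ` pcarrier M z = pcarrier N z"
proof -
  have m: "pmorphism M N f" and b: "bij_betw (f z) (pcarrier M z) (pcarrier N z)"
    using assms unfolding pisomorphism_def by blast+
  show "f z \<in> module_hom class_ring (pspace M z) (pspace N z)" by (rule pmorphismD(1)[OF m])
  show "z \<le> w \<Longrightarrow> x \<in> pcarrier M z \<Longrightarrow> f w (pmap M z w x) = pmap N z w (f z x)"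
    by (rule pmorphismD(2)[OF m])
  show "inj_on (f z) (pcarrier M z)" by (rule bij_betw_imp_inj_on[OF b])
  show "f z ` pcarrier M z = pcarrier N z" by (rule bij_betw_imp_surj_on[OF b])
qed

text \<open>A complex with chosen bases, in which statements about \<open>C\<close> become
  statements about the matrices \<open>D d\<close>; the index of \<open>D\<close> is the degree of
  its source. Finiteness of the cohomology is represented by \<open>vanish\<close>.\<close>

locale based_complex =
  fixes C :: "('k::field, 'v) pcomplex" and \<Delta> :: "nat \<Rightarrow> 'k gmatrix"
    and G :: "nat \<Rightarrow> grade list" and \<phi> :: "nat \<Rightarrow> grade \<Rightarrow> 'k vec \<Rightarrow> 'v"
  assumes C: "cochain_complex C"
    and iso: "pisomorphism (free_pm (G d)) (pobj C (int d)) (\<phi> d)"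
    and mor: "morphism_matrix (\<Delta> (Suc d))"
    and grades: "cgr (\<Delta> (Suc d)) = G d" "rgr (\<Delta> (Suc d)) = G (Suc d)"
    and diff: "v \<in> free_at (G d) z \<Longrightarrow>
      pdiff C (int (Suc d)) z (\<phi> d z v) = \<phi> (Suc d) z (ent (\<Delta> (Suc d)) *\<^sub>v v)"
    and negative: "zero_pmodule (pobj C (-1))"
    and vanish: "\<exists>M. \<forall>z. M \<le> fst z \<or> M \<le> snd z \<longrightarrow>
      cocycles C (int d) z \<subseteq> coboundaries C (int d) z"
begin

abbreviation D :: "nat \<Rightarrow> 'k mat" where "D d \<equiv> ent (\<Delta> (Suc d))"

lemma D_graded: "graded_mat (D d) (G (Suc d)) (G d)"
  using mor[of d] unfolding morphism_matrix_graded_mat grades .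

lemma D_carrier: "D d \<in> carrier_mat (length (G (Suc d))) (length (G d))"
  by (rule graded_matD(1)[OF D_graded])

lemma phi_mem: "v \<in> free_at (G d) z \<Longrightarrow> \<phi> d z v \<in> pcarrier (pobj C (int d)) z"
  using pisomorphismD(4)[OF iso, of d z] by blast

lemma phi_surj: "x \<in> pcarrier (pobj C (int d)) z \<Longrightarrow> \<exists>v\<in>free_at (G d) z. x = \<phi> d z v"
  unfolding pisomorphismD(4)[OF iso, of d z, symmetric] by blast

lemma phi_inj: "u \<in> free_at (G d) z \<Longrightarrow> v \<in> free_at (G d) z \<Longrightarrow> \<phi> d z u = \<phi> d z v \<longleftrightarrow> u = v"
  using inj_on_eq_iff[OF pisomorphismD(3)[OF iso]] .

lemma phi_zero: "\<phi> d z (0\<^sub>v (length (G d))) = \<zero>\<^bsub>pspace (pobj C (int d)) z\<^esub>"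
proof -
  have V: "vectorspace class_ring (pspace (free_pm (G d) :: ('k, 'k vec) pmodule) z)"
    unfolding free_pm_simps by (rule free_space_vectorspace)
  show ?thesis
    using class_module_hom_zero[OF V cochain_complexD(1)[OF C] pisomorphismD(1)[OF iso]]
    unfolding free_pm_simps .
qed

lemma D_mem: "v \<in> free_at (G d) z \<Longrightarrow> D d *\<^sub>v v \<in> free_at (G (Suc d)) z"
  by (rule graded_mat_mult_vec[OF D_graded])

lemma cocycles_phi:
  assumes v: "v \<in> free_at (G d) z"
  shows "\<phi> d z v \<in> cocycles C (int d) z \<longleftrightarrow> D d *\<^sub>v v = 0\<^sub>v (length (G (Suc d)))"
proof -
  have i: "int d + 1 = int (Suc d)" by simp
  have "\<phi> d z v \<in> cocycles C (int d) z \<longleftrightarrow> \<phi> (Suc d) z (D d *\<^sub>v v) = \<phi> (Suc d) z (0\<^sub>v (length (G (Suc d))))"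
    unfolding cocycles_def i phi_zero using phi_mem[OF v] diff[OF v] by simp
  also have "\<dots> \<longleftrightarrow> D d *\<^sub>v v = 0\<^sub>v (length (G (Suc d)))"
    by (rule phi_inj[OF D_mem[OF v] zero_free_at])
  finally show ?thesis .
qed

lemma coboundaries_Suc:
  "coboundaries C (int (Suc d)) z = (\<lambda>u. \<phi> (Suc d) z (D d *\<^sub>v u)) ` free_at (G d) z"
proof -
  have i: "int (Suc d) - 1 = int d" by simp
  have "coboundaries C (int (Suc d)) z = pdiff C (int (Suc d)) z ` \<phi> d z ` free_at (G d) z"
    unfolding coboundaries_def i pisomorphismD(4)[OF iso, of d z, symmetric] ..
  also have "\<dots> = (\<lambda>u. \<phi> (Suc d) z (D d *\<^sub>v u)) ` free_at (G d) z"
    unfolding image_image by (rule image_cong[OF refl diff])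
  finally show ?thesis .
qed

lemma coboundaries_phi:
  assumes v: "v \<in> free_at (G (Suc d)) z"
  shows "\<phi> (Suc d) z v \<in> coboundaries C (int (Suc d)) z \<longleftrightarrow> (\<exists>u\<in>free_at (G d) z. v = D d *\<^sub>v u)"
  unfolding coboundaries_Suc using phi_inj[OF v D_mem] by blast

lemma coboundaries_0: "coboundaries C 0 z = {\<zero>\<^bsub>pspace (pobj C 0) z\<^esub>}"
proof -
  have "pcarrier (pobj C (-1)) z = {\<zero>\<^bsub>pspace (pobj C (-1)) z\<^esub>}"
    using negative unfolding zero_pmodule_def by (rule spec)
  then have "coboundaries C 0 z = {pdiff C 0 z \<zero>\<^bsub>pspace (pobj C (-1)) z\<^esub>}"
    unfolding coboundaries_def by simp
  moreover have "pdiff C 0 z \<zero>\<^bsub>pspace (pobj C (-1)) z\<^esub> = \<zero>\<^bsub>pspace (pobj C 0) z\<^esub>"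
    using class_module_hom_zero[OF cochain_complexD(1)[OF C] cochain_complexD(1)[OF C] cochain_complexD(3)[OF C, of 0 z]]
    by simp
  ultimately show ?thesis by simp
qed

lemma exact_eventually:
  "\<exists>M. \<forall>z v. (M \<le> fst z \<or> M \<le> snd z) \<longrightarrow> v \<in> free_at (G (Suc d)) z \<longrightarrow>
    D (Suc d) *\<^sub>v v = 0\<^sub>v (length (G (Suc (Suc d)))) \<longrightarrow> (\<exists>u\<in>free_at (G d) z. v = D d *\<^sub>v u)"
proof -
  obtain M where M: "\<And>z. M \<le> fst z \<or> M \<le> snd z \<Longrightarrow> cocycles C (int (Suc d)) z \<subseteq> coboundaries C (int (Suc d)) z"
    using vanish by blast
  show ?thesis
  proof (intro exI[of _ M] allI impI)
    fix z v assume z: "M \<le> fst z \<or> M \<le> snd z" and v: "v \<in> free_at (G (Suc d)) z"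
      and "D (Suc d) *\<^sub>v v = 0\<^sub>v (length (G (Suc (Suc d))))"
    then have "\<phi> (Suc d) z v \<in> cocycles C (int (Suc d)) z" using cocycles_phi by blast
    then show "\<exists>u\<in>free_at (G d) z. v = D d *\<^sub>v u" using M[OF z] coboundaries_phi[OF v] by blast
  qed
qed

text \<open>Read off in a grade above all generators, where \<open>v\<close> is an element of the
  module.\<close>

lemma D_D:
  assumes v: "v \<in> carrier_vec (length (G d))"
  shows "D (Suc d) *\<^sub>v (D d *\<^sub>v v) = 0\<^sub>v (length (G (Suc (Suc d))))"
proof -
  obtain z where "\<forall>g\<in>set (G d). g \<le> z" using grade_upper_bound by blast
  then have v: "v \<in> free_at (G d) z" using v by (simp only: free_at_UNIV)
  then have "\<phi> (Suc d) z (D d *\<^sub>v v) \<in> coboundaries C (int (Suc d)) z" unfolding coboundaries_Suc by blast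
  then have "\<phi> (Suc d) z (D d *\<^sub>v v) \<in> cocycles C (int (Suc d)) z" using coboundaries_subset[OF C] by blast
  then show ?thesis using cocycles_phi[OF D_mem[OF v]] by blast
qed

text \<open>Exactness in the colimit, proved in one grade that lies above all generators of degree
  \<open>Suc d\<close> and beyond the nonzero cohomology: there a kernel vector is a cocycle, hence
  a coboundary.\<close>

lemma range_eq_kernel:
  "mat_range (D d) = {v \<in> carrier_vec (length (G (Suc d))). D (Suc d) *\<^sub>v v = 0\<^sub>v (length (G (Suc (Suc d))))}"
proof (intro equalityI subsetI)
  fix v assume "v \<in> mat_range (D d)"
  then obtain u where "u \<in> carrier_vec (length (G d))" "v = D d *\<^sub>v u"
    unfolding mat_range_def using D_carrier[of d] by auto
  then show "v \<in> {v \<in> carrier_vec (length (G (Suc d))). D (Suc d) *\<^sub>v v = 0\<^sub>v (length (G (Suc (Suc d))))}"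
    using D_D[of u d] D_carrier[of d] by simp
next
  fix v assume "v \<in> {v \<in> carrier_vec (length (G (Suc d))). D (Suc d) *\<^sub>v v = 0\<^sub>v (length (G (Suc (Suc d))))}"
  then have v: "v \<in> carrier_vec (length (G (Suc d)))" "D (Suc d) *\<^sub>v v = 0\<^sub>v (length (G (Suc (Suc d))))" by blast+
  obtain M where M: "\<And>z v. M \<le> fst z \<or> M \<le> snd z \<Longrightarrow> v \<in> free_at (G (Suc d)) z \<Longrightarrow>
    D (Suc d) *\<^sub>v v = 0\<^sub>v (length (G (Suc (Suc d)))) \<Longrightarrow> \<exists>u\<in>free_at (G d) z. v = D d *\<^sub>v u"
    using exact_eventually[of d] by blast
  obtain z where z: "\<forall>g\<in>set (G (Suc d)). g \<le> z" "M \<le> fst z" using grade_upper_bound by blast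
  have "v \<in> free_at (G (Suc d)) z" unfolding free_at_UNIV[OF z(1)] by (rule v(1))
  then obtain u where u: "u \<in> free_at (G d) z" "v = D d *\<^sub>v u" using M[OF disjI1[OF z(2)] _ v(2)] by blast
  then show "v \<in> mat_range (D d)" unfolding mat_range_def using D_carrier[of d] free_atD(1)[OF u(1)] by auto
qed

text \<open>This connects what Bireduce computes, from the columns of \<open>D d\<close> alone, with
  the cocycles, which are defined by the next matrix.\<close>

lemma range_free_at_eq_kernel:
  "mat_range (D d) \<inter> free_at (G (Suc d)) z =
    {v \<in> free_at (G (Suc d)) z. D (Suc d) *\<^sub>v v = 0\<^sub>v (length (G (Suc (Suc d))))}"
  unfolding range_eq_kernel using free_atD(1) by blast

lemma vanish_Suc:
  "\<exists>M. \<forall>z v. M \<le> fst z \<or> M \<le> snd z \<longrightarrow> v \<in> mat_range (D d) \<longrightarrow> v \<in> free_at (G (Suc d)) z \<longrightarrow>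
    (\<exists>u\<in>free_at (G d) z. D d *\<^sub>v u = v)"
proof -
  obtain M where M: "\<And>z v. M \<le> fst z \<or> M \<le> snd z \<Longrightarrow> v \<in> free_at (G (Suc d)) z \<Longrightarrow>
    D (Suc d) *\<^sub>v v = 0\<^sub>v (length (G (Suc (Suc d)))) \<Longrightarrow> \<exists>u\<in>free_at (G d) z. v = D d *\<^sub>v u"
    using exact_eventually[of d] by blast
  show ?thesis
  proof (intro exI[of _ M] allI impI)
    fix z v assume z: "M \<le> fst z \<or> M \<le> snd z" and "v \<in> mat_range (D d)" and v: "v \<in> free_at (G (Suc d)) z"
    then have "D (Suc d) *\<^sub>v v = 0\<^sub>v (length (G (Suc (Suc d))))" unfolding range_eq_kernel by blast
    then show "\<exists>u\<in>free_at (G d) z. D d *\<^sub>v u = v" using M[OF z v] by metis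
  qed
qed

text \<open>There are no nonzero coboundaries in degree zero, and the structure maps of a free
  module are inclusions. A nonzero cocycle would therefore persist to the grade \<open>?w\<close>,
  where the cohomology vanishes.\<close>

lemma cohomology_0: "zero_pmodule (cohomology C 0)"
  unfolding zero_pmodule_def
proof
  fix z :: grade
  obtain M where M: "\<And>z. M \<le> fst z \<or> M \<le> snd z \<Longrightarrow> cocycles C 0 z \<subseteq> coboundaries C 0 z"
    using vanish[of 0, unfolded of_nat_0] by blast
  let ?w = "(max M (fst z), snd z)"
  have zw: "z \<le> ?w" by (simp add: less_eq_prod_def)
  have "cocycles C 0 z \<subseteq> coboundaries C 0 z"
  proof
    fix x assume x: "x \<in> cocycles C 0 z"
    then have "x \<in> pcarrier (pobj C (int 0)) z" unfolding cocycles_def by simp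
    then obtain v where v: "v \<in> free_at (G 0) z" "x = \<phi> 0 z v" using phi_surj by blast
    have "D 0 *\<^sub>v v = 0\<^sub>v (length (G (Suc 0)))" using x cocycles_phi[OF v(1)] unfolding v(2) by simp
    moreover have vw: "v \<in> free_at (G 0) ?w" using v(1) free_at_mono[OF zw] by blast
    ultimately have "\<phi> 0 ?w v \<in> coboundaries C 0 ?w" using cocycles_phi[OF vw] M[of ?w] by auto
    then have "\<phi> 0 ?w v = \<phi> 0 ?w (0\<^sub>v (length (G 0)))" unfolding coboundaries_0 phi_zero by simp
    then have "v = 0\<^sub>v (length (G 0))" using phi_inj[OF vw zero_free_at] by blast
    then show "x \<in> coboundaries C 0 z" unfolding v(2) coboundaries_0 using phi_zero[of 0 z] by simp
  qed
  then show "pcarrier (cohomology C 0) z = {\<zero>\<^bsub>pspace (cohomology C 0) z\<^esub>}"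
    using cohomology_trivial_iff[OF C] by blast
qed

text \<open>A kernel vector is a cocycle of degree zero in a large grade. Injectivity makes
  preimages of degree-one cocycles unique, on which the vanishing in degree one rests.\<close>

lemma D_0_injective:
  assumes v: "v \<in> carrier_vec (length (G 0))" and Dv: "D 0 *\<^sub>v v = 0\<^sub>v (length (G (Suc 0)))"
  shows "v = 0\<^sub>v (length (G 0))"
proof -
  obtain z where "\<forall>g\<in>set (G 0). g \<le> z" using grade_upper_bound by blast
  then have vz: "v \<in> free_at (G 0) z" using v by (simp only: free_at_UNIV)
  have "pcarrier (cohomology C 0) z = {\<zero>\<^bsub>pspace (cohomology C 0) z\<^esub>}"
    using cohomology_0 unfolding zero_pmodule_def by (rule spec)
  then have "cocycles C 0 z \<subseteq> coboundaries C 0 z" using cohomology_trivial_iff[OF C] by blast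
  then have "\<phi> 0 z v \<in> coboundaries C 0 z" using cocycles_phi[OF vz] Dv by auto
  then have "\<phi> 0 z v = \<phi> 0 z (0\<^sub>v (length (G 0)))" unfolding coboundaries_0 phi_zero by simp
  then show ?thesis using phi_inj[OF vz zero_free_at] by blast
qed

text \<open>The unique preimage of a cocycle lives in grades \<open>(N, y)\<close> and \<open>(x, N)\<close>, hence in their meet \<open>(x, y)\<close>.\<close>

lemma cohomology_1: "zero_pmodule (cohomology C 1)"
  unfolding zero_pmodule_def
proof
  fix z :: grade
  obtain M where M: "\<And>z v. M \<le> fst z \<or> M \<le> snd z \<Longrightarrow> v \<in> mat_range (D 0) \<Longrightarrow> v \<in> free_at (G (Suc 0)) z \<Longrightarrow>
    \<exists>u\<in>free_at (G 0) z. D 0 *\<^sub>v u = v"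
    using vanish_Suc[of 0] by blast
  let ?a = "(max M (fst z), snd z)" and ?b = "(fst z, max M (snd z))"
  have z: "z \<le> ?a" "z \<le> ?b" by (simp_all add: less_eq_prod_def)
  have "cocycles C (int (Suc 0)) z \<subseteq> coboundaries C (int (Suc 0)) z"
  proof
    fix x assume x: "x \<in> cocycles C (int (Suc 0)) z"
    then have "x \<in> pcarrier (pobj C (int (Suc 0))) z" unfolding cocycles_def by blast
    then obtain v where v: "v \<in> free_at (G (Suc 0)) z" "x = \<phi> (Suc 0) z v" using phi_surj by blast
    have "D (Suc 0) *\<^sub>v v = 0\<^sub>v (length (G (Suc (Suc 0))))" using x cocycles_phi[OF v(1)] unfolding v(2) by blast
    then have vr: "v \<in> mat_range (D 0)" unfolding range_eq_kernel using free_atD(1)[OF v(1)] by blast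
    have va: "v \<in> free_at (G (Suc 0)) ?a" and vb: "v \<in> free_at (G (Suc 0)) ?b"
      using v(1) free_at_mono[OF z(1)] free_at_mono[OF z(2)] by blast+
    obtain a where a: "a \<in> free_at (G 0) ?a" "D 0 *\<^sub>v a = v" using M[of ?a, OF _ vr va] by auto
    obtain b where b: "b \<in> free_at (G 0) ?b" "D 0 *\<^sub>v b = v" using M[of ?b, OF _ vr vb] by auto
    note ac = free_atD(1)[OF a(1)] and bc = free_atD(1)[OF b(1)]
    have "D 0 *\<^sub>v (a - b) = D 0 *\<^sub>v a - D 0 *\<^sub>v b" by (rule mult_minus_distrib_mat_vec[OF D_carrier ac bc])
    also have "\<dots> = 0\<^sub>v (length (G (Suc 0)))" unfolding a(2) b(2) using free_atD(1)[OF v(1)] by simp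
    finally have 0: "a - b = 0\<^sub>v (length (G 0))" using ac bc by (intro D_0_injective) auto
    have ab: "a = b"
    proof (rule eq_vecI)
      fix i assume "i < dim_vec b"
      then have i: "i < length (G 0)" using bc by simp
      then have "(a - b) $ i = 0" unfolding 0 by simp
      then show "a $ i = b $ i" using i ac bc by simp
    qed (use ac bc in simp)
    have "a \<in> free_at (G 0) z"
    proof (rule free_atI[OF ac])
      fix i assume i: "i < length (G 0)" "a $ i \<noteq> 0"
      have "G 0 ! i \<le> ?a" by (rule free_atD(2)[OF a(1) i])
      moreover have "G 0 ! i \<le> ?b" using i unfolding ab by (rule free_atD(2)[OF b(1)])
      ultimately show "G 0 ! i \<le> z" by (simp add: less_eq_prod_def)
    qed
    then show "x \<in> coboundaries C (int (Suc 0)) z"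
      unfolding v(2) coboundaries_phi[OF v(1)] using a(2) by blast
  qed
  then have "cocycles C 1 z \<subseteq> coboundaries C 1 z" by simp
  then show "pcarrier (cohomology C 1) z = {\<zero>\<^bsub>pspace (cohomology C 1) z\<^esub>}"
    using cohomology_trivial_iff[OF C] by blast
qed

text \<open>\<open>I\<close> is a basis of the cocycles of degree \<open>Suc d\<close>. Together
  with the coboundary matrix into the next cocycle module it gives the reference resolution, with
  which the output of MGSWithKer is compared.\<close>

lemma transposed_presentation_resolution:
  assumes spec: "mgs_with_ker_spec mgs" and I: "rgr I = G (Suc d)"
    and basis: "basis_matrix I (\<lambda>z. mat_range (D d) \<inter> free_at (G (Suc d)) z)"
    and res: "mgs (gtranspose I) = (I', P')"
  shows "represents_chain_complex (gtranspose I', gtranspose P')"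
    and "\<exists>\<epsilon>. augmentation (matrix_complex (gtranspose I', gtranspose P')) (cohomology C (int (Suc (Suc d)))) \<epsilon>"
proof -
  define A where "A = gtranspose I'"
  define B where "B = gtranspose P'"
  let ?H = "cohomology C (int (Suc (Suc d)))"
  let ?r = "G (Suc d)" and ?r' = "G (Suc (Suc d))" and ?D = "D (Suc d)"
  have mI: "morphism_matrix I" using basis unfolding basis_matrix_def by blast
  note AB = mgs_with_ker_transposed[OF spec mI res, folded A_def B_def]
  show P: "represents_chain_complex (gtranspose I', gtranspose P')"
    unfolding represents_chain_complex_def A_def[symmetric] B_def[symmetric]
    using AB(2-4) dual_exact_composition[OF AB(5)] by simp
  \<comment> \<open>The next cocycle module only has to be known to be free. Its basis is obtained
    from the uncleared matrix and need not be the one that the next pass computes.\<close>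
  obtain J where J: "rgr J = ?r'" "basis_matrix J (\<lambda>z. mat_range ?D \<inter> free_at ?r' z)"
    using bireduce_correct[of "\<Delta> (Suc (Suc d))"] mor[of "Suc d"]
    unfolding morphism_matrix_def grades by blast
  have gI: "graded_mat (ent I) ?r (cgr I)" using mI unfolding morphism_matrix_graded_mat I .
  have gJ: "graded_mat (ent J) ?r' (cgr J)"
    using J(2) unfolding basis_matrix_def morphism_matrix_graded_mat J(1) by blast
  have bI: "bij_betw (\<lambda>v. ent I *\<^sub>v v) (free_at (cgr I) z) {v \<in> free_at ?r z. ?D *\<^sub>v v = 0\<^sub>v (length ?r')}" for z
    using basis unfolding basis_matrix_def range_free_at_eq_kernel by blast
  have bJ: "bij_betw (\<lambda>v. ent J *\<^sub>v v) (free_at (cgr J) z) (mat_range ?D \<inter> free_at ?r' z)" for z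
    using J(2) unfolding basis_matrix_def by blast
  obtain M where M: "\<And>z v. M \<le> fst z \<or> M \<le> snd z \<Longrightarrow> v \<in> mat_range ?D \<Longrightarrow> v \<in> free_at ?r' z \<Longrightarrow>
      \<exists>u\<in>free_at ?r z. ?D *\<^sub>v u = v"
    using vanish_Suc[of "Suc d"] by blast
  have ex: "dual_exact (ent A) (ent B) (cgr I) (rgr A) (rgr B)" using AB(5) unfolding AB(1) .
  have im: "(\<lambda>u. transpose_mat (ent A) *\<^sub>v u) ` cofree_at (rgr A) w =
      (\<lambda>u. transpose_mat (ent I) *\<^sub>v u) ` cofree_at ?r w" for w
    using AB(6)[of w] unfolding I .
  obtain E where gE: "graded_mat E ?r' (rgr B)"
    and E_range: "\<And>x. x \<in> carrier_vec (length (rgr B)) \<Longrightarrow> E *\<^sub>v x \<in> mat_range ?D"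
    and E_surj: "\<And>z y. y \<in> mat_range ?D \<Longrightarrow> y \<in> free_at ?r' z \<Longrightarrow>
      \<exists>x\<in>free_at (rgr B) z. \<exists>u\<in>free_at ?r z. E *\<^sub>v x = y + ?D *\<^sub>v u"
    and E_ker: "\<And>z x u. x \<in> free_at (rgr B) z \<Longrightarrow> u \<in> free_at ?r z \<Longrightarrow> E *\<^sub>v x = ?D *\<^sub>v u \<Longrightarrow>
      \<exists>w\<in>free_at (rgr A) z. x = ent B *\<^sub>v w"
    and E_B: "\<And>z w. w \<in> free_at (rgr A) z \<Longrightarrow> \<exists>u\<in>free_at ?r z. E *\<^sub>v (ent B *\<^sub>v w) = ?D *\<^sub>v u"
    and mid: "\<And>z w. w \<in> free_at (rgr A) z \<Longrightarrow> ent B *\<^sub>v w = 0\<^sub>v (length (rgr B)) \<Longrightarrow>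
      \<exists>v\<in>free_at (cgr I) z. w = ent A *\<^sub>v v"
    and inj: "\<And>z v. v \<in> free_at (cgr I) z \<Longrightarrow> ent A *\<^sub>v v = 0\<^sub>v (length (rgr A)) \<Longrightarrow> v = 0\<^sub>v (length (cgr I))"
    by (rule dual_resolution[OF D_graded gI gJ bI bJ M ex im]) (assumption | rule that)+
  let ?V = "\<lambda>z. pspace (pobj C (int (Suc (Suc d)))) z"
  let ?c = "\<lambda>z x. coboundaries C (int (Suc (Suc d))) z +>\<^bsub>?V z\<^esub> x"
  let ?\<phi> = "\<phi> (Suc (Suc d))"
  \<comment> \<open>The class of the cocycle with coordinates \<open>E *\<^sub>v x\<close>.\<close>
  define \<epsilon> where "\<epsilon> = (\<lambda>z x. ?c z (?\<phi> z (E *\<^sub>v x)))"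
  note phi_hom = class_module_homD[OF pisomorphismD(1)[OF iso[of "Suc (Suc d)"]]]
  have phi_add: "?\<phi> z (x + y) = ?\<phi> z x \<oplus>\<^bsub>?V z\<^esub> ?\<phi> z y" if "x \<in> free_at ?r' z" "y \<in> free_at ?r' z" for z x y
    using phi_hom(2)[OF that] unfolding free_pm_simps .
  have phi_smult: "?\<phi> z (a \<cdot>\<^sub>v x) = a \<odot>\<^bsub>?V z\<^esub> ?\<phi> z x" if "x \<in> free_at ?r' z" for z a x
    using phi_hom(3)[OF that] unfolding free_pm_simps .
  have E_mem: "E *\<^sub>v x \<in> free_at ?r' z" if "x \<in> free_at (rgr B) z" for z x
    by (rule graded_mat_mult_vec[OF gE that])
  have E_cocycle: "?\<phi> z (E *\<^sub>v x) \<in> cocycles C (int (Suc (Suc d))) z" if x: "x \<in> free_at (rgr B) z" for z x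
    using E_range[OF free_atD(1)[OF x]] cocycles_phi[OF E_mem[OF x]] unfolding range_eq_kernel by blast
  note Ec = graded_matD(1)[OF gE]
  have c_hom: "?c z (x \<oplus>\<^bsub>?V z\<^esub> y) = ?c z x \<oplus>\<^bsub>pspace ?H z\<^esub> ?c z y" "?c z (a \<odot>\<^bsub>?V z\<^esub> x) = a \<odot>\<^bsub>pspace ?H z\<^esub> ?c z x"
    if "x \<in> cocycles C (int (Suc (Suc d))) z" "y \<in> cocycles C (int (Suc (Suc d))) z" for z x y a
    using class_module_homD(2,3)[OF cohomology_class_hom[OF C, of "int (Suc (Suc d))" z]] that by simp_all
  have \<epsilon>_mor: "pmorphism (free_pm (rgr B)) ?H \<epsilon>"
  proof (rule pmorphismI)
    show "\<epsilon> z \<in> module_hom class_ring (pspace (free_pm (rgr B)) z) (pspace ?H z)" for z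
    proof (rule class_module_homI)
      fix x :: "'k vec" assume x: "x \<in> free_at (rgr B) z"
      note xc = free_atD(1)[OF x]
      show "\<epsilon> z x \<in> pcarrier ?H z"
        unfolding \<epsilon>_def cohomology_carrier by (rule imageI[OF E_cocycle[OF x]])
      fix a
      have "?\<phi> z (E *\<^sub>v (a \<cdot>\<^sub>v x)) = a \<odot>\<^bsub>?V z\<^esub> ?\<phi> z (E *\<^sub>v x)"
        unfolding mult_mat_vec[OF Ec xc] by (rule phi_smult[OF E_mem[OF x]])
      then show "\<epsilon> z (a \<odot>\<^bsub>pspace (free_pm (rgr B)) z\<^esub> x) = a \<odot>\<^bsub>pspace ?H z\<^esub> \<epsilon> z x"
        unfolding free_pm_simps \<epsilon>_def using c_hom(2)[OF E_cocycle[OF x] E_cocycle[OF x]] by simp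
      fix y :: "'k vec" assume y: "y \<in> free_at (rgr B) z"
      have "?\<phi> z (E *\<^sub>v (x + y)) = ?\<phi> z (E *\<^sub>v x) \<oplus>\<^bsub>?V z\<^esub> ?\<phi> z (E *\<^sub>v y)"
        unfolding mult_add_distrib_mat_vec[OF Ec xc free_atD(1)[OF y]] by (rule phi_add[OF E_mem[OF x] E_mem[OF y]])
      then show "\<epsilon> z (x \<oplus>\<^bsub>pspace (free_pm (rgr B)) z\<^esub> y) = \<epsilon> z x \<oplus>\<^bsub>pspace ?H z\<^esub> \<epsilon> z y"
        unfolding free_pm_simps \<epsilon>_def using c_hom(1)[OF E_cocycle[OF x] E_cocycle[OF y]] by simp
    qed
    show "\<epsilon> w (pmap (free_pm (rgr B)) z w x) = pmap ?H z w (\<epsilon> z x)"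
      if zw: "z \<le> w" and x: "x \<in> free_at (rgr B) z" for z w x
    proof -
      have "pmap ?H z w (\<epsilon> z x) = ?c w (pmap (pobj C (int (Suc (Suc d)))) z w (?\<phi> z (E *\<^sub>v x)))"
        unfolding \<epsilon>_def by (rule cohomology_pmap_class[OF C zw E_cocycle[OF x]])
      also have "pmap (pobj C (int (Suc (Suc d)))) z w (?\<phi> z (E *\<^sub>v x)) = ?\<phi> w (E *\<^sub>v x)"
        using pisomorphismD(2)[OF iso zw E_mem[OF x]] unfolding free_pm_simps by (rule sym)
      finally show ?thesis unfolding \<epsilon>_def free_pm_simps by (rule sym)
    qed
  qed
  have "augmentation (matrix_complex (A, B)) ?H \<epsilon>"
  proof (rule matrix_complex_augmentation[OF _ \<epsilon>_mor])
    show "represents_chain_complex (A, B)" using P unfolding A_def B_def .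
    show "\<exists>x\<in>free_at (rgr B) z. \<epsilon> z x = m" if m: "m \<in> pcarrier ?H z" for z m
    proof -
      obtain s where s: "s \<in> cocycles C (int (Suc (Suc d))) z" "m = ?c z s"
        using m unfolding cohomology_carrier by blast
      obtain y where y: "y \<in> free_at ?r' z" "s = ?\<phi> z y"
        using phi_surj s(1) cocycles_carrier[OF C] by blast
      \<comment> \<open>A cocycle is a coboundary in the colimit, which puts its coordinates into
        the range on which \<open>E\<close> is known to be surjective modulo coboundaries.\<close>
      have "y \<in> mat_range ?D"
        using s(1) cocycles_phi[OF y(1)] free_atD(1)[OF y(1)] unfolding y(2) range_eq_kernel by blast
      then obtain x u where xu: "x \<in> free_at (rgr B) z" "u \<in> free_at ?r z" "E *\<^sub>v x = y + ?D *\<^sub>v u"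
        using E_surj[OF _ y(1)] by blast
      have Du: "?D *\<^sub>v u \<in> free_at ?r' z" by (rule D_mem[OF xu(2)])
      have "E *\<^sub>v x = ?D *\<^sub>v u + y"
        unfolding xu(3) by (rule comm_add_vec[OF free_atD(1)[OF y(1)] free_atD(1)[OF Du]])
      then have "?\<phi> z (E *\<^sub>v x) = ?\<phi> z (?D *\<^sub>v u) \<oplus>\<^bsub>?V z\<^esub> s"
        unfolding y(2) using phi_add[OF Du y(1)] by simp
      moreover have "?\<phi> z (?D *\<^sub>v u) \<in> coboundaries C (int (Suc (Suc d))) z"
        unfolding coboundaries_Suc using xu(2) by blast
      ultimately have "\<epsilon> z x = m"
        unfolding \<epsilon>_def s(2)
        using cohomology_class_eq_iff[OF C E_cocycle[OF xu(1)] s(1)] by blast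
      then show ?thesis using xu(1) by blast
    qed
    show "\<epsilon> z x = \<zero>\<^bsub>pspace ?H z\<^esub> \<longleftrightarrow> (\<exists>w\<in>free_at (cgr B) z. x = ent B *\<^sub>v w)"
      if x: "x \<in> free_at (rgr B) z" for z x
    proof -
      have "\<epsilon> z x = \<zero>\<^bsub>pspace ?H z\<^esub> \<longleftrightarrow> ?\<phi> z (E *\<^sub>v x) \<in> coboundaries C (int (Suc (Suc d))) z"
        unfolding \<epsilon>_def cohomology_space quotient_space_simps
        by (rule cohomology_class_zero_iff[OF C E_cocycle[OF x]])
      also have "\<dots> \<longleftrightarrow> (\<exists>u\<in>free_at ?r z. E *\<^sub>v x = ?D *\<^sub>v u)" by (rule coboundaries_phi[OF E_mem[OF x]])
      also have "\<dots> \<longleftrightarrow> (\<exists>w\<in>free_at (cgr B) z. x = ent B *\<^sub>v w)"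
        unfolding AB(2)[symmetric] using E_ker[OF x] E_B by blast
      finally show ?thesis .
    qed
    show "\<exists>v\<in>free_at (cgr A) z. w = ent A *\<^sub>v v"
      if "w \<in> free_at (cgr B) z" "ent B *\<^sub>v w = 0\<^sub>v (length (rgr B))" for z w
      using mid that unfolding AB(1) AB(2)[symmetric] by blast
    show "v = 0\<^sub>v (length (cgr A))" if "v \<in> free_at (cgr A) z" "ent A *\<^sub>v v = 0\<^sub>v (length (rgr A))" for z v
      using inj that unfolding AB(1) by blast
  qed
  then show "\<exists>\<epsilon>. augmentation (matrix_complex (gtranspose I', gtranspose P')) ?H \<epsilon>"
    unfolding A_def B_def by blast
qed

text \<open>The loop variable \<open>q\<close> retains only pivots, whereas clearing is justified by
  the kernel vectors having these pivots; \<open>Z\<close> keeps track of them. The new set consists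
  of the columns of \<open>I\<close>, which lie in the range of \<open>D d\<close> and so in the
  kernel of the next matrix.\<close>

lemma loop_body_correct:
  assumes mgs: "mgs_with_ker_spec mgs" and minimize: "minimize_spec minimize"
    and Z: "\<And>b. b \<in> Z \<Longrightarrow> b \<in> carrier_vec (length (G d)) \<and> b \<noteq> 0\<^sub>v (length (G d)) \<and>
      D d *\<^sub>v b = 0\<^sub>v (length (G (Suc d)))"
  shows "\<exists>Z' P. loop_body mgs minimize (\<Delta> (Suc d)) (piv ` Z) = Some (piv ` Z', P) \<and>
    represents_free_resolution P (cohomology C (int (Suc (Suc d)))) \<and>
    (\<forall>b\<in>Z'. b \<in> carrier_vec (length (G (Suc d))) \<and> b \<noteq> 0\<^sub>v (length (G (Suc d))) \<and>
      D (Suc d) *\<^sub>v b = 0\<^sub>v (length (G (Suc (Suc d)))))"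
proof -
  let ?A = "clear_columns (piv ` Z) (\<Delta> (Suc d))" and ?H = "cohomology C (int (Suc (Suc d)))"
  have "graded_matrix (\<Delta> (Suc d))" using mor unfolding morphism_matrix_def by blast
  then have gA: "graded_matrix ?A" by (rule graded_matrix_clear_columns)
  have rA: "mat_range (ent ?A) = mat_range (D d)" by (rule mat_range_clear_columns[OF D_carrier Z])
  obtain I where I: "bireduce ?A = Some I" "rgr I = G (Suc d)" "mat_range (ent I) = mat_range (D d)"
    "basis_matrix I (\<lambda>z. mat_range (D d) \<inter> free_at (G (Suc d)) z)"
    using bireduce_correct[OF gA] unfolding rA clear_columns_simps grades by blast
  obtain I' P' where mg: "mgs (gtranspose I) = (I', P')" by (cases "mgs (gtranspose I)")
  let ?P = "(gtranspose I', gtranspose P')"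
  let ?Z = "set (cols (ent I))"
  have out: "loop_body mgs minimize (\<Delta> (Suc d)) (piv ` Z) = Some (piv ` ?Z, minimize ?P)"
    unfolding loop_body_def using I(1) mg by (simp add: Let_def)
  note P = transposed_presentation_resolution[OF mgs I(2,4) mg]
  obtain \<epsilon> where \<epsilon>: "augmentation (matrix_complex ?P) ?H \<epsilon>" using P(2) by blast
  obtain A B where AB: "minimize ?P = (A, B)" by (cases "minimize ?P")
  have Q: "represents_chain_complex (A, B)" "quasi_isomorphic (matrix_complex ?P) (matrix_complex (A, B))"
    using minimize P(1) unfolding minimize_spec_def AB[symmetric] by blast+
  obtain f where f: "quasi_isomorphism (matrix_complex ?P) (matrix_complex (A, B)) f"
    using Q(2) unfolding quasi_isomorphic_def by blast
  note cP = matrix_complex_cochain_complex[OF P(1)] and cQ = matrix_complex_cochain_complex[OF Q(1)]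
  note H = cohomology_vectorspace(1)[OF C, of "int (Suc (Suc d))"]
  \<comment> \<open>Minimization provides a quasi-isomorphism out of the computed complex, along
    which the augmentation is pushed forward.\<close>
  obtain \<epsilon>' where "augmentation (matrix_complex (A, B)) ?H \<epsilon>'"
    using augmentation_transfer[OF cP(1,3) cQ(1,3) H \<epsilon> f] by blast
  then have "free_resolution (matrix_complex (A, B)) ?H"
    by (rule augmentation_free_resolution[OF cQ(1,2,3) H])
  then have "represents_free_resolution (minimize ?P) ?H"
    unfolding represents_free_resolution_def AB using Q(1) by blast
  moreover have "b \<in> carrier_vec (length (G (Suc d))) \<and> b \<noteq> 0\<^sub>v (length (G (Suc d))) \<and>
      D (Suc d) *\<^sub>v b = 0\<^sub>v (length (G (Suc (Suc d))))" if b: "b \<in> ?Z" for b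
  proof -
    have Ic: "ent I \<in> carrier_mat (length (G (Suc d))) (length (cgr I))"
      using I(4) unfolding basis_matrix_def morphism_matrix_def graded_matrix_def I(2) by blast
    then obtain j where j: "j < length (cgr I)" "b = col (ent I) j"
      using b by (auto simp: cols_def)
    have "b \<in> mat_range (ent I)"
      unfolding mat_range_def j(2) mult_unit_vec[OF Ic j(1), symmetric] using Ic by auto
    then have "b \<in> mat_range (D d)" unfolding I(3) .
    moreover have "b \<noteq> 0\<^sub>v (length (G (Suc d)))"
      using basis_matrix_col_nonzero[OF I(4) j(1)] unfolding j(2) I(2) .
    ultimately show ?thesis unfolding range_eq_kernel by blast
  qed
  ultimately show ?thesis using out by blast
qed

lemma iteration_correct:
  assumes mgs: "mgs_with_ker_spec mgs" and minimize: "minimize_spec minimize"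
  shows "\<exists>Z P. iteration mgs minimize \<Delta> d = Some (piv ` Z, P) \<and>
    represents_free_resolution P (cohomology C (int (Suc (Suc d)))) \<and>
    (\<forall>b\<in>Z. b \<in> carrier_vec (length (G (Suc d))) \<and> b \<noteq> 0\<^sub>v (length (G (Suc d))) \<and>
      D (Suc d) *\<^sub>v b = 0\<^sub>v (length (G (Suc (Suc d)))))"
proof (induction d)
  case 0
  \<comment> \<open>In the first pass \<open>q\<close> is empty, so there are no kernel vectors to
    account for.\<close>
  show ?case using loop_body_correct[OF mgs minimize, of "{}" 0] by simp
next
  case (Suc d)
  then obtain Z P where Z: "iteration mgs minimize \<Delta> d = Some (piv ` Z, P)"
    "\<And>b. b \<in> Z \<Longrightarrow> b \<in> carrier_vec (length (G (Suc d))) \<and> b \<noteq> 0\<^sub>v (length (G (Suc d))) \<and>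
      D (Suc d) *\<^sub>v b = 0\<^sub>v (length (G (Suc (Suc d))))"
    by blast
  have "iteration mgs minimize \<Delta> (Suc d) = loop_body mgs minimize (\<Delta> (Suc (Suc d))) (piv ` Z)"
    using Z(1) by simp
  then show ?case using loop_body_correct[OF mgs minimize Z(2)] by simp
qed

end

text \<open>The pass with index \<open>d\<close> uses the coboundary matrix into degree
  \<open>d + 1\<close>, whose target is the middle term of a resolution ending in the cocycles of
  degree \<open>d + 2\<close>; hence the shift. In degrees 0 and 1 the cohomology vanishes, so that
  all degrees \<open>d \<ge> 0\<close> are covered.\<close>

theorem corollary21:
  fixes C :: "('k::field, 'v) pcomplex"
    and \<Delta> :: "nat \<Rightarrow> 'k gmatrix"
    and mgs_with_ker :: "'k gmatrix \<Rightarrow> 'k gmatrix \<times> 'k gmatrix"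
    and minimize :: "'k gmatrix \<times> 'k gmatrix \<Rightarrow> 'k gmatrix \<times> 'k gmatrix"
  assumes "cochain_complex C"
    and "\<And>d. free_finite_rank (pobj C d)"
    and "\<And>d. d < 0 \<Longrightarrow> zero_pmodule (pobj C d)"
    and "(\<Sum>\<^sub>\<infinity>d. total_dim (cohomology C d)) < \<infinity>"
    and "represents_cochain_complex \<Delta> C"
    and "mgs_with_ker_spec mgs_with_ker"
    and "minimize_spec minimize"
  shows "(\<forall>d. \<exists>P. algorithm_output mgs_with_ker minimize \<Delta> d = Some P \<and>
            represents_free_resolution P (cohomology C (int d + 2))) \<and>
         zero_pmodule (cohomology C 0) \<and> zero_pmodule (cohomology C 1)"
proof -
  have "total_dim (cohomology C d) < \<infinity>" for d
  proof -
    have "total_dim (cohomology C d) = (\<Sum>\<^sub>\<infinity>d\<in>{d}. total_dim (cohomology C d))" by simp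
    also have "\<dots> \<le> (\<Sum>\<^sub>\<infinity>d. total_dim (cohomology C d))"
      by (intro infsum_mono_neutral nonneg_summable_on_complete) auto
    finally show ?thesis using assms(4) by (rule le_less_trans)
  qed
  then have vanish: "\<exists>M. \<forall>z. M \<le> fst z \<or> M \<le> snd z \<longrightarrow> cocycles C d z \<subseteq> coboundaries C d z" for d
    by (rule cohomology_vanishing[OF assms(1)])
  obtain G \<phi> where rep: "\<forall>d. pisomorphism (free_pm (G d)) (pobj C (int d)) (\<phi> d)"
    "\<forall>d. morphism_matrix (\<Delta> (Suc d)) \<and> cgr (\<Delta> (Suc d)) = G d \<and> rgr (\<Delta> (Suc d)) = G (Suc d) \<and>
        (\<forall>z. \<forall>v\<in>pcarrier (free_pm (G d)) z.
          pdiff C (int (Suc d)) z (\<phi> d z v) = \<phi> (Suc d) z (ent (\<Delta> (Suc d)) *\<^sub>v v))"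
    using assms(5) unfolding represents_cochain_complex_def by blast
  interpret based_complex C \<Delta> G \<phi>
  proof
    show "zero_pmodule (pobj C (-1))" by (rule assms(3)) simp
  qed (use assms(1) rep vanish in blast)+
  have "\<exists>P. algorithm_output mgs_with_ker minimize \<Delta> d = Some P \<and>
      represents_free_resolution P (cohomology C (int d + 2))" for d
  proof -
    have i: "int (Suc (Suc d)) = int d + 2" by simp
    obtain Z :: "'k vec set" and P where P: "iteration mgs_with_ker minimize \<Delta> d = Some (piv ` Z, P)"
      "represents_free_resolution P (cohomology C (int d + 2))"
      using iteration_correct[OF assms(6,7), of d] unfolding i by blast
    then show ?thesis unfolding algorithm_output_def by (intro exI[of _ P]) simp
  qed
  then show ?thesis using cohomology_0 cohomology_1 by blast
qed

end
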